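(* Let $(X,\mathcal{A},\mu,T,\xi)$ be a mixing probability preserving Gibbs-Markov system. Let $x^*\in X$ be a point such that the cylinder $A_l:=\xi_l(x^* )$ is defined for every $l\ge 1$, where $0<\mu(A_l)\to0$. Fix any $r>0$ and set $\mathcal{V}:=\{u\odot\mu:u\in\mathcal{U}(r)\}$ and $\mathcal{V}_l:=\{u\odot\mu:u\in\mathcal{U}_l\}$ with $\mathcal{U}_l:=\{u\in\mathcal{D}(\mu): u=1_{A_l}u\text{ and } \mathrm{R}_{A_l}(u)\le r\}$. Define $\theta$ as follows. A) If $x^*$ is not periodic, let $\theta:=1$. B) If $x^*$ is periodic, $T^p x^*=x^*$ with $p\ge 1$ minimal, let $\theta:=1-v'_{A_p}(x^* )\in(0,1)$. Then, in either case, for every $d\ge 1$ and $\delta\in(0,1]$, as $l\to\infty$, $$\nu\Big(\bigcap_{j=1}^d T_{A_l}^{-(j-1)}\{\varphi_{A_l}=k_l^{(j)}\}\Big)\sim\theta^{2d-1}\mu(A_l)^d\,e^{-\theta\mu(A_l)\sum_{j=1}^d k_l^{(j)}}$$ uniformly in $\nu\in\mathcal{V}$ and $(k_l^{(1)}),\ldots,(k_l^{(d)})\in\mathcal{K}_\delta(A_l)$, and $$\nu_l\Big(\bigcap_{j=1}^d T_{A_l}^{-(j-1)}\{\varphi_{A_l}=k_l^{(j)}\}\Big)\sim\theta^{2d}\mu(A_l)^d\,e^{-\theta\mu(A_l)\sum_{j=1}^d k_l^{(j)}}$$ uniformly in $(\nu_l)\in\prod_{l\ge 1}\mathcal{V}_l$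 and $(k_l^{(1)}),\ldots,(k_l^{(d)})\in\mathcal{K}_\delta(A_l)$.
   Context: Piecewise invertible systems. $(X,\mathrm{d}_X)$ is a metric space with $\mathrm{diam}(X)<\infty$ and Borel $\sigma$-algebra $\mathcal{A}$. A piecewise invertible probability preserving system is $(X,\mathcal{A},\mu,T,\xi)$ where $T:X\to X$ preserves the probability measure $\mu$, and $\xi$ is a finite or countable partition mod $\mu$ of $X$ into pairwise disjoint open sets such that the restriction of $T$ to each $Z\in\xi$ is a homeomorphism onto $TZ$. Let $\xi_n$ be the family of cylinders of rank $n$, i.e. sets $\bigcap_{i=0}^{n-1}T^{-i}Z_i$ with $Z_i\in\xi$ (so $\xi_1=\xi$), and $\xi_n(x)$ the element of $\xi_n$ containing $x$ (defined for a.e. $x$). For $Z\in\xi_n$, $v_Z:=(T^n|_Z)^{-1}:T^nZ\to Z$ is the inverse branch and $v_Z':=d(\mu\circ v_Z)/d\mu$. The system is uniformly expanding if there is $\rho\in(0,1)$ with $\mathrm{d}_X(x,y)\le\rho\,\mathrm{d}_X(Tx,Ty)$ whenever $x,y\in Z\in\xi$; its $n$-th iterate is $(X,\mathcal{A},\mu,T^n,\xi_n)$. It is Markov if $\mu(TZ\cap Z')>0$ for $Z,Z'\in\xi$ implies $Z'\subseteq TZ$. Gibbs-Markov. A Markov system is Gibbs-Markov if some iterate $T^N$ is uniformly expanding, $\inf_{Z\in\xi}\mu(TZ)>0$, and there are $r_0>0$ and versions of the $v_Z'$, $Z\in\xi$, such that $|v_Z'(x)/v_Z'(y)-1|\le r_0\,\mathrm{d}_X(x,y)$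 for $x,y\in TZ$, $Z\in\xi$. In this case $r_0$ can be chosen such that there are versions with $|v_Z'(x)/v_Z'(y)-1|\le r_0\,\mathrm{d}_X(x,y)$ for all $n\ge 1$, $Z\in\xi_n$, $x,y\in T^nZ$; $v_Z'$ always denotes such versions. Densities. $\mathcal{D}(\mu)$ is the set of probability densities w.r.t. $\mu$, $u\odot\mu(A):=\int_A u\,d\mu$. For $B\subseteq X$ and $w\ge 0$, $\mathrm{R}_B(w):=\inf\{s>0: w(x)\le(1+s\,\mathrm{d}_X(x,y))w(y)\text{ for } x,y\in B\}$ (with $\inf\varnothing=\infty$; for densities, conditions on $\mathrm{R}_B$ are understood for a suitable version). $\beta$ is the partition generated by $\{TZ:Z\in\xi\}$, $\mathrm{R}_\beta(w):=\sup_{B\in\beta}\mathrm{R}_B(w)$, and $\mathcal{U}(s):=\{u\in\mathcal{D}(\mu):\mathrm{R}_\beta(u)\le s\}$. Hitting times. $\varphi_A(x):=\inf\{n\ge 1:T^nx\in A\}\in\{1,2,\ldots,\infty\}$, and $T_Ax:=T^{\varphi_A(x)}x$ (defined a.e. if $\mu(A)>0$) is the first entrance map. For $\delta\in(0,1]$, $\mathcal{K}_\delta(A_l):=\{(k_l)_{l\ge 1}:k_l\in\mathbb{N},\ \delta\le\mu(A_l)k_l\le\delta^{-1}\text{ for } l\ge 1\}$. Uniformity of $a_l\sim b_l$ in some parameters means that for every $\varepsilon>0$ there is $l_0$ such that $|a_l/b_l-1|\le\varepsilon$ for all $l\ge l_0$ and all admissible parameters. *)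

theory Defs
  imports "HOL-Probability.Probability"
begin

section \<open>Piecewise invertible and Gibbs-Markov systems\<close>

text \<open>The metric space is a whole type of class \<^class>\<open>metric_space\<close>, so \<open>X = UNIV\<close>.\<close>

definition cylinders :: "('a \<Rightarrow> 'a) \<Rightarrow> 'a set set \<Rightarrow> nat \<Rightarrow> 'a set set" where
  "cylinders T \<xi> n = {\<Inter>i<n. (T ^^ i) -` Z i |Z. \<forall>i<n. Z i \<in> \<xi>}"

text \<open>\<open>g\<close> is a version of the density of \<open>\<mu> \<circ> v\<close> with respect to \<open>\<mu>\<close> on \<open>T\<^sup>n Z\<close>, where \<open>v\<close> is the inverse
  of \<open>T\<^sup>n\<close> restricted to \<open>Z\<close>. The values of \<open>g\<close> off \<open>T\<^sup>n Z\<close> are irrelevant. A set \<open>Z\<close> may be a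
  cylinder of several ranks, so the rank \<open>n\<close> is a separate argument.\<close>

definition inverse_branch_density ::
  "'a measure \<Rightarrow> ('a \<Rightarrow> 'a) \<Rightarrow> nat \<Rightarrow> 'a set \<Rightarrow> ('a \<Rightarrow> real) \<Rightarrow> bool" where
  "inverse_branch_density M T n Z g \<longleftrightarrow>
     g \<in> borel_measurable M \<and> (\<forall>x\<in>(T ^^ n) ` Z. 0 \<le> g x) \<and>
     (\<forall>E\<in>sets M. E \<subseteq> (T ^^ n) ` Z \<longrightarrow>
        emeasure M (inv_into Z (T ^^ n) ` E) = (\<integral>\<^sup>+x\<in>E. ennreal (g x) \<partial>M))"

text \<open>Since \<open>0 / 0 = 0\<close>, the case \<open>x = y\<close> forces \<open>g\<close> to have no zero in \<open>B\<close>.\<close>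

definition ratio_lipschitz_on :: "real \<Rightarrow> 'a::metric_space set \<Rightarrow> ('a \<Rightarrow> real) \<Rightarrow> bool" where
  "ratio_lipschitz_on r B g \<longleftrightarrow> (\<forall>x\<in>B. \<forall>y\<in>B. \<bar>g x / g y - 1\<bar> \<le> r * dist x y)"

definition uniformly_expanding :: "('a::metric_space \<Rightarrow> 'a) \<Rightarrow> 'a set set \<Rightarrow> bool" where
  "uniformly_expanding T \<xi> \<longleftrightarrow>
     (\<exists>\<rho>. 0 < \<rho> \<and> \<rho> < 1 \<and> (\<forall>Z\<in>\<xi>. \<forall>x\<in>Z. \<forall>y\<in>Z. dist x y \<le> \<rho> * dist (T x) (T y)))"

definition mixing :: "'a measure \<Rightarrow> ('a \<Rightarrow> 'a) \<Rightarrow> bool" where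
  "mixing M T \<longleftrightarrow>
     (\<forall>A\<in>sets M. \<forall>B\<in>sets M.
        (\<lambda>n. measure M (A \<inter> ((T ^^ n) -` B \<inter> space M))) \<longlonglongrightarrow> measure M A * measure M B)"

locale piecewise_invertible = prob_space M for M :: "'a::metric_space measure" +
  fixes T :: "'a \<Rightarrow> 'a" and \<xi> :: "'a set set"
  assumes bounded_space: "bounded (UNIV :: 'a set)"
    and sets_eq_borel: "sets M = sets borel"
    and measurable_T: "T \<in> measurable M M"
    and distr_T: "distr M M T = M"
    and countable_partition: "countable \<xi>"
    and disjoint_partition: "disjoint \<xi>"
    and open_partition: "Z \<in> \<xi> \<Longrightarrow> open Z"
    and AE_partition: "AE x in M. x \<in> \<Union>\<xi>"
    and homeomorphism_branch: "Z \<in> \<xi> \<Longrightarrow> \<exists>g. homeomorphism Z (T ` Z) T g"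

locale markov_system = piecewise_invertible +
  assumes markov: "\<lbrakk>Z \<in> \<xi>; Z' \<in> \<xi>; measure M (T ` Z \<inter> Z') > 0\<rbrakk> \<Longrightarrow> Z' \<subseteq> T ` Z"

text \<open>As \<^const>\<open>measure\<close> is 0 on non-measurable sets, \<open>big_image\<close> also makes every \<open>T ` Z\<close> measurable.\<close>

locale gibbs_markov = markov_system +
  assumes expanding_iterate: "\<exists>N\<ge>1. uniformly_expanding (T ^^ N) (cylinders T \<xi> N)"
    and big_image: "(INF Z\<in>\<xi>. measure M (T ` Z)) > 0"
    and distortion: "\<exists>r\<^sub>0>0. \<exists>g. \<forall>Z\<in>\<xi>.
          inverse_branch_density M T 1 Z (g Z) \<and> ratio_lipschitz_on r\<^sub>0 (T ` Z) (g Z)"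

text \<open>A choice of versions \<open>v' n Z\<close> of the inverse branch densities with uniformly bounded distortion
  over all ranks.\<close>

definition regular_versions ::
  "'a::metric_space measure \<Rightarrow> ('a \<Rightarrow> 'a) \<Rightarrow> 'a set set \<Rightarrow> (nat \<Rightarrow> 'a set \<Rightarrow> 'a \<Rightarrow> real) \<Rightarrow> bool" where
  "regular_versions M T \<xi> v' \<longleftrightarrow>
     (\<exists>r\<^sub>0>0. \<forall>n\<ge>1. \<forall>Z\<in>cylinders T \<xi> n.
        inverse_branch_density M T n Z (v' n Z) \<and> ratio_lipschitz_on r\<^sub>0 ((T ^^ n) ` Z) (v' n Z))"


section \<open>Regular probability densities\<close>

definition prob_densities :: "'a measure \<Rightarrow> ('a \<Rightarrow> real) set" where
  "prob_densities M =
     {u \<in> borel_measurable M. (\<forall>x. 0 \<le> u x) \<and> (\<integral>\<^sup>+x. ennreal (u x) \<partial>M) = 1}"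

definition weighted :: "('a \<Rightarrow> real) \<Rightarrow> 'a measure \<Rightarrow> 'a measure"  (infixr "\<odot>" 70) where
  "u \<odot> M = density M (\<lambda>x. ennreal (u x))"

text \<open>In \<^typ>\<open>ereal\<close>, the infimum of the empty set is \<open>\<infinity>\<close>.\<close>

definition reg_on :: "'a::metric_space set \<Rightarrow> ('a \<Rightarrow> real) \<Rightarrow> ereal" where
  "reg_on B w = Inf (ereal ` {s. 0 < s \<and> (\<forall>x\<in>B. \<forall>y\<in>B. w x \<le> (1 + s * dist x y) * w y)})"

text \<open>The partition generated by the images \<open>T ` Z\<close>: its elements are the classes of points that lie in
  the same images.\<close>

definition image_partition :: "('a \<Rightarrow> 'a) \<Rightarrow> 'a set set \<Rightarrow> 'a set set" where
  "image_partition T \<xi> = range (\<lambda>x. {y. \<forall>Z\<in>\<xi>. y \<in> T ` Z \<longleftrightarrow> x \<in> T ` Z})"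

definition reg_partition :: "'a::metric_space set set \<Rightarrow> ('a \<Rightarrow> real) \<Rightarrow> ereal" where
  "reg_partition \<beta> w = (SUP B\<in>\<beta>. reg_on B w)"

text \<open>Densities are identified almost everywhere, so the regularity conditions are required of some
  version \<open>w\<close> of \<open>u\<close>.\<close>

definition regular_densities ::
  "'a::metric_space measure \<Rightarrow> ('a \<Rightarrow> 'a) \<Rightarrow> 'a set set \<Rightarrow> real \<Rightarrow> ('a \<Rightarrow> real) set" where
  "regular_densities M T \<xi> s =
     {u \<in> prob_densities M. \<exists>w\<in>prob_densities M. (AE x in M. u x = w x) \<and>
        reg_partition (image_partition T \<xi>) w \<le> ereal s}"

definition regular_densities_on ::
  "'a::metric_space measure \<Rightarrow> 'a set \<Rightarrow> real \<Rightarrow> ('a \<Rightarrow> real) set" where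
  "regular_densities_on M A s =
     {u \<in> prob_densities M. \<exists>w\<in>prob_densities M. (AE x in M. u x = w x) \<and>
        w = (\<lambda>x. indicator A x * w x) \<and> reg_on A w \<le> ereal s}"


section \<open>Hitting times\<close>

text \<open>In \<^typ>\<open>enat\<close>, the infimum of the empty set is \<open>\<infinity>\<close>.\<close>

definition hitting_time :: "('a \<Rightarrow> 'a) \<Rightarrow> 'a set \<Rightarrow> 'a \<Rightarrow> enat" where
  "hitting_time T A x = Inf (enat ` {n. 1 \<le> n \<and> (T ^^ n) x \<in> A})"

text \<open>The value is arbitrary where the hitting time is infinite.\<close>

definition entrance_map :: "('a \<Rightarrow> 'a) \<Rightarrow> 'a set \<Rightarrow> 'a \<Rightarrow> 'a" where
  "entrance_map T A x = (T ^^ the_enat (hitting_time T A x)) x"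

text \<open>The first \<open>d\<close> waiting times between visits to \<open>A\<close> are \<open>k 1, \<dots>, k d\<close>. The conditions for smaller \<open>j\<close>
  ensure that only points with finite hitting time are passed to \<^const>\<open>entrance_map\<close>.\<close>

definition hitting_event :: "('a \<Rightarrow> 'a) \<Rightarrow> 'a set \<Rightarrow> nat \<Rightarrow> (nat \<Rightarrow> nat) \<Rightarrow> 'a set" where
  "hitting_event T A d k =
     (\<Inter>j\<in>{1..d}. (entrance_map T A ^^ (j - 1)) -` {x. hitting_time T A x = enat (k j)})"

definition time_scales :: "'a measure \<Rightarrow> (nat \<Rightarrow> 'a set) \<Rightarrow> real \<Rightarrow> (nat \<Rightarrow> nat) set" where
  "time_scales M A \<delta> =
     {k. \<forall>l\<ge>1. \<delta> \<le> measure M (A l) * real (k l) \<and> measure M (A l) * real (k l) \<le> 1 / \<delta>}"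

definition periodic :: "('a \<Rightarrow> 'a) \<Rightarrow> 'a \<Rightarrow> bool" where
  "periodic T x \<longleftrightarrow> (\<exists>p\<ge>1. (T ^^ p) x = x)"

definition min_period :: "('a \<Rightarrow> 'a) \<Rightarrow> 'a \<Rightarrow> nat" where
  "min_period T x = (LEAST p. 1 \<le> p \<and> (T ^^ p) x = x)"

text \<open>Asymptotic equivalence of \<open>a q l\<close> and \<open>b q l\<close> as \<open>l\<close> tends to infinity, uniformly in \<open>q \<in> Q\<close>.\<close>

definition uniformly_asymp_equiv ::
  "'q set \<Rightarrow> ('q \<Rightarrow> nat \<Rightarrow> real) \<Rightarrow> ('q \<Rightarrow> nat \<Rightarrow> real) \<Rightarrow> bool" where
  "uniformly_asymp_equiv Q a b \<longleftrightarrow>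
     (\<forall>\<epsilon>>0. \<exists>l\<^sub>0. \<forall>l\<ge>l\<^sub>0. \<forall>q\<in>Q. \<bar>a q l / b q l - 1\<bar> \<le> \<epsilon>)"

end

theory Submission
  imports Defs
begin

text \<open>
  Finite measures are called \<open>s\<close>-regular if their log-density with respect to \<open>M\<close> oscillates by at most
  \<open>s * \<kappa> ^ n\<close> on cylinders of rank \<open>n\<close>. Bounded distortion makes push-forward contract the constant \<open>s\<close> up to
  an additive error, and together with big images and mixing it gives a Doeblin condition: a fixed
  proportion of every regular probability measure is pushed to a common regular part, and the rest
  stays regular. Hence regular measures converge to \<open>M\<close> exponentially fast, uniformly and relative to
  \<open>M\<close>, and cylinders decay exponentially in their rank.

  Consequently a visit to \<open>A l\<close> is forgotten after a gap of length \<open>l\<close>, and gaps are negligible since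
  \<open>l * M (A l)\<close> tends to \<open>0\<close>. Inside a gap following a visit, another visit is unlikely, except for
  the immediate return along a periodic orbit, which has asymptotic probability \<open>1 - \<theta>\<close>. So from \<open>A l\<close>
  a fraction \<open>\<theta>\<close> of the mass escapes the gap. By stationarity the survival function
  \<open>F k = M {\<phi> > k}\<close> satisfies \<open>F (k + 1) = F k - M (A l \<inter> {\<phi> > k})\<close>, an approximate recursion
  \<open>F (k + 1) \<approx> (1 - \<theta> * M (A l)) * F k\<close>, and its decrements are the local law of \<open>\<phi>\<close>. Finally, a regular
  measure restricted to \<open>{\<phi> = k}\<close> and pushed forward by \<open>T ^^ k\<close> is again regular, now on \<open>A l\<close>, so
  successive waiting times multiply.
\<close>

section \<open>Elementary facts\<close>

text \<open>A first hit exactly at time \<open>k\<close> has measure of order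
  \<open>prob (W l)\<close>, so a mixing rate with absolute error says nothing about it. Every error
  term is therefore kept proportional to the measure of a target set. In the gap estimates, a visit
  may come too late to be forgotten when the target \<open>Q\<close> begins; there the error is
  proportional to the measure of \<open>Q'\<close>, which drops one more block of \<open>l\<close>
  steps from \<open>Q\<close>. Regularity is required only from some rank on, because a measure
  starting on \<open>A l\<close> is in general not regular at ranks below \<open>l\<close>. After
  about \<open>l\<close> steps this defect is gone, and this dictates the length of the gaps. The
  exponents of \<open>\<theta>\<close> are counted as follows. A waiting time that starts on
  \<open>A l\<close> contributes one factor for escaping from the gap and one for the rate of the
  next hit. A start in \<open>V\<close> is spread over the space and pays no escape factor, hence
  \<open>2 * d - 1\<close> instead of \<open>2 * d\<close>.\<close>

lemma power_div_le_root_power: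
  fixes x :: real
  assumes "0 < x" "x < 1" "0 < N"
  shows "x ^ (n div N) \<le> root N x ^ n / x"
proof -
  have q: "0 < root N x" "root N x < 1" "root N x ^ N = x" using assms by auto
  have "root N x ^ (N * (n div N) + N) \<le> root N x ^ n"
  proof (rule power_decreasing)
    have "n mod N < N" using assms(3) by simp
    then have "N * (n div N) + n mod N \<le> N * (n div N) + N" by linarith
    then show "n \<le> N * (n div N) + N" by simp
  qed (use q in auto)
  then have "x ^ (n div N) * x \<le> root N x ^ n"
    unfolding power_add power_mult q(3) .
  then show ?thesis using assms(1) by (simp add: field_simps)
qed

lemma power_sum_le:
  fixes q :: real
  assumes "0 < q" "q < 1"
  shows "(\<Sum>i\<in>{m..n}. q ^ i) \<le> q ^ m / (1 - q)"
proof (cases "m \<le> n")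
  case True
  have "(\<Sum>i\<in>{m..n}. q ^ i) = (q ^ m - q ^ Suc n) / (1 - q)"
    using sum_gp_multiplied[OF True, of q] assms by (simp add: field_simps)
  also have "\<dots> \<le> q ^ m / (1 - q)" using assms by (intro divide_right_mono) auto
  finally show ?thesis .
qed (use assms in simp)

lemma exp_minus_quadratic:
  fixes y :: real
  assumes "0 \<le> y" shows "\<bar>exp (- y) - (1 - y)\<bar> \<le> y\<^sup>2"
proof -
  have "1 - y \<le> exp (- y)" using exp_ge_add_one_self[of "- y"] by simp
  moreover have "exp (- y) \<le> 1 - y + y\<^sup>2"
  proof -
    have "exp (- y) \<le> 1 / (1 + y)"
      using exp_ge_add_one_self[of y] assms by (simp add: exp_minus field_simps)
    also have "\<dots> \<le> 1 - y + y\<^sup>2"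
    proof -
      have "(1 - y + y\<^sup>2) * (1 + y) = 1 + y ^ 3" by (simp add: algebra_simps power2_eq_square power3_eq_cube)
      then show ?thesis using assms by (simp add: divide_le_eq)
    qed
    finally show ?thesis .
  qed
  ultimately show ?thesis by simp
qed

lemma exp_minus_lipschitz:
  fixes x y :: real
  assumes "0 \<le> x" "x \<le> y" shows "\<bar>exp (- x) - exp (- y)\<bar> \<le> y - x"
proof -
  have eq: "exp (- x) - exp (- y) = exp (- x) * (1 - exp (- (y - x)))"
    by (simp add: right_diff_distrib flip: exp_add)
  have "1 - exp (- (y - x)) \<le> y - x" using exp_ge_add_one_self[of "- (y - x)"] by linarith
  then have "exp (- x) * (1 - exp (- (y - x))) \<le> 1 * (y - x)"
    using assms by (intro mult_mono) auto
  moreover have "exp (- y) \<le> exp (- x)" using assms by simp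
  ultimately show ?thesis using eq by simp
qed

text \<open>A discrete Gronwall argument: \<open>exp (- c * real k)\<close> satisfies the recursion
  up to \<open>a\<^sup>2\<close> per step, and multiplication by \<open>1 - c\<close> does not
  enlarge errors, so one-step errors just add up. It is used with \<open>F\<close> the survival
  function, \<open>a\<close> the measure of the target and \<open>n\<close> proportional to its
  rank: during the first \<open>n\<close> steps only the trivial one-step bound \<open>a\<close> is
  available.\<close>

lemma perturbed_geometric:
  fixes F :: "nat \<Rightarrow> real" and c a e :: real
  assumes F0: "F 0 = 1" and c: "0 \<le> c" "c \<le> a" "a \<le> 1" and e: "0 \<le> e"
    and early: "\<And>k. k < n \<Longrightarrow> \<bar>F (Suc k) - (1 - c) * F k\<bar> \<le> a"
    and late: "\<And>k. n \<le> k \<Longrightarrow> \<bar>F (Suc k) - (1 - c) * F k\<bar> \<le> e * a"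
  shows "\<bar>F k - exp (- c * real k)\<bar> \<le> real n * a + real k * (e * a + a\<^sup>2)"
proof -
  \<comment> \<open>The induction has to count the early steps made so far, \<open>min k n\<close>,
    instead of charging all \<open>n\<close> at once.\<close>
  have "\<bar>F k - exp (- c * real k)\<bar> \<le> real (min k n) * a + real k * (e * a + a\<^sup>2)"
  proof (induction k)
    case 0
    then show ?case using F0 by simp
  next
    case (Suc k)
    define G where "G = exp (- c * real k)"
    have G: "0 \<le> G" "G \<le> 1" using c by (simp_all add: G_def)
    have GS: "exp (- c * real (Suc k)) = G * exp (- c)" by (simp add: G_def algebra_simps flip: exp_add)
    have "\<bar>G * exp (- c) - (1 - c) * G\<bar> = G * \<bar>exp (- c) - (1 - c)\<bar>"
    proof -
      have "G * exp (- c) - (1 - c) * G = G * (exp (- c) - (1 - c))" by (simp add: algebra_simps)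
      then show ?thesis using G by (simp add: abs_mult)
    qed
    also have "\<dots> \<le> 1 * c\<^sup>2" using G exp_minus_quadratic[OF c(1)] by (intro mult_mono) auto
    also have "\<dots> \<le> a\<^sup>2" using c by simp
    finally have 1: "\<bar>G * exp (- c) - (1 - c) * G\<bar> \<le> a\<^sup>2" .
    have "\<bar>(1 - c) * (F k - G)\<bar> \<le> 1 * \<bar>F k - G\<bar>"
      unfolding abs_mult using c by (intro mult_right_mono) auto
    then have 2: "\<bar>(1 - c) * F k - (1 - c) * G\<bar> \<le> \<bar>F k - G\<bar>" by (simp add: right_diff_distrib)
    have 3: "\<bar>F (Suc k) - (1 - c) * F k\<bar> \<le> real (min (Suc k) n) * a - real (min k n) * a + e * a"
    proof (cases "k < n")
      case True
      then have "real (min (Suc k) n) * a - real (min k n) * a = a" by (simp add: algebra_simps)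
      moreover have "0 \<le> e * a" using c e by simp
      ultimately show ?thesis using early[OF True] by linarith
    next
      case False
      then show ?thesis using late[of k] by simp
    qed
    have "\<bar>F (Suc k) - G * exp (- c)\<bar> \<le> real (min (Suc k) n) * a - real (min k n) * a + e * a
        + (real (min k n) * a + real k * (e * a + a\<^sup>2)) + a\<^sup>2"
      using 1 2 3 Suc.IH[folded G_def] by linarith
    then show ?case unfolding GS by (simp add: algebra_simps)
  qed
  also have "\<dots> \<le> real n * a + real k * (e * a + a\<^sup>2)"
    using c by (intro add_right_mono mult_right_mono) auto
  finally show ?thesis .
qed

text \<open>The cube comes from \<open>2 * x - 1 / x \<le> x ^ 3\<close>, that is, \<open>(x ^ 2 - 1) ^ 2 \<ge> 0\<close>.\<close>

lemma diff_ratio_le: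
  fixes p p' q q' x e f :: real
  assumes "1 \<le> x" "p * f \<le> x * p' * e" "q' * e \<le> x * q * f" "2 * q' \<le> p'" "0 \<le> q'" "0 \<le> e"
  shows "(p - q) * f \<le> x ^ 3 * (p' - q') * e"
proof -
  have "q' * e / x \<le> q * f" using assms(1,3) by (simp add: field_simps)
  then have "(p - q) * f \<le> (x * p' - q' / x) * e" using assms(2) by (simp add: algebra_simps)
  also have "\<dots> \<le> (x ^ 3 * (p' - q')) * e"
  proof (rule mult_right_mono[OF _ \<open>0 \<le> e\<close>])
    have "1 \<le> x ^ 2" using assms(1) by simp
    then have "0 \<le> (x ^ 3 - x) * (p' - 2 * q')"
      using assms by (intro mult_nonneg_nonneg) (simp_all add: power3_eq_cube power2_eq_square)
    moreover have "0 \<le> q' * ((x ^ 2 - 1) ^ 2 / x)" using assms by simp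
    moreover have "(x ^ 2 - 1) ^ 2 / x = x ^ 3 - 2 * x + 1 / x"
      using assms(1) by (simp add: field_simps power2_eq_square power3_eq_cube)
    ultimately show "x * p' - q' / x \<le> x ^ 3 * (p' - q')" by (simp add: algebra_simps)
  qed
  finally show ?thesis .
qed

text \<open>One waiting time is composed with the remaining ones: \<open>n\<close> is the initial
  mass, \<open>y\<close> the mass after the first hit, \<open>z\<close> the mass of the full event.
  Since \<open>y \<le> 2 * a * n\<close>, the error of the remaining part costs at most
  \<open>2 * e * (a * B) * n\<close> and that of the first part \<open>e * (a * B) * n\<close>. The
  bound \<open>B\<close> on \<open>b\<close> is kept apart because errors are measured against
  powers of the target measure without powers of \<open>\<theta>\<close>.\<close>

lemma hits_step:
  fixes a c x X e y z n :: real
  assumes first: "\<bar>y - a * c * x * n\<bar> \<le> e * a * n"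
    and rest: "\<bar>z - b * X * y\<bar> \<le> e * B * y"
    and bounds: "0 \<le> b" "b \<le> B" "0 \<le> c" "c \<le> 1" "0 \<le> x" "x \<le> 1" "0 \<le> X" "X \<le> 1" "0 \<le> e" "e \<le> 1" "0 \<le> a" "0 \<le> n"
  shows "\<bar>z - (a * c * b) * (x * X) * n\<bar> \<le> 3 * e * (a * B) * n"
proof -
  have "a * c * x * n \<le> a * 1 * 1 * n" using bounds by (intro mult_mono) auto
  moreover have "e * a * n \<le> 1 * a * n" using bounds by (intro mult_right_mono) auto
  ultimately have y: "y \<le> 2 * a * n" using first by linarith
  have "e * B * y \<le> e * B * (2 * a * n)" using bounds y by (intro mult_left_mono) auto
  moreover have "(b * X) * \<bar>y - a * c * x * n\<bar> \<le> (B * 1) * (e * a * n)"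
    using bounds first by (intro mult_mono) auto
  moreover have "(b * X) * \<bar>y - a * c * x * n\<bar> = \<bar>b * X * y - (a * c * b) * (x * X) * n\<bar>"
  proof -
    have "b * X * y - (a * c * b) * (x * X) * n = (b * X) * (y - a * c * x * n)"
      by (simp add: algebra_simps)
    then show ?thesis using bounds by (simp add: abs_mult)
  qed
  moreover have "e * B * (2 * a * n) + (B * 1) * (e * a * n) = 3 * e * (a * B) * n" by simp
  ultimately show ?thesis using rest by linarith
qed

lemma sum_from_1_Suc: "(\<Sum>j=1..Suc d. f j) = f 1 + (\<Sum>j=1..d. f (Suc j))"
  for f :: "nat \<Rightarrow> real"
  by (induction d) auto

lemma inv_into_image:
  assumes "inj_on f Z" "E \<subseteq> f ` Z"
  shows "inv_into Z f ` E = Z \<inter> f -` E"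
proof (intro equalityI subsetI)
  fix z assume "z \<in> Z \<inter> f -` E"
  then show "z \<in> inv_into Z f ` E"
    using inv_into_f_f[OF assms(1), of z] by (metis IntE imageI vimageE)
qed (use assms in \<open>auto simp: f_inv_into_f inv_into_into subset_eq\<close>)

lemma ball_atLeastAtMost_add: "(\<forall>j\<in>{1..i+k}. P j) \<longleftrightarrow> (\<forall>j\<in>{1..i}. P j) \<and> (\<forall>j\<in>{1..k::nat}. P (i + j))"
proof (intro iffI conjI ballI)
  fix j assume *: "(\<forall>j\<in>{1..i}. P j) \<and> (\<forall>j\<in>{1..k}. P (i + j))" "j \<in> {1..i+k}"
  show "P j"
  proof (cases "j \<le> i")
    case False
    then have "j - i \<in> {1..k}" "j = i + (j - i)" using *(2) by auto
    then show ?thesis using * by metis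
  qed (use * in auto)
qed auto

lemma funpow_comp_apply: "(f ^^ j) ((f ^^ i) y) = (f ^^ (i + j)) y"
  by (simp add: add.commute[of i j] funpow_add)

lemma funpow_add_vimage: "(f ^^ (a + b)) -` E = (f ^^ a) -` ((f ^^ b) -` E)"
  by (simp add: add.commute[of a b] funpow_add vimage_comp)

lemma funpow_Suc_vimage: "(f ^^ Suc j) -` E = (f ^^ j) -` (f -` E)"
  by (simp add: vimage_comp)

text \<open>Integrating the pointwise bound over \<open>y \<in> F\<close> as well gives the
  comparison in product form, so that no division by a possibly vanishing measure occurs.\<close>

lemma nn_integral_ratio_le:
  assumes [measurable]: "w \<in> borel_measurable M" "E \<in> sets M" "F \<in> sets M" and "0 \<le> c"
    and le: "\<And>x y. x \<in> E \<Longrightarrow> y \<in> F \<Longrightarrow> w x \<le> c * w y"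
  shows "(\<integral>\<^sup>+x\<in>E. ennreal (w x) \<partial>M) * emeasure M F
    \<le> ennreal c * (\<integral>\<^sup>+x\<in>F. ennreal (w x) \<partial>M) * emeasure M E"
proof -
  have 1: "(\<integral>\<^sup>+x\<in>E. ennreal (w x) \<partial>M) \<le> ennreal c * ennreal (w y) * emeasure M E" if "y \<in> F" for y
  proof -
    have "(\<integral>\<^sup>+x\<in>E. ennreal (w x) \<partial>M) \<le> (\<integral>\<^sup>+x. (ennreal c * ennreal (w y)) * indicator E x \<partial>M)"
      using le that \<open>0 \<le> c\<close>
      by (intro nn_integral_mono) (auto simp: indicator_def ennreal_mult'[symmetric] intro!: ennreal_leI)
    then show ?thesis by (simp add: nn_integral_cmult_indicator)
  qed
  have "(\<integral>\<^sup>+x\<in>E. ennreal (w x) \<partial>M) * emeasure M F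
      = (\<integral>\<^sup>+y\<in>F. (\<integral>\<^sup>+x\<in>E. ennreal (w x) \<partial>M) \<partial>M)"
    by (simp add: nn_integral_cmult_indicator)
  also have "\<dots> \<le> (\<integral>\<^sup>+y. (ennreal c * emeasure M E) * (ennreal (w y) * indicator F y) \<partial>M)"
    using 1 by (intro nn_integral_mono) (auto simp: indicator_def mult_ac)
  also have "\<dots> = ennreal c * emeasure M E * (\<integral>\<^sup>+x\<in>F. ennreal (w x) \<partial>M)"
    by (subst nn_integral_cmult) auto
  finally show ?thesis by (simp add: mult_ac)
qed

lemma ratio_lipschitz_onD:
  assumes "ratio_lipschitz_on s B g" "\<And>x. x \<in> B \<Longrightarrow> 0 \<le> g x" "x \<in> B" "y \<in> B"
  shows "0 < g x" "\<bar>g x - g y\<bar> \<le> s * dist x y * g y"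
proof -
  have "\<bar>g z / g z - 1\<bar> \<le> 0" if "z \<in> B" for z
    using assms(1) that unfolding ratio_lipschitz_on_def by (metis dist_self mult_zero_right)
  then have nz: "g z \<noteq> 0" if "z \<in> B" for z using that by fastforce
  show "0 < g x" using nz[OF assms(3)] assms(2)[OF assms(3)] by simp
  have "0 < g y" using nz[OF assms(4)] assms(2)[OF assms(4)] by simp
  moreover have "\<bar>g x / g y - 1\<bar> \<le> s * dist x y"
    using assms unfolding ratio_lipschitz_on_def by blast
  ultimately have "\<bar>g x / g y - 1\<bar> * g y \<le> s * dist x y * g y" by (intro mult_right_mono) auto
  moreover have "\<bar>g x / g y - 1\<bar> * g y = \<bar>g x - g y\<bar>"
    using \<open>0 < g y\<close> by (simp add: abs_mult_pos left_diff_distrib)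
  ultimately show "\<bar>g x - g y\<bar> \<le> s * dist x y * g y" by simp
qed

text \<open>The infimum need not be attained, so the constant is enlarged; later only its finiteness
  and its independence of the density matter.\<close>

lemma reg_onD:
  assumes "reg_on B w \<le> ereal r" "x \<in> B" "y \<in> B" "0 \<le> w y"
  shows "w x \<le> (1 + (r + 1) * dist x y) * w y"
proof -
  have "reg_on B w < ereal (r + 1)" using assms(1) by (rule le_less_trans) simp
  then obtain s where s: "0 < s" "\<forall>x\<in>B. \<forall>y\<in>B. w x \<le> (1 + s * dist x y) * w y" "s < r + 1"
    unfolding reg_on_def Inf_less_iff by auto
  then have "w x \<le> (1 + s * dist x y) * w y" using assms by blast
  also have "\<dots> \<le> (1 + (r + 1) * dist x y) * w y"
    using s assms(4) by (intro mult_right_mono add_left_mono) auto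
  finally show ?thesis .
qed

section \<open>Cylinders\<close>

lemma cylinders_0 [simp]: "cylinders T \<xi> 0 = {UNIV}"
  by (auto simp: cylinders_def)

lemma cylinders_Suc:
  "cylinders T \<xi> (Suc n) = {Z \<inter> T -` B |Z B. Z \<in> \<xi> \<and> B \<in> cylinders T \<xi> n}"
proof (intro equalityI subsetI)
  fix C assume "C \<in> cylinders T \<xi> (Suc n)"
  then obtain Z where C: "C = (\<Inter>i<Suc n. (T ^^ i) -` Z i)" and Z: "\<forall>i<Suc n. Z i \<in> \<xi>"
    by (auto simp: cylinders_def)
  have "C = Z 0 \<inter> T -` (\<Inter>i<n. (T ^^ i) -` Z (Suc i))"
    unfolding C by (auto simp: lessThan_Suc_eq_insert_0 funpow_swap1)
  moreover have "(\<Inter>i<n. (T ^^ i) -` Z (Suc i)) \<in> cylinders T \<xi> n"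
    using Z by (auto simp: cylinders_def)
  ultimately show "C \<in> {Z \<inter> T -` B |Z B. Z \<in> \<xi> \<and> B \<in> cylinders T \<xi> n}"
    using Z by blast
next
  fix C assume "C \<in> {Z \<inter> T -` B |Z B. Z \<in> \<xi> \<and> B \<in> cylinders T \<xi> n}"
  then obtain Y Z where C: "C = Y \<inter> T -` (\<Inter>i<n. (T ^^ i) -` Z i)" and Y: "Y \<in> \<xi>"
    and Z: "\<forall>i<n. Z i \<in> \<xi>"
    by (auto simp: cylinders_def)
  have "C = (\<Inter>i<Suc n. (T ^^ i) -` (case i of 0 \<Rightarrow> Y | Suc j \<Rightarrow> Z j))"
    unfolding C by (auto simp: lessThan_Suc_eq_insert_0 funpow_swap1)
  then show "C \<in> cylinders T \<xi> (Suc n)"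
    using Y Z unfolding cylinders_def
    by (intro CollectI exI[of _ "\<lambda>i. case i of 0 \<Rightarrow> Y | Suc j \<Rightarrow> Z j"]) (auto split: nat.splits)
qed

lemma cylinders_Int:
  assumes "B \<in> cylinders T \<xi> m" "C \<in> cylinders T \<xi> n"
  shows "B \<inter> (T ^^ m) -` C \<in> cylinders T \<xi> (m + n)"
  using assms
proof (induction m arbitrary: B)
  case (Suc m)
  then obtain Z B' where "Z \<in> \<xi>" "B' \<in> cylinders T \<xi> m" "B = Z \<inter> T -` B'"
    by (auto simp: cylinders_Suc)
  moreover from this have "B \<inter> (T ^^ Suc m) -` C = Z \<inter> T -` (B' \<inter> (T ^^ m) -` C)"
    by (auto simp: funpow_swap1)
  moreover have "B' \<inter> (T ^^ m) -` C \<in> cylinders T \<xi> (m + n)"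
    using Suc.IH[OF \<open>B' \<in> cylinders T \<xi> m\<close>] Suc.prems by simp
  ultimately show ?case
    unfolding add_Suc cylinders_Suc by blast
qed simp

lemma cylinders_split:
  assumes "D \<in> cylinders T \<xi> (m + n)"
  obtains B C where "B \<in> cylinders T \<xi> m" "C \<in> cylinders T \<xi> n" "D = B \<inter> (T ^^ m) -` C"
  using assms
proof (induction m arbitrary: D thesis)
  case (Suc m)
  then obtain Z D' where D: "Z \<in> \<xi>" "D' \<in> cylinders T \<xi> (m + n)" "D = Z \<inter> T -` D'"
    by (auto simp: cylinders_Suc)
  then obtain B C where BC: "B \<in> cylinders T \<xi> m" "C \<in> cylinders T \<xi> n" "D' = B \<inter> (T ^^ m) -` C"
    using Suc.IH by blast
  have "Z \<inter> T -` B \<in> cylinders T \<xi> (Suc m)"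
    using D BC by (auto simp: cylinders_Suc)
  moreover have "D = (Z \<inter> T -` B) \<inter> (T ^^ Suc m) -` C"
    using D BC by (auto simp: funpow_swap1)
  ultimately show ?case using BC Suc.prems by blast
qed auto

lemma cylinders_mono:
  assumes "B \<in> cylinders T \<xi> n" "m \<le> n"
  obtains C where "C \<in> cylinders T \<xi> m" "B \<subseteq> C"
  using cylinders_split[of B T \<xi> m "n - m"] assms by (metis inf.cobounded1 le_add_diff_inverse)

lemma cylinders_1 [simp]: "cylinders T \<xi> (Suc 0) = \<xi>"
  by (auto simp: cylinders_Suc)

lemma cylinders_disjoint:
  assumes "disjoint \<xi>" "B \<in> cylinders T \<xi> n" "C \<in> cylinders T \<xi> n" "B \<noteq> C"
  shows "B \<inter> C = {}"
  using assms(2-)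
proof (induction n arbitrary: B C)
  case (Suc n)
  then obtain Z B' Y C' where *: "Z \<in> \<xi>" "B' \<in> cylinders T \<xi> n" "B = Z \<inter> T -` B'"
      "Y \<in> \<xi>" "C' \<in> cylinders T \<xi> n" "C = Y \<inter> T -` C'"
    unfolding cylinders_Suc by blast
  show ?case
  proof (cases "Z = Y")
    case True
    then have "B' \<inter> C' = {}" using * Suc.IH[of B' C'] Suc.prems by blast
    then show ?thesis using * by blast
  next
    case False
    then show ?thesis using * assms(1) by (auto simp: disjoint_def)
  qed
qed simp

lemma cylinders_dichotomy:
  assumes "disjoint \<xi>" "B \<in> cylinders T \<xi> n" "C \<in> cylinders T \<xi> m" "m \<le> n"
  shows "B \<subseteq> C \<or> B \<inter> C = {}"
proof -
  obtain D where "D \<in> cylinders T \<xi> m" "B \<subseteq> D" using cylinders_mono[OF assms(2,4)] by blast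
  then show ?thesis using cylinders_disjoint[OF assms(1) _ assms(3), of D] by blast
qed

section \<open>Absolutely continuous measures and bounded distortion\<close>

context gibbs_markov
begin

lemma space_M [simp]: "space M = UNIV"
  using sets_eq_imp_space_eq[OF sets_eq_borel] by simp

lemma in_sets_M: "E \<in> sets M \<longleftrightarrow> E \<in> sets borel"
  by (simp add: sets_eq_borel)

lemma measurable_funpow_T: "T ^^ n \<in> measurable M M"
  by (induction n) (simp_all add: measurable_comp measurable_T comp_def[symmetric] id_def[symmetric] del: comp_apply)

lemma funpow_vimage_sets [simp, measurable (raw)]: "E \<in> sets M \<Longrightarrow> (T ^^ n) -` E \<in> sets M"
  using measurable_sets[OF measurable_funpow_T] by simp

lemma vimage_sets [simp, measurable (raw)]: "E \<in> sets M \<Longrightarrow> T -` E \<in> sets M"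
  using measurable_sets[OF measurable_T] by simp

lemma UNIV_sets [simp]: "UNIV \<in> sets M"
  using sets.top[of M] by simp

lemma prob_UNIV [simp]: "prob UNIV = 1"
  using prob_space by simp

lemma Compl_sets [simp, intro]: "E \<in> sets M \<Longrightarrow> - E \<in> sets M"
  using sets.compl_sets[of E M] by (simp add: Compl_eq_Diff_UNIV)

lemma prob_vimage [simp]:
  assumes "E \<in> sets M" shows "prob (T -` E) = prob E"
proof -
  have "measure (distr M M T) E = prob (T -` E)"
    using assms measurable_T by (simp add: measure_distr)
  then show ?thesis by (simp add: distr_T)
qed

lemma prob_funpow_vimage [simp]:
  assumes "E \<in> sets M" shows "prob ((T ^^ n) -` E) = prob E"
proof (induction n)
  case (Suc n)
  have "(T ^^ Suc n) -` E = T -` ((T ^^ n) -` E)"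
    by (auto simp: funpow_swap1)
  then show ?case using Suc assms by (simp del: funpow.simps)
qed simp

lemma partition_sets [simp, intro]: "Z \<in> \<xi> \<Longrightarrow> Z \<in> sets M"
  using open_partition by (simp add: in_sets_M)

lemma cylinders_sets [intro]: "B \<in> cylinders T \<xi> n \<Longrightarrow> B \<in> sets M"
  by (induction n arbitrary: B) (auto simp: cylinders_Suc)

lemma partition_nonempty: "\<xi> \<noteq> {}"
proof
  assume "\<xi> = {}"
  then have "AE x in M. False" using AE_partition by simp
  then show False by simp
qed

lemma big_image_bound:
  obtains c where "c > 0" "\<And>Z. Z \<in> \<xi> \<Longrightarrow> c \<le> prob (T ` Z)"
proof
  show "0 < (INF Z\<in>\<xi>. prob (T ` Z))" by (rule big_image)
  fix Z assume "Z \<in> \<xi>"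
  then show "(INF Z\<in>\<xi>. prob (T ` Z)) \<le> prob (T ` Z)"
    by (intro cINF_lower bdd_belowI2[where m=0]) auto
qed

lemma image_pos: "Z \<in> \<xi> \<Longrightarrow> 0 < prob (T ` Z)"
  using big_image_bound by (metis less_le_trans)

lemma image_sets [simp, intro]: "Z \<in> \<xi> \<Longrightarrow> T ` Z \<in> sets M"
  using image_pos measure_notin_sets[of "T ` Z" M] by force

lemma inj_on_branch: "Z \<in> \<xi> \<Longrightarrow> inj_on T Z"
  using homeomorphism_branch unfolding homeomorphism_def inj_on_def by metis

lemma inj_on_cylinder: "B \<in> cylinders T \<xi> n \<Longrightarrow> inj_on (T ^^ n) B"
proof (induction n arbitrary: B)
  case (Suc n)
  then obtain Z B' where "Z \<in> \<xi>" "B' \<in> cylinders T \<xi> n" "B = Z \<inter> T -` B'"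
    by (auto simp: cylinders_Suc)
  moreover from this have "inj_on (T ^^ n) B'" "inj_on T Z"
    using Suc inj_on_branch by auto
  ultimately show ?case
    by (auto simp: inj_on_def funpow_swap1)
qed simp

text \<open>Padding with the empty set treats finite and infinite partitions alike: repeated values
  in an enumeration of \<open>insert {} \<xi>\<close> are replaced by \<open>{}\<close>.\<close>

lemma partition_enum:
  obtains Zs :: "nat \<Rightarrow> 'a set" where "disjoint_family Zs" "\<And>i. Zs i \<in> \<xi> \<or> Zs i = {}"
    "(\<Union>i. Zs i) = \<Union>\<xi>"
proof -
  have "countable (insert {} \<xi>)" using countable_partition by simp
  then obtain f :: "nat \<Rightarrow> 'a set" where f: "range f = insert {} \<xi>"
    using range_from_nat_into[of "insert {} \<xi>"] by blast
  define Zs where "Zs = (\<lambda>i. if \<exists>j<i. f j = f i then {} else f i)"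
  have "disjoint_family Zs"
    unfolding disjoint_family_on_def
  proof (intro ballI impI)
    fix m n :: nat assume "m \<noteq> n"
    show "Zs m \<inter> Zs n = {}"
    proof (rule ccontr)
      assume ne: "Zs m \<inter> Zs n \<noteq> {}"
      then have "f m \<noteq> {}" "f n \<noteq> {}" "f m \<inter> f n \<noteq> {}" "Zs m = f m" "Zs n = f n"
        by (auto simp: Zs_def split: if_splits)
      moreover from this have "f m \<in> \<xi>" "f n \<in> \<xi>" using f by blast+
      ultimately have "f m = f n" using disjoint_partition unfolding disjoint_def by blast
      then show False using ne \<open>m \<noteq> n\<close> by (auto simp: Zs_def split: if_splits) (metis nat_neq_iff)
    qed
  qed
  moreover have "Zs i \<in> \<xi> \<or> Zs i = {}" for i
    using f by (auto simp: Zs_def)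
  moreover have "(\<Union>i. Zs i) = \<Union>\<xi>"
  proof -
    have "x \<in> (\<Union>i. Zs i)" if "x \<in> f i" for x i
      using that
    proof (induction i rule: less_induct)
      case (less i)
      then show ?case by (cases "\<exists>j<i. f j = f i") (auto simp: Zs_def)
    qed
    then have "(\<Union>i. f i) \<subseteq> (\<Union>i. Zs i)" by blast
    moreover have "(\<Union>i. Zs i) \<subseteq> (\<Union>i. f i)" by (auto simp: Zs_def split: if_splits)
    ultimately show ?thesis using f by auto
  qed
  ultimately show thesis using that by blast
qed

text \<open>The measures of the argument are represented by their real-valued set functions, so that
  restriction, push-forward and differences are plain lambda terms.\<close>

definition acm :: "('a set \<Rightarrow> real) \<Rightarrow> bool" where
  "acm \<nu> \<longleftrightarrow> (\<forall>E\<in>sets M. 0 \<le> \<nu> E) \<and> (\<forall>E\<in>sets M. prob E = 0 \<longrightarrow> \<nu> E = 0) \<and>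
     (\<forall>D :: nat \<Rightarrow> 'a set. range D \<subseteq> sets M \<longrightarrow> disjoint_family D \<longrightarrow>
        (\<lambda>i. \<nu> (D i)) sums \<nu> (\<Union>i. D i))"

lemma acm_nonneg: "acm \<nu> \<Longrightarrow> E \<in> sets M \<Longrightarrow> 0 \<le> \<nu> E"
  by (simp add: acm_def)

lemma acm_null: "acm \<nu> \<Longrightarrow> E \<in> sets M \<Longrightarrow> prob E = 0 \<Longrightarrow> \<nu> E = 0"
  by (simp add: acm_def)

lemma acm_sums:
  fixes D :: "nat \<Rightarrow> 'a set"
  assumes "acm \<nu>" "\<And>i. D i \<in> sets M" "disjoint_family D"
  shows "(\<lambda>i. \<nu> (D i)) sums \<nu> (\<Union>i. D i)"
proof (rule assms(1)[unfolded acm_def, THEN conjunct2, THEN conjunct2, rule_format])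
  show "range D \<subseteq> sets M" using assms(2) by blast
qed (rule assms(3))

lemma acm_empty: "acm \<nu> \<Longrightarrow> \<nu> {} = 0"
  by (simp add: acm_null)

lemma acm_Un:
  assumes "acm \<nu>" "E \<in> sets M" "F \<in> sets M" "E \<inter> F = {}"
  shows "\<nu> (E \<union> F) = \<nu> E + \<nu> F"
proof -
  have "(\<lambda>i. \<nu> (binaryset E F i)) sums \<nu> (\<Union>i. binaryset E F i)"
    using assms by (intro acm_sums) (auto simp: binaryset_def disjoint_family_on_def)
  moreover have "(\<lambda>i. \<nu> (binaryset E F i)) sums (\<nu> E + \<nu> F)"
    using assms by (intro binaryset_sums acm_empty)
  ultimately show ?thesis
    by (metis UN_binaryset_eq sums_unique2)
qed

lemma acm_split:
  assumes "acm \<nu>" "E \<in> sets M" "F \<in> sets M"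
  shows "\<nu> E = \<nu> (E \<inter> F) + \<nu> (E - F)"
  using acm_Un[of \<nu> "E \<inter> F" "E - F"] assms by (simp add: Int_Diff_Un Int_Diff_disjoint)

lemma acm_mono:
  assumes "acm \<nu>" "E \<in> sets M" "F \<in> sets M" "E \<subseteq> F"
  shows "\<nu> E \<le> \<nu> F"
  using acm_split[OF assms(1,3,2)] acm_nonneg[OF assms(1), of "F - E"] assms
  by (simp add: Int_absorb1)

lemma acm_subadd:
  assumes "acm \<nu>" "E \<in> sets M" "F \<in> sets M"
  shows "\<nu> (E \<union> F) \<le> \<nu> E + \<nu> F"
  using acm_Un[of \<nu> E "F - E"] acm_mono[of \<nu> "F - E" F] assms by auto

lemma acm_UN_le:
  assumes "acm \<nu>" "finite I" "\<And>i. i \<in> I \<Longrightarrow> D i \<in> sets M"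
  shows "\<nu> (\<Union>i\<in>I. D i) \<le> (\<Sum>i\<in>I. \<nu> (D i))"
  using assms(2,3)
proof (induction I rule: finite_induct)
  case (insert i I)
  have "\<nu> (D i \<union> (\<Union>i\<in>I. D i)) \<le> \<nu> (D i) + \<nu> (\<Union>i\<in>I. D i)"
    using insert.hyps insert.prems assms(1) by (intro acm_subadd sets.finite_UN) blast+
  moreover have "\<nu> (\<Union>i\<in>I. D i) \<le> (\<Sum>i\<in>I. \<nu> (D i))"
    using insert by blast
  ultimately show ?case using insert.hyps by simp
qed (simp add: acm_empty[OF assms(1)])

lemma acm_prob: "acm prob"
  unfolding acm_def
proof (intro conjI ballI allI impI)
  fix D :: "nat \<Rightarrow> 'a set" assume "range D \<subseteq> sets M" "disjoint_family D"
  then show "(\<lambda>i. prob (D i)) sums prob (\<Union> (range D))"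
    by (rule finite_measure_UNION)
qed auto

lemma acm_push:
  assumes "acm \<nu>" shows "acm (\<lambda>E. \<nu> ((T ^^ n) -` E))"
  unfolding acm_def
proof (intro conjI ballI allI impI)
  fix D :: "nat \<Rightarrow> 'a set" assume D: "range D \<subseteq> sets M" "disjoint_family D"
  show "(\<lambda>i. \<nu> ((T ^^ n) -` D i)) sums \<nu> ((T ^^ n) -` \<Union> (range D))"
    unfolding vimage_UN
  proof (rule acm_sums[OF assms])
    show "(T ^^ n) -` D i \<in> sets M" for i using D(1) by (intro funpow_vimage_sets) blast
    show "disjoint_family (\<lambda>i. (T ^^ n) -` D i)" using D(2) unfolding disjoint_family_on_def by blast
  qed
next
  fix E assume "E \<in> sets M"
  then show "0 \<le> \<nu> ((T ^^ n) -` E)" by (intro acm_nonneg[OF assms] funpow_vimage_sets)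
next
  fix E assume "E \<in> sets M" "prob E = 0"
  then show "\<nu> ((T ^^ n) -` E) = 0"
    by (intro acm_null[OF assms] funpow_vimage_sets) (simp_all del: funpow.simps)
qed

lemma acm_restrict:
  assumes "acm \<nu>" "G \<in> sets M" shows "acm (\<lambda>E. \<nu> (E \<inter> G))"
  unfolding acm_def
proof (intro conjI ballI allI impI)
  fix D :: "nat \<Rightarrow> 'a set" assume D: "range D \<subseteq> sets M" "disjoint_family D"
  have "(\<lambda>i. \<nu> (D i \<inter> G)) sums \<nu> (\<Union>i. D i \<inter> G)"
  proof (rule acm_sums[OF assms(1)])
    show "D i \<inter> G \<in> sets M" for i using D(1) assms(2) by blast
    show "disjoint_family (\<lambda>i. D i \<inter> G)" using D(2) unfolding disjoint_family_on_def by blast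
  qed
  then show "(\<lambda>i. \<nu> (D i \<inter> G)) sums \<nu> (\<Union> (range D) \<inter> G)" by simp
next
  fix E assume E: "E \<in> sets M" "prob E = 0"
  then have "prob (E \<inter> G) \<le> prob E"
    using assms by (intro finite_measure_mono) auto
  then have "prob (E \<inter> G) = 0" using E measure_nonneg[of M "E \<inter> G"] by linarith
  then show "\<nu> (E \<inter> G) = 0" by (intro acm_null[OF assms(1)] sets.Int E assms(2))
next
  fix E assume "E \<in> sets M"
  then show "0 \<le> \<nu> (E \<inter> G)" by (intro acm_nonneg[OF assms(1)] sets.Int assms(2))
qed

lemma acm_partition_sums:
  assumes "acm \<nu>" "disjoint_family Zs" "\<And>i. Zs i \<in> \<xi> \<or> Zs i = {}" "(\<Union>i::nat. Zs i) = \<Union>\<xi>"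
    "G \<in> sets M"
  shows "(\<lambda>i. \<nu> (Zs i \<inter> G)) sums \<nu> G"
proof -
  have s: "Zs i \<in> sets M" for i using assms(3)[of i] by auto
  then have X: "\<Union>\<xi> \<in> sets M" unfolding assms(4)[symmetric] by auto
  have "prob (G - \<Union>\<xi>) = 0"
    using AE_partition X assms by (intro prob_eq_0[THEN iffD2]) auto
  then have "\<nu> (G - \<Union>\<xi>) = 0" by (rule acm_null[OF assms(1) sets.Diff[OF assms(5) X]])
  then have "\<nu> G = \<nu> (G \<inter> \<Union>\<xi>)" using acm_split[OF assms(1,5) X] by linarith
  moreover have "(\<lambda>i. \<nu> (Zs i \<inter> G)) sums \<nu> (\<Union>i. Zs i \<inter> G)"
  proof (rule acm_sums[OF assms(1)])
    show "Zs i \<inter> G \<in> sets M" for i using s assms(5) by blast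
    show "disjoint_family (\<lambda>i. Zs i \<inter> G)" using assms(2) unfolding disjoint_family_on_def by blast
  qed
  moreover have "(\<Union>i. Zs i \<inter> G) = G \<inter> \<Union>\<xi>" unfolding assms(4)[symmetric] by blast
  ultimately show ?thesis by simp
qed

text \<open>Absolute continuity makes the complement of \<open>\<Union>\<xi>\<close> negligible for
  both measures, so estimates on single branches add up. All estimates for one step of
  \<open>T\<close> are obtained in this way.\<close>

lemma acm_partition_le:
  assumes "acm \<nu>" "acm \<nu>'" "G \<in> sets M" "H \<in> sets M"
    and "\<And>Z. Z \<in> \<xi> \<Longrightarrow> a * \<nu> (Z \<inter> G) \<le> b * \<nu>' (Z \<inter> H)"
  shows "a * \<nu> G \<le> b * \<nu>' H"
proof -
  obtain Zs :: "nat \<Rightarrow> 'a set" where Zs: "disjoint_family Zs" "\<And>i. Zs i \<in> \<xi> \<or> Zs i = {}"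
    "(\<Union>i. Zs i) = \<Union>\<xi>" by (rule partition_enum) blast
  have 1: "(\<lambda>i. a * \<nu> (Zs i \<inter> G)) sums (a * \<nu> G)"
    by (intro sums_mult acm_partition_sums assms Zs)
  have 2: "(\<lambda>i. b * \<nu>' (Zs i \<inter> H)) sums (b * \<nu>' H)"
    by (intro sums_mult acm_partition_sums assms Zs)
  have 3: "a * \<nu> (Zs i \<inter> G) \<le> b * \<nu>' (Zs i \<inter> H)" for i
    using Zs(2)[of i] assms by (auto simp: acm_empty)
  show ?thesis by (rule sums_le[OF _ 1 2]) (rule 3)
qed

section \<open>Positivity, diameter and distortion of branches\<close>

lemma image_disjoint_or_contains:
  assumes "Z \<in> \<xi>" "Z' \<in> \<xi>"
  shows "prob (T ` Z \<inter> Z') = 0 \<or> Z' \<subseteq> T ` Z"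
  using markov[OF assms] measure_nonneg[of M "T ` Z \<inter> Z'"] by force

text \<open>If \<open>Z\<close> were null, the density of its inverse branch would have integral
  \<open>0\<close> over the image of \<open>Z\<close>. The ratio condition makes this density
  strictly positive, so the image would be null, against \<open>big_image\<close>.\<close>

lemma branch_pos:
  assumes Z: "Z \<in> \<xi>" shows "0 < prob Z"
proof (rule ccontr)
  assume "\<not> 0 < prob Z"
  then have null: "emeasure M Z = 0"
    using measure_nonneg[of M Z] by (simp add: emeasure_eq_measure)
  obtain r0 g where g: "inverse_branch_density M T 1 Z g" and lip: "ratio_lipschitz_on r0 (T ` Z) g"
    using distortion Z by blast
  have [measurable]: "g \<in> borel_measurable M" "T ` Z \<in> sets M" and nn: "\<And>x. x \<in> T ` Z \<Longrightarrow> 0 \<le> g x"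
    and int: "emeasure M (inv_into Z T ` (T ` Z)) = (\<integral>\<^sup>+x\<in>T ` Z. ennreal (g x) \<partial>M)"
    using g Z unfolding inverse_branch_density_def by auto
  have "inv_into Z T ` (T ` Z) = Z"
    using inv_into_image_cancel[OF inj_on_branch[OF Z], of Z] by simp
  then have "(\<integral>\<^sup>+x\<in>T ` Z. ennreal (g x) \<partial>M) = 0" using int null by simp
  then have ae: "AE x in M. ennreal (g x) * indicator (T ` Z) x = 0"
    by (subst (asm) nn_integral_0_iff_AE) auto
  have imp: "x \<notin> T ` Z" if "ennreal (g x) * indicator (T ` Z) x = 0" for x
  proof
    assume x: "x \<in> T ` Z"
    then have "0 < g x" using ratio_lipschitz_onD(1)[OF lip _ x x] nn by blast
    then show False using that x by simp
  qed
  from eventually_mono[OF ae imp] have "AE x in M. x \<notin> T ` Z" .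
  then have "prob (T ` Z) = 0" using Z by (subst prob_eq_0) auto
  then show False using image_pos[OF Z] by simp
qed

text \<open>Iterating the expansion of \<open>T ^^ N\<close> contracts by \<open>\<rho>\<close> per
  block of \<open>N\<close> letters. Hence \<open>\<kappa>\<close> is the \<open>N\<close>-th root
  of \<open>\<rho>\<close>, and the constant absorbs the incomplete block; the maximum with
  \<open>1\<close> keeps it positive.\<close>

lemma cylinder_diameter:
  obtains \<kappa> C where "0 < \<kappa>" "\<kappa> < 1" "0 < C"
    "\<And>n B x y. B \<in> cylinders T \<xi> n \<Longrightarrow> x \<in> B \<Longrightarrow> y \<in> B \<Longrightarrow> dist x y \<le> C * \<kappa> ^ n"
proof -
  obtain D0 where "\<forall>x\<in>(UNIV::'a set). \<forall>y\<in>UNIV. dist x y \<le> D0"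
    using bounded_space bounded_two_points by blast
  then have D: "dist x y \<le> max D0 1" for x y :: 'a by (simp add: le_max_iff_disj)
  obtain N \<rho> where N: "1 \<le> N" and \<rho>: "0 < \<rho>" "\<rho> < 1"
    and exp: "\<And>Z x y. Z \<in> cylinders T \<xi> N \<Longrightarrow> x \<in> Z \<Longrightarrow> y \<in> Z \<Longrightarrow>
      dist x y \<le> \<rho> * dist ((T ^^ N) x) ((T ^^ N) y)"
    using expanding_iterate unfolding uniformly_expanding_def by blast
  have j: "dist x y \<le> \<rho> ^ j * max D0 1" if "B \<in> cylinders T \<xi> (j * N)" "x \<in> B" "y \<in> B" for j B x y
    using that
  proof (induction j arbitrary: B x y)
    case (Suc j)
    then obtain B1 C where B1: "B1 \<in> cylinders T \<xi> N" and C: "C \<in> cylinders T \<xi> (j * N)"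
      and B: "B = B1 \<inter> (T ^^ N) -` C"
      using cylinders_split[of B T \<xi> N "j * N"] unfolding mult_Suc by blast
    have 1: "dist x y \<le> \<rho> * dist ((T ^^ N) x) ((T ^^ N) y)"
      and 2: "dist ((T ^^ N) x) ((T ^^ N) y) \<le> \<rho> ^ j * max D0 1"
      using Suc.prems B exp[OF B1, of x y] Suc.IH[OF C] by blast+
    have "dist x y \<le> \<rho> * (\<rho> ^ j * max D0 1)"
      using \<rho> by (intro order_trans[OF 1] mult_left_mono 2) auto
    then show ?case by (simp add: mult_ac)
  qed (use D in simp)
  define \<kappa> where "\<kappa> = root N \<rho>"
  have \<kappa>: "0 < \<kappa>" "\<kappa> < 1" "\<kappa> ^ N = \<rho>"
    using N \<rho> by (auto simp: \<kappa>_def)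
  have "dist x y \<le> (max D0 1 / \<rho>) * \<kappa> ^ n" if B: "B \<in> cylinders T \<xi> n" "x \<in> B" "y \<in> B" for n B x y
  proof -
    obtain B' where "B' \<in> cylinders T \<xi> (n div N * N)" "B \<subseteq> B'"
      using cylinders_mono[OF B(1), of "n div N * N"] by auto
    then have "dist x y \<le> \<rho> ^ (n div N) * max D0 1" using j B by blast
    also have "\<rho> ^ (n div N) = \<kappa> ^ (n div N * N)"
      using \<kappa>(3) by (simp add: power_mult mult.commute[of _ N])
    also have "\<kappa> ^ (n div N * N) \<le> \<kappa> ^ n / \<rho>"
    proof -
      have "\<kappa> ^ N \<le> \<kappa> ^ (n mod N)"
        using \<kappa> N by (intro power_decreasing) (auto simp: less_imp_le)
      then have "\<kappa> ^ (n div N * N) * \<rho> \<le> \<kappa> ^ (n div N * N) * \<kappa> ^ (n mod N)"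
        using \<kappa> by (intro mult_left_mono) auto
      also have "\<dots> = \<kappa> ^ n" by (simp flip: power_add)
      finally show ?thesis using \<rho> by (simp add: field_simps)
    qed
    finally show ?thesis by (simp add: mult_ac mult_right_mono)
  qed
  moreover have "0 < max D0 1 / \<rho>" using \<rho> by (simp add: less_max_iff_disj)
  ultimately show thesis by (intro that[OF \<kappa>(1,2)])
qed

text \<open>On a cylinder of rank \<open>n\<close> the branch density varies by at most the factor
  \<open>1 + r0 * C * \<kappa> ^ n\<close>, which integration turns into a comparison of masses. The
  exponential form makes constants additive under composition, and \<open>R\<close> is a maximum so
  that one constant serves both diameters and distortion.\<close>

lemma branch_distortion:
  obtains \<kappa> R where "0 < \<kappa>" "\<kappa> < 1" "0 < R"
    "\<And>n B x y. B \<in> cylinders T \<xi> n \<Longrightarrow> x \<in> B \<Longrightarrow> y \<in> B \<Longrightarrow> dist x y \<le> R * \<kappa> ^ n"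
    "\<And>n B Z E F. Z \<in> \<xi> \<Longrightarrow> B \<in> cylinders T \<xi> n \<Longrightarrow> E \<in> sets M \<Longrightarrow> F \<in> sets M \<Longrightarrow>
       E \<subseteq> B \<inter> T ` Z \<Longrightarrow> F \<subseteq> B \<inter> T ` Z \<Longrightarrow>
       prob (Z \<inter> T -` E) * prob F \<le> exp (R * \<kappa> ^ n) * prob (Z \<inter> T -` F) * prob E"
proof -
  obtain \<kappa> C where \<kappa>: "0 < \<kappa>" "\<kappa> < 1" "0 < C" and
    diam: "\<And>n B x y. B \<in> cylinders T \<xi> n \<Longrightarrow> x \<in> B \<Longrightarrow> y \<in> B \<Longrightarrow> dist x y \<le> C * \<kappa> ^ n"
    by (rule cylinder_diameter) blast
  obtain r0 g where r0: "r0 > 0" and gl: "\<forall>Z\<in>\<xi>. inverse_branch_density M T 1 Z (g Z) \<and>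
      ratio_lipschitz_on r0 (T ` Z) (g Z)"
    using distortion by auto
  then have g: "\<And>Z. Z \<in> \<xi> \<Longrightarrow> inverse_branch_density M T 1 Z (g Z)"
    and lip: "\<And>Z. Z \<in> \<xi> \<Longrightarrow> ratio_lipschitz_on r0 (T ` Z) (g Z)"
    by auto
  define R where "R = max C (r0 * C)"
  have "dist x y \<le> R * \<kappa> ^ n" if "B \<in> cylinders T \<xi> n" "x \<in> B" "y \<in> B" for n B x y
  proof -
    have "C * \<kappa> ^ n \<le> R * \<kappa> ^ n" using \<kappa> by (intro mult_right_mono) (auto simp: R_def)
    then show ?thesis using diam[OF that] by linarith
  qed
  note diamR = this
  have dist: "prob (Z \<inter> T -` E) * prob F \<le> exp (R * \<kappa> ^ n) * prob (Z \<inter> T -` F) * prob E"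
    if Z: "Z \<in> \<xi>" and B: "B \<in> cylinders T \<xi> n" and [measurable]: "E \<in> sets M" "F \<in> sets M"
      and EF: "E \<subseteq> B \<inter> T ` Z" "F \<subseteq> B \<inter> T ` Z" for n B Z E F
  proof -
    have [measurable]: "g Z \<in> borel_measurable M" and nn: "\<And>x. x \<in> T ` Z \<Longrightarrow> 0 \<le> g Z x"
      and int: "\<And>E. E \<in> sets M \<Longrightarrow> E \<subseteq> T ` Z \<Longrightarrow>
        emeasure M (Z \<inter> T -` E) = (\<integral>\<^sup>+x\<in>E. ennreal (g Z x) \<partial>M)"
      using g[OF Z] inv_into_image[OF inj_on_branch[OF Z]] unfolding inverse_branch_density_def by auto
    have "g Z x \<le> exp (R * \<kappa> ^ n) * g Z y" if "x \<in> E" "y \<in> F" for x y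
    proof -
      have xy: "x \<in> T ` Z" "y \<in> T ` Z" "dist x y \<le> C * \<kappa> ^ n" using EF that diam[OF B, of x y] by auto
      have "r0 * dist x y \<le> r0 * (C * \<kappa> ^ n)" using xy r0 by (intro mult_left_mono) auto
      also have "\<dots> \<le> R * \<kappa> ^ n" using \<kappa> by (simp add: R_def mult.assoc[symmetric])
      also have "1 + R * \<kappa> ^ n \<le> exp (R * \<kappa> ^ n)" by (rule exp_ge_add_one_self)
      finally have le: "1 + r0 * dist x y \<le> exp (R * \<kappa> ^ n)" by simp
      have "0 < g Z y" "\<bar>g Z x - g Z y\<bar> \<le> r0 * dist x y * g Z y"
        using ratio_lipschitz_onD[OF lip[OF Z] nn] xy by blast+
      then have "g Z x \<le> (1 + r0 * dist x y) * g Z y" by (simp add: algebra_simps)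
      also have "\<dots> \<le> exp (R * \<kappa> ^ n) * g Z y" using le \<open>0 < g Z y\<close> by (intro mult_right_mono) auto
      finally show ?thesis .
    qed
    then have "emeasure M (Z \<inter> T -` E) * emeasure M F
        \<le> ennreal (exp (R * \<kappa> ^ n)) * emeasure M (Z \<inter> T -` F) * emeasure M E"
      using EF by (subst (1 2) int) (auto intro!: nn_integral_ratio_le)
    then show ?thesis
      by (simp add: emeasure_eq_measure ennreal_mult'[symmetric] del: ennreal_mult)
  qed
  have "0 < R" using \<kappa> by (simp add: R_def less_max_iff_disj)
  then show thesis by (rule that[OF \<kappa>(1,2) _ diamR dist])
qed

end

section \<open>Regular measures and decay of correlations\<close>

text \<open>The constants delivered by \<open>branch_distortion\<close> are fixed here once, and
  mixing is assumed from here on.\<close>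

locale distortion_control = gibbs_markov M T \<xi>
  for M :: "'a::metric_space measure" and T :: "'a \<Rightarrow> 'a" and \<xi> :: "'a set set" +
  fixes \<kappa> R :: real
  assumes \<kappa>_pos: "0 < \<kappa>" and \<kappa>_less_1: "\<kappa> < 1" and R_pos: "0 < R"
    and diameter: "B \<in> cylinders T \<xi> n \<Longrightarrow> x \<in> B \<Longrightarrow> y \<in> B \<Longrightarrow> dist x y \<le> R * \<kappa> ^ n"
    and bounded_distortion:
      "Z \<in> \<xi> \<Longrightarrow> B \<in> cylinders T \<xi> n \<Longrightarrow> E \<in> sets M \<Longrightarrow> F \<in> sets M \<Longrightarrow>
       E \<subseteq> B \<inter> T ` Z \<Longrightarrow> F \<subseteq> B \<inter> T ` Z \<Longrightarrow>
       prob (Z \<inter> T -` E) * prob F \<le> exp (R * \<kappa> ^ n) * prob (Z \<inter> T -` F) * prob E"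
    and mixing_T: "mixing M T"
begin

section \<open>Regularity under restriction, push-forward and subtraction\<close>

lemma \<kappa>_power_le_1: "\<kappa> ^ n \<le> 1"
  using \<kappa>_pos \<kappa>_less_1 by (simp add: power_le_one)

text \<open>Regularity of the density, expressed by products of masses: no version of the density has to be
  chosen and null cylinders need no exception.\<close>

definition reg :: "nat \<Rightarrow> real \<Rightarrow> ('a set \<Rightarrow> real) \<Rightarrow> bool" where
  "reg m s \<nu> \<longleftrightarrow> acm \<nu> \<and> (\<forall>n\<ge>m. \<forall>B\<in>cylinders T \<xi> n. \<forall>E\<in>sets M. \<forall>F\<in>sets M.
     E \<subseteq> B \<longrightarrow> F \<subseteq> B \<longrightarrow> \<nu> E * prob F \<le> exp (s * \<kappa> ^ n) * \<nu> F * prob E)"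

text \<open>The fixed point of \<open>s \<mapsto> \<kappa> * s + R\<close>, the effect of one
  push-forward on the regularity constant. Iteration brings any starting constant geometrically
  close to it.\<close>

definition distortion_limit :: real  ("s\<^sub>0") where
  "s\<^sub>0 = R / (1 - \<kappa>)"

definition image_bound :: real  ("c\<^sub>0") where
  "c\<^sub>0 = (INF Z\<in>\<xi>. prob (T ` Z))"

lemma s0_pos: "0 < s\<^sub>0" and s0_fixed: "\<kappa> * s\<^sub>0 + R = s\<^sub>0"
  using \<kappa>_less_1 R_pos by (simp_all add: distortion_limit_def field_simps)

lemma c0_pos: "0 < c\<^sub>0"
  using big_image by (simp add: image_bound_def)

lemma c0_le: "Z \<in> \<xi> \<Longrightarrow> c\<^sub>0 \<le> prob (T ` Z)"
  unfolding image_bound_def by (intro cINF_lower bdd_belowI2[where m=0]) auto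

lemma reg_acm: "reg m s \<nu> \<Longrightarrow> acm \<nu>"
  by (simp add: reg_def)

lemma regD:
  assumes "reg m s \<nu>" "m \<le> n" "B \<in> cylinders T \<xi> n" "E \<in> sets M" "F \<in> sets M" "E \<subseteq> B" "F \<subseteq> B"
  shows "\<nu> E * prob F \<le> exp (s * \<kappa> ^ n) * \<nu> F * prob E"
  using assms unfolding reg_def by blast

lemma regI:
  assumes "acm \<nu>"
    and "\<And>n B E F. m \<le> n \<Longrightarrow> B \<in> cylinders T \<xi> n \<Longrightarrow> E \<in> sets M \<Longrightarrow> F \<in> sets M \<Longrightarrow>
      E \<subseteq> B \<Longrightarrow> F \<subseteq> B \<Longrightarrow> \<nu> E * prob F \<le> exp (s * \<kappa> ^ n) * \<nu> F * prob E"
  shows "reg m s \<nu>"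
  using assms unfolding reg_def by blast

lemma reg_mono:
  assumes reg: "reg m s \<nu>" and "m \<le> m'" "s \<le> s'"
  shows "reg m' s' \<nu>"
proof (rule regI)
  show acm: "acm \<nu>" using reg by (rule reg_acm)
  fix n B E F
  assume *: "m' \<le> n" "B \<in> cylinders T \<xi> n" "E \<in> sets M" "F \<in> sets M" "E \<subseteq> B" "F \<subseteq> B"
  have "s * \<kappa> ^ n \<le> s' * \<kappa> ^ n" using assms \<kappa>_pos by (intro mult_right_mono) auto
  then have "exp (s * \<kappa> ^ n) * (\<nu> F * prob E) \<le> exp (s' * \<kappa> ^ n) * (\<nu> F * prob E)"
    using acm_nonneg[OF acm *(4)] by (intro mult_right_mono mult_nonneg_nonneg) auto
  moreover have "m \<le> n" using *(1) assms(2) by simp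
  ultimately show "\<nu> E * prob F \<le> exp (s' * \<kappa> ^ n) * \<nu> F * prob E"
    using regD[OF reg _ *(2-)] by (simp add: mult.assoc)
qed

lemma reg_prob: "reg 1 0 prob"
  by (rule regI) (simp_all add: acm_prob mult.commute)

lemma reg_restrict_sets:
  assumes reg: "reg m s \<nu>" and G: "G \<in> sets M"
    and dich: "\<And>n B. k \<le> n \<Longrightarrow> B \<in> cylinders T \<xi> n \<Longrightarrow> B \<subseteq> G \<or> B \<inter> G = {}"
  shows "reg (max m k) s (\<lambda>E. \<nu> (E \<inter> G))"
proof (rule regI)
  show "acm (\<lambda>E. \<nu> (E \<inter> G))" by (rule acm_restrict[OF reg_acm[OF reg] G])
  fix n B E F
  assume *: "max m k \<le> n" "B \<in> cylinders T \<xi> n" "E \<in> sets M" "F \<in> sets M" "E \<subseteq> B" "F \<subseteq> B"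
  have "k \<le> n" "m \<le> n" using *(1) by auto
  from dich[OF this(1) *(2)]
  show "\<nu> (E \<inter> G) * prob F \<le> exp (s * \<kappa> ^ n) * \<nu> (F \<inter> G) * prob E"
  proof
    assume "B \<subseteq> G"
    then have "E \<inter> G = E" "F \<inter> G = F" using *(5,6) by auto
    then show ?thesis using regD[OF reg \<open>m \<le> n\<close> *(2-)] by simp
  next
    assume "B \<inter> G = {}"
    then have "E \<inter> G = {}" "F \<inter> G = {}" using *(5,6) by auto
    then show ?thesis using acm_empty[OF reg_acm[OF reg]] by simp
  qed
qed

lemma reg_restrict:
  assumes "reg m s \<nu>" "C \<in> cylinders T \<xi> k"
  shows "reg (max m k) s (\<lambda>E. \<nu> (E \<inter> C))"
proof (rule reg_restrict_sets[OF assms(1)])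
  fix n B assume "k \<le> n" "B \<in> cylinders T \<xi> n"
  then show "B \<subseteq> C \<or> B \<inter> C = {}"
    using cylinders_dichotomy[OF disjoint_partition _ assms(2)] by blast
qed (rule cylinders_sets[OF assms(2)])

lemma reg_restrict_Compl:
  assumes "reg m s \<nu>" "C \<in> cylinders T \<xi> k"
  shows "reg (max m k) s (\<lambda>E. \<nu> (E \<inter> - C))"
proof (rule reg_restrict_sets[OF assms(1)])
  fix n B assume "k \<le> n" "B \<in> cylinders T \<xi> n"
  then show "B \<subseteq> - C \<or> B \<inter> - C = {}"
    using cylinders_dichotomy[OF disjoint_partition _ assms(2)] by blast
qed (rule Compl_sets[OF cylinders_sets[OF assms(2)]])

text \<open>Two comparisons are chained: regularity at rank \<open>Suc n\<close> replaces
  \<open>\<nu>\<close> by \<open>prob\<close> on the preimages within \<open>Z\<close>, and bounded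
  distortion of the branch replaces preimages by images.\<close>

lemma reg_branch:
  assumes reg: "reg m s \<nu>" and m: "m \<le> Suc n" and B: "B \<in> cylinders T \<xi> n" and Z: "Z \<in> \<xi>"
    and E: "E \<in> sets M" "E \<subseteq> B \<inter> T ` Z" and F: "F \<in> sets M" "F \<subseteq> B \<inter> T ` Z"
  shows "\<nu> (Z \<inter> T -` E) * prob F \<le> exp (s * \<kappa> ^ Suc n + R * \<kappa> ^ n) * \<nu> (Z \<inter> T -` F) * prob E"
proof -
  define p q a b x y where "p = \<nu> (Z \<inter> T -` E)" and "q = \<nu> (Z \<inter> T -` F)"
    and "a = prob (Z \<inter> T -` E)" and "b = prob (Z \<inter> T -` F)"
    and "x = exp (s * \<kappa> ^ Suc n)" and "y = exp (R * \<kappa> ^ n)"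
  note d = this
  note acm = reg_acm[OF reg]
  have s: "Z \<inter> T -` E \<in> sets M" "Z \<inter> T -` F \<in> sets M"
    using Z E F by (auto intro!: sets.Int vimage_sets)
  have nn: "0 \<le> p" "0 \<le> q" "0 \<le> a" "0 \<le> b" "0 < x" "0 < y"
    using s by (simp_all add: d acm_nonneg[OF acm])
  have cyl: "Z \<inter> T -` B \<in> cylinders T \<xi> (Suc n)" using Z B unfolding cylinders_Suc by blast
  have 1: "p * b \<le> x * q * a"
    unfolding d by (rule regD[OF reg m cyl s]) (use E F in auto)
  have 2: "a * prob F \<le> y * b * prob E"
    unfolding d by (rule bounded_distortion[OF Z B E(1) F(1) E(2) F(2)])
  \<comment> \<open>The intermediate mass \<open>b\<close> has to be cancelled. If it vanishes,
    distortion makes \<open>a\<close> or \<open>prob F\<close> vanish, and in the first case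
    absolute continuity gives \<open>p = 0\<close>.\<close>
  have "p * prob F \<le> x * y * q * prob E"
  proof (cases "b = 0")
    case True
    then have "a * prob F \<le> 0" using 2 by simp
    moreover have "0 \<le> a * prob F" using nn by simp
    ultimately have "a * prob F = 0" by linarith
    then have "a = 0 \<or> prob F = 0" by simp
    moreover have "p = 0" if "a = 0" using that s unfolding d by (intro acm_null[OF acm])
    ultimately have "p * prob F = 0" by auto
    moreover have "0 \<le> x * y * q * prob E" using nn by simp
    ultimately show ?thesis by linarith
  next
    case False
    then have b: "0 < b" using nn by simp
    have "(p * prob F) * b = (p * b) * prob F" by simp
    also have "\<dots> \<le> (x * q * a) * prob F" using 1 by (intro mult_right_mono) auto
    also have "\<dots> = (x * q) * (a * prob F)" by simp
    also have "\<dots> \<le> (x * q) * (y * b * prob E)" using 2 nn by (intro mult_left_mono) auto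
    also have "\<dots> = (x * y * q * prob E) * b" by simp
    finally show ?thesis using b by (rule mult_right_le_imp_le)
  qed
  then show ?thesis by (simp add: d exp_add)
qed

lemma prob_branch_eq_0:
  assumes Z: "Z \<in> \<xi>" and E: "E \<in> sets M" "prob (E \<inter> T ` Z) = 0"
  shows "prob (Z \<inter> T -` E) = 0"
proof -
  have "prob (Z \<inter> T -` (E \<inter> T ` Z)) * prob (T ` Z)
      \<le> exp (R * \<kappa> ^ 0) * prob (Z \<inter> T -` (T ` Z)) * prob (E \<inter> T ` Z)"
    using Z E by (intro bounded_distortion[of Z UNIV 0]) auto
  moreover have "Z \<inter> T -` (E \<inter> T ` Z) = Z \<inter> T -` E" by auto
  ultimately have "prob (Z \<inter> T -` E) * prob (T ` Z) \<le> 0" using E(2) by simp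
  then show ?thesis using image_pos[OF Z] measure_nonneg[of M "Z \<inter> T -` E"]
    by (simp add: mult_le_0_iff)
qed

text \<open>By the Markov property a cylinder of positive rank is, up to null sets, either contained
  in the image of a branch or disjoint from it. So the branches can be compared on all of
  \<open>B\<close> and then summed. Ranks shift by one, and \<open>s * \<kappa> ^ Suc n + R *
  \<kappa> ^ n = (\<kappa> * s + R) * \<kappa> ^ n\<close>. The rank stays at least \<open>1\<close>
  because the image of a branch need not contain the cylinder \<open>UNIV\<close> of rank
  \<open>0\<close>.\<close>

lemma reg_push1:
  assumes reg: "reg m s \<nu>"
  shows "reg (max 1 (m - 1)) (\<kappa> * s + R) (\<lambda>E. \<nu> (T -` E))"
proof (rule regI)
  note acm = reg_acm[OF reg]
  show "acm (\<lambda>E. \<nu> (T -` E))" using acm_push[OF acm, of 1] by simp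
  fix n B E F
  assume *: "max 1 (m - 1) \<le> n" "B \<in> cylinders T \<xi> n" "E \<in> sets M" "F \<in> sets M" "E \<subseteq> B" "F \<subseteq> B"
  have n: "1 \<le> n" "m \<le> Suc n" using *(1) by auto
  obtain Z' where Z': "Z' \<in> \<xi>" "B \<subseteq> Z'" using cylinders_mono[OF *(2) n(1)] by auto
  have "prob F * \<nu> (Z \<inter> T -` E) \<le> (exp ((\<kappa> * s + R) * \<kappa> ^ n) * prob E) * \<nu> (Z \<inter> T -` F)"
    if Z: "Z \<in> \<xi>" for Z
  proof -
    have sets: "Z \<inter> T -` E \<in> sets M" "Z \<inter> T -` F \<in> sets M"
      using Z *(3,4) by (auto intro!: sets.Int vimage_sets)
    show ?thesis using image_disjoint_or_contains[OF Z Z'(1)]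
    proof
      assume 0: "prob (T ` Z \<inter> Z') = 0"
      have "prob (E \<inter> T ` Z) \<le> prob (T ` Z \<inter> Z')"
      proof (rule finite_measure_mono)
        show "E \<inter> T ` Z \<subseteq> T ` Z \<inter> Z'" using Z'(2) *(5) by blast
        show "T ` Z \<inter> Z' \<in> sets M" using Z Z'(1) by (intro sets.Int) auto
      qed
      then have "prob (E \<inter> T ` Z) = 0" using measure_nonneg[of M "E \<inter> T ` Z"] 0 by linarith
      then have "prob (Z \<inter> T -` E) = 0" by (rule prob_branch_eq_0[OF Z *(3)])
      then have "\<nu> (Z \<inter> T -` E) = 0" by (rule acm_null[OF acm sets(1)])
      moreover have "0 \<le> \<nu> (Z \<inter> T -` F)" by (rule acm_nonneg[OF acm sets(2)])
      ultimately show ?thesis by simp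
    next
      assume TZ: "Z' \<subseteq> T ` Z"
      have "E \<subseteq> B \<inter> T ` Z" "F \<subseteq> B \<inter> T ` Z" using TZ Z'(2) *(5,6) by blast+
      then have "\<nu> (Z \<inter> T -` E) * prob F
          \<le> exp (s * \<kappa> ^ Suc n + R * \<kappa> ^ n) * \<nu> (Z \<inter> T -` F) * prob E"
        by (intro reg_branch[OF reg n(2) *(2) Z *(3) _ *(4)])
      then show ?thesis by (simp add: algebra_simps)
    qed
  qed
  then have "prob F * \<nu> (T -` E) \<le> (exp ((\<kappa> * s + R) * \<kappa> ^ n) * prob E) * \<nu> (T -` F)"
    by (rule acm_partition_le[OF acm acm vimage_sets[OF *(3)] vimage_sets[OF *(4)]])
  then show "\<nu> (T -` E) * prob F \<le> exp ((\<kappa> * s + R) * \<kappa> ^ n) * \<nu> (T -` F) * prob E"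
    by (simp add: mult_ac)
qed

lemma reg_push:
  assumes reg: "reg m s \<nu>" and "1 \<le> m"
  shows "reg (max 1 (m - j)) (\<kappa> ^ j * s + s\<^sub>0) (\<lambda>E. \<nu> ((T ^^ j) -` E))"
proof (induction j)
  case 0
  have "reg m (s + s\<^sub>0) \<nu>" using s0_pos by (intro reg_mono[OF reg]) auto
  then show ?case using \<open>1 \<le> m\<close> by (simp add: max_def)
next
  case (Suc j)
  have "\<kappa> * (\<kappa> ^ j * s + s\<^sub>0) + R = \<kappa> ^ Suc j * s + s\<^sub>0"
    using s0_fixed by (simp add: algebra_simps)
  moreover have "max 1 (max 1 (m - j) - 1) = max 1 (m - Suc j)" by (simp add: max_def)
  ultimately show ?case using reg_push1[OF Suc] unfolding funpow_Suc_vimage by metis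
qed

text \<open>This is where big images enter: within a branch, \<open>E\<close> is compared with the
  whole image, whose measure is at least \<open>c\<^sub>0\<close>. The cylinder \<open>UNIV\<close>
  of rank \<open>0\<close> is admissible in \<open>reg_branch\<close> because its preimage within
  \<open>Z\<close> has rank \<open>1\<close>.\<close>

lemma reg_bounded:
  assumes reg: "reg 1 s \<nu>" and E: "E \<in> sets M"
  shows "\<nu> (T -` E) \<le> exp (s * \<kappa> + R) / c\<^sub>0 * prob E * \<nu> UNIV"
proof -
  note acm = reg_acm[OF reg]
  have "1 * \<nu> (Z \<inter> T -` E) \<le> (exp (s * \<kappa> + R) / c\<^sub>0 * prob E) * \<nu> (Z \<inter> UNIV)" if Z: "Z \<in> \<xi>" for Z
  proof -
    have eq: "Z \<inter> T -` (E \<inter> T ` Z) = Z \<inter> T -` E" "Z \<inter> T -` (T ` Z) = Z" by auto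
    have sets: "Z \<inter> T -` E \<in> sets M" "Z \<in> sets M" "E \<inter> T ` Z \<in> sets M" "T ` Z \<in> sets M"
      using Z E by (auto intro!: sets.Int vimage_sets)
    note nn = acm_nonneg[OF acm sets(1)] acm_nonneg[OF acm sets(2)]
    have "\<nu> (Z \<inter> T -` E) * c\<^sub>0 \<le> \<nu> (Z \<inter> T -` E) * prob (T ` Z)"
      using c0_le[OF Z] nn(1) by (rule mult_left_mono)
    also have "\<dots> = \<nu> (Z \<inter> T -` (E \<inter> T ` Z)) * prob (T ` Z)" by (simp only: eq)
    also have "\<dots> \<le> exp (s * \<kappa> ^ Suc 0 + R * \<kappa> ^ 0) * \<nu> (Z \<inter> T -` (T ` Z)) * prob (E \<inter> T ` Z)"
      by (rule reg_branch[OF reg, of 0 UNIV]) (use Z sets in auto)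
    also have "\<dots> = exp (s * \<kappa> + R) * \<nu> Z * prob (E \<inter> T ` Z)"
      by (simp only: eq) simp
    also have "\<dots> \<le> exp (s * \<kappa> + R) * \<nu> Z * prob E"
      using nn E by (intro mult_left_mono finite_measure_mono) auto
    finally show ?thesis using c0_pos by (simp add: field_simps)
  qed
  then have "1 * \<nu> (T -` E) \<le> (exp (s * \<kappa> + R) / c\<^sub>0 * prob E) * \<nu> UNIV"
    by (rule acm_partition_le[OF acm acm vimage_sets[OF E] UNIV_sets])
  then show ?thesis by simp
qed

text \<open>The comparison with the whole image in the opposite direction, where its measure is
  estimated by \<open>1\<close>. It supplies the lower bound for the Doeblin condition.\<close>

lemma reg_branch_lower:
  assumes reg: "reg 1 s \<nu>" and Z: "Z \<in> \<xi>" and E: "E \<in> sets M"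
  shows "\<nu> Z * prob (E \<inter> T ` Z) \<le> exp (s * \<kappa> + R) * \<nu> (Z \<inter> T -` E)"
proof -
  note acm = reg_acm[OF reg]
  have eq: "Z \<inter> T -` (E \<inter> T ` Z) = Z \<inter> T -` E" "Z \<inter> T -` (T ` Z) = Z" by auto
  have sets: "Z \<inter> T -` E \<in> sets M" "E \<inter> T ` Z \<in> sets M" "T ` Z \<in> sets M"
    using Z E by (auto intro!: sets.Int vimage_sets)
  have "\<nu> (Z \<inter> T -` (T ` Z)) * prob (E \<inter> T ` Z)
      \<le> exp (s * \<kappa> ^ Suc 0 + R * \<kappa> ^ 0) * \<nu> (Z \<inter> T -` (E \<inter> T ` Z)) * prob (T ` Z)"
    by (rule reg_branch[OF reg, of 0 UNIV]) (use Z sets in auto)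
  also have "\<dots> = exp (s * \<kappa> + R) * \<nu> (Z \<inter> T -` E) * prob (T ` Z)"
    by (simp only: eq) simp
  also have "\<dots> \<le> exp (s * \<kappa> + R) * \<nu> (Z \<inter> T -` E) * 1"
    using acm_nonneg[OF acm sets(1)] by (intro mult_left_mono) auto
  finally show ?thesis by (simp add: eq)
qed

lemma reg_scale:
  assumes reg: "reg m s \<nu>" and c: "0 \<le> c"
  shows "reg m s (\<lambda>E. c * \<nu> E)"
proof (rule regI)
  note acm = reg_acm[OF reg]
  show "acm (\<lambda>E. c * \<nu> E)"
    unfolding acm_def
  proof (intro conjI ballI allI impI)
    fix D :: "nat \<Rightarrow> 'a set" assume D: "range D \<subseteq> sets M" "disjoint_family D"
    show "(\<lambda>i. c * \<nu> (D i)) sums (c * \<nu> (\<Union> (range D)))"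
      using D by (intro sums_mult acm_sums[OF acm]) blast+
  qed (use c acm_nonneg[OF acm] acm_null[OF acm] in simp_all)
  fix n B E F
  assume *: "m \<le> n" "B \<in> cylinders T \<xi> n" "E \<in> sets M" "F \<in> sets M" "E \<subseteq> B" "F \<subseteq> B"
  have "c * (\<nu> E * prob F) \<le> c * (exp (s * \<kappa> ^ n) * \<nu> F * prob E)"
    by (rule mult_left_mono[OF regD[OF reg *] c])
  then show "c * \<nu> E * prob F \<le> exp (s * \<kappa> ^ n) * (c * \<nu> F) * prob E"
    by (simp add: mult_ac)
qed

text \<open>A difference of regular measures may be very irregular; the condition that at most half
  of the mass of every set is removed excludes such cancellation. The factor \<open>3\<close> is the
  exponent in \<open>diff_ratio_le\<close>.\<close>

lemma reg_diff:
  assumes reg: "reg m s \<nu>" "reg m s \<nu>'" and s: "0 \<le> s"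
    and le: "\<And>E. E \<in> sets M \<Longrightarrow> 2 * \<nu>' E \<le> \<nu> E"
  shows "reg m (3 * s) (\<lambda>E. \<nu> E - \<nu>' E)"
proof (rule regI)
  note acm = reg_acm[OF reg(1)] reg_acm[OF reg(2)]
  show "acm (\<lambda>E. \<nu> E - \<nu>' E)"
    unfolding acm_def
  proof (intro conjI ballI allI impI)
    fix D :: "nat \<Rightarrow> 'a set" assume D: "range D \<subseteq> sets M" "disjoint_family D"
    show "(\<lambda>i. \<nu> (D i) - \<nu>' (D i)) sums (\<nu> (\<Union> (range D)) - \<nu>' (\<Union> (range D)))"
      using D by (intro sums_diff acm_sums[OF acm(1)] acm_sums[OF acm(2)]) blast+
  next
    fix E assume "E \<in> sets M"
    then show "0 \<le> \<nu> E - \<nu>' E" using le[of E] acm_nonneg[OF acm(2), of E] by linarith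
  qed (simp add: acm_null[OF acm(1)] acm_null[OF acm(2)])
  fix n B E F
  assume *: "m \<le> n" "B \<in> cylinders T \<xi> n" "E \<in> sets M" "F \<in> sets M" "E \<subseteq> B" "F \<subseteq> B"
  have "exp (3 * s * \<kappa> ^ n) = exp (s * \<kappa> ^ n) ^ 3"
    using exp_of_nat_mult[of 3 "s * \<kappa> ^ n"] by (simp add: mult.assoc)
  moreover have "(\<nu> E - \<nu>' E) * prob F \<le> exp (s * \<kappa> ^ n) ^ 3 * (\<nu> F - \<nu>' F) * prob E"
  proof (rule diff_ratio_le)
    show "1 \<le> exp (s * \<kappa> ^ n)" using s \<kappa>_pos by simp
    show "\<nu> E * prob F \<le> exp (s * \<kappa> ^ n) * \<nu> F * prob E" by (rule regD[OF reg(1) *])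
    show "\<nu>' F * prob E \<le> exp (s * \<kappa> ^ n) * \<nu>' E * prob F"
      by (rule regD[OF reg(2) *(1,2) *(4) *(3) *(6) *(5)])
  qed (use le[OF *(4)] acm_nonneg[OF acm(2) *(4)] in auto)
  ultimately show "(\<nu> E - \<nu>' E) * prob F \<le> exp (3 * s * \<kappa> ^ n) * (\<nu> F - \<nu>' F) * prob E"
    by simp
qed

section \<open>Doeblin condition and exponential convergence\<close>

text \<open>Finitely many elements of the partition carry more than \<open>1 - c\<^sub>0\<close> of
  the mass, so the image of every branch meets one of them with positive measure and then contains
  it by the Markov property. Mixing thus has to be applied to finitely many pairs of sets
  only.\<close>

lemma finite_big_subset:
  obtains \<F> where "finite \<F>" "\<F> \<subseteq> \<xi>" "\<And>Z. Z \<in> \<xi> \<Longrightarrow> \<exists>Z'\<in>\<F>. Z' \<subseteq> T ` Z"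
proof -
  obtain Zs :: "nat \<Rightarrow> 'a set" where Zs: "disjoint_family Zs" "\<And>i. Zs i \<in> \<xi> \<or> Zs i = {}"
    "(\<Union>i. Zs i) = \<Union>\<xi>" by (rule partition_enum) blast
  have sets: "Zs i \<in> sets M" for i using Zs(2)[of i] by auto
  have "(\<lambda>i. prob (Zs i \<inter> UNIV)) sums prob UNIV"
    by (rule acm_partition_sums[OF acm_prob Zs UNIV_sets])
  then have "(\<lambda>n. \<Sum>i<n. prob (Zs i)) \<longlonglongrightarrow> 1" by (simp add: sums_def)
  then have "\<forall>\<^sub>F n in sequentially. 1 - c\<^sub>0 < (\<Sum>i<n. prob (Zs i))"
    by (rule order_tendstoD) (use c0_pos in simp)
  then obtain n where n: "1 - c\<^sub>0 < (\<Sum>i<n. prob (Zs i))"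
    using eventually_happens'[OF sequentially_bot] by blast
  have U: "prob (\<Union>i<n. Zs i) = (\<Sum>i<n. prob (Zs i))"
    using sets Zs(1) by (intro finite_measure_finite_Union) (auto simp: disjoint_family_on_def)
  have Us: "(\<Union>i<n. Zs i) \<in> sets M" using sets by auto
  show thesis
  proof (rule that[of "Zs ` {..<n} \<inter> \<xi>"])
    fix Z assume Z: "Z \<in> \<xi>"
    show "\<exists>Z'\<in>Zs ` {..<n} \<inter> \<xi>. Z' \<subseteq> T ` Z"
    proof (rule ccontr)
      assume no: "\<not> ?thesis"
      have 0: "prob (T ` Z \<inter> Zs i) = 0" if "i < n" for i
      proof (cases "Zs i \<in> \<xi>")
        case True
        then have "\<not> Zs i \<subseteq> T ` Z" using no that by blast
        then show ?thesis using image_disjoint_or_contains[OF Z True] by blast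
      next
        case False
        then show ?thesis using Zs(2)[of i] by simp
      qed
      have TZ: "T ` Z \<in> sets M" using Z by auto
      have "prob (\<Union>i<n. T ` Z \<inter> Zs i) \<le> (\<Sum>i<n. prob (T ` Z \<inter> Zs i))"
        using sets TZ by (intro acm_UN_le[OF acm_prob]) auto
      also have "\<dots> = 0" using 0 by simp
      finally have 1: "prob (\<Union>i<n. T ` Z \<inter> Zs i) \<le> 0" .
      have "T ` Z \<inter> (\<Union>i<n. Zs i) = (\<Union>i<n. T ` Z \<inter> Zs i)" by auto
      then have "prob (T ` Z) = prob (\<Union>i<n. T ` Z \<inter> Zs i) + prob (T ` Z - (\<Union>i<n. Zs i))"
        using acm_split[OF acm_prob TZ Us] by simp
      also have "\<dots> \<le> 0 + prob (UNIV - (\<Union>i<n. Zs i))"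
        using 1 TZ Us by (intro add_mono finite_measure_mono) auto
      also have "\<dots> = 1 - (\<Sum>i<n. prob (Zs i))"
        using acm_split[OF acm_prob UNIV_sets Us] U by simp
      finally show False using c0_le[OF Z] n by linarith
    qed
  qed auto
qed

text \<open>In one step every branch covers a member of the finite family \<open>\<F>\<close>.
  Mixing gives a common time \<open>n\<close> at which each member has sent mass into
  \<open>Z\<^sub>0\<close>, and regularity of the pushed mass spreads it evenly over
  \<open>Z\<^sub>0\<close>; together this takes \<open>Suc n\<close> steps. The proportion
  \<open>\<eta>\<close> is half of the smallest mass \<open>pm\<close> in \<open>\<F>\<close>,
  divided by the distortion factors \<open>x\<close> of the later steps and \<open>y\<close> of the
  first one.\<close>

lemma doeblin:
  assumes Z0: "Z\<^sub>0 \<in> \<xi>"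
  obtains N \<eta> where "0 < \<eta>" "\<And>\<nu> E. reg 1 s \<nu> \<Longrightarrow> E \<in> sets M \<Longrightarrow>
    \<eta> * prob (E \<inter> Z\<^sub>0) * \<nu> UNIV \<le> \<nu> ((T ^^ N) -` E)"
proof -
  obtain \<F> where F: "finite \<F>" "\<F> \<subseteq> \<xi>" "\<And>Z. Z \<in> \<xi> \<Longrightarrow> \<exists>Z'\<in>\<F>. Z' \<subseteq> T ` Z"
    by (rule finite_big_subset) blast
  have "\<forall>\<^sub>F n in sequentially. \<forall>Z\<in>\<F>. prob Z * prob Z\<^sub>0 / 2 < prob (Z \<inter> (T ^^ n) -` Z\<^sub>0)"
  proof (rule eventually_ball_finite[OF F(1)], intro ballI)
    fix Z assume "Z \<in> \<F>"
    then have Z: "Z \<in> \<xi>" using F by auto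
    have "(\<lambda>n. prob (Z \<inter> ((T ^^ n) -` Z\<^sub>0 \<inter> space M))) \<longlonglongrightarrow> prob Z * prob Z\<^sub>0"
      using mixing_T Z Z0 unfolding mixing_def by blast
    then have "(\<lambda>n. prob (Z \<inter> (T ^^ n) -` Z\<^sub>0)) \<longlonglongrightarrow> prob Z * prob Z\<^sub>0" by simp
    then show "\<forall>\<^sub>F n in sequentially. prob Z * prob Z\<^sub>0 / 2 < prob (Z \<inter> (T ^^ n) -` Z\<^sub>0)"
      by (rule order_tendstoD) (use branch_pos[OF Z] branch_pos[OF Z0] in simp)
  qed
  then obtain n where n: "\<And>Z. Z \<in> \<F> \<Longrightarrow> prob Z * prob Z\<^sub>0 / 2 < prob (Z \<inter> (T ^^ n) -` Z\<^sub>0)"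
    using eventually_happens'[OF sequentially_bot] by blast
  define pm where "pm = Min (insert 1 (prob ` \<F>))"
  have pm: "0 < pm" "\<And>Z. Z \<in> \<F> \<Longrightarrow> pm \<le> prob Z"
    using F branch_pos by (auto simp: pm_def)
  define x where "x = exp (s\<^sub>0 * \<kappa>)"
  define y where "y = exp (s * \<kappa> + R)"
  have xy: "0 < x" "0 < y" by (simp_all add: x_def y_def)
  have low: "pm / (2 * x) * prob (E \<inter> Z\<^sub>0) \<le> prob ((T ^^ n) -` E \<inter> Z)"
    if "Z \<in> \<F>" and E: "E \<in> sets M" for Z E
  proof -
    have Z: "Z \<in> \<xi>" using F that by auto
    have "reg (max 1 1) 0 (\<lambda>E. prob (E \<inter> Z))"
      by (rule reg_restrict[OF reg_prob]) (use Z in simp)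
    from reg_push[OF this, of n]
    have reg: "reg 1 s\<^sub>0 (\<lambda>E. prob ((T ^^ n) -` E \<inter> Z))" by simp
    have "prob ((T ^^ n) -` Z\<^sub>0 \<inter> Z) * prob (E \<inter> Z\<^sub>0)
        \<le> exp (s\<^sub>0 * \<kappa> ^ 1) * prob ((T ^^ n) -` (E \<inter> Z\<^sub>0) \<inter> Z) * prob Z\<^sub>0"
      by (rule regD[OF reg, of 1 Z\<^sub>0]) (use Z0 E in auto)
    also have "\<dots> \<le> exp (s\<^sub>0 * \<kappa> ^ 1) * prob ((T ^^ n) -` E \<inter> Z) * prob Z\<^sub>0"
      using E Z by (intro mult_right_mono mult_left_mono finite_measure_mono) auto
    finally have "prob ((T ^^ n) -` Z\<^sub>0 \<inter> Z) * prob (E \<inter> Z\<^sub>0)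
        \<le> x * prob ((T ^^ n) -` E \<inter> Z) * prob Z\<^sub>0" by (simp add: x_def)
    moreover have "(pm * prob Z\<^sub>0 / 2) * prob (E \<inter> Z\<^sub>0) \<le> prob ((T ^^ n) -` Z\<^sub>0 \<inter> Z) * prob (E \<inter> Z\<^sub>0)"
    proof (rule mult_right_mono)
      have "pm * prob Z\<^sub>0 / 2 \<le> prob Z * prob Z\<^sub>0 / 2"
        using pm(2)[OF that(1)] by (simp add: mult_right_mono)
      then show "pm * prob Z\<^sub>0 / 2 \<le> prob ((T ^^ n) -` Z\<^sub>0 \<inter> Z)"
        using n[OF that(1)] by (simp add: Int_commute)
    qed simp
    ultimately have "(pm / 2 * prob (E \<inter> Z\<^sub>0)) * prob Z\<^sub>0 \<le> (x * prob ((T ^^ n) -` E \<inter> Z)) * prob Z\<^sub>0"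
      by (simp add: mult_ac)
    then have "pm / 2 * prob (E \<inter> Z\<^sub>0) \<le> x * prob ((T ^^ n) -` E \<inter> Z)"
      using branch_pos[OF Z0] by (rule mult_right_le_imp_le)
    then show ?thesis using xy by (simp add: field_simps)
  qed
  define \<eta> where "\<eta> = pm / (2 * x * y)"
  show thesis
  proof (rule that[of \<eta> "Suc n"])
    show "0 < \<eta>" using pm xy by (simp add: \<eta>_def)
    fix \<nu> E assume reg: "reg 1 s \<nu>" and E: "E \<in> sets M"
    note acm = reg_acm[OF reg]
    have "(\<eta> * prob (E \<inter> Z\<^sub>0)) * \<nu> (Z \<inter> UNIV) \<le> 1 * \<nu> (Z \<inter> T -` ((T ^^ n) -` E))" if Z: "Z \<in> \<xi>" for Z
    proof -
      obtain Z' where Z': "Z' \<in> \<F>" "Z' \<subseteq> T ` Z" using F(3)[OF Z] by blast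
      have "Z \<in> sets M" using Z by auto
      have "pm / (2 * x) * prob (E \<inter> Z\<^sub>0) \<le> prob ((T ^^ n) -` E \<inter> Z')" by (rule low[OF Z'(1) E])
      also have "\<dots> \<le> prob ((T ^^ n) -` E \<inter> T ` Z)"
        using Z Z' E by (intro finite_measure_mono) auto
      finally have "\<nu> Z * (pm / (2 * x) * prob (E \<inter> Z\<^sub>0)) \<le> \<nu> Z * prob ((T ^^ n) -` E \<inter> T ` Z)"
        by (rule mult_left_mono) (rule acm_nonneg[OF acm \<open>Z \<in> sets M\<close>])
      also have "\<dots> \<le> y * \<nu> (Z \<inter> T -` ((T ^^ n) -` E))"
        unfolding y_def by (rule reg_branch_lower[OF reg Z funpow_vimage_sets[OF E]])
      finally show ?thesis using xy by (simp add: \<eta>_def field_simps)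
    qed
    then have "(\<eta> * prob (E \<inter> Z\<^sub>0)) * \<nu> UNIV \<le> 1 * \<nu> (T -` ((T ^^ n) -` E))"
      by (rule acm_partition_le[OF acm acm UNIV_sets vimage_sets[OF funpow_vimage_sets[OF E]]])
    moreover have "(T ^^ Suc n) -` E = T -` ((T ^^ n) -` E)"
      using funpow_add_vimage[of 1 n T E] by simp
    ultimately show "\<eta> * prob (E \<inter> Z\<^sub>0) * \<nu> UNIV \<le> \<nu> ((T ^^ Suc n) -` E)" by simp
  qed
qed

lemma reg_nonneg: "reg m s \<nu> \<Longrightarrow> E \<in> sets M \<Longrightarrow> 0 \<le> \<nu> E"
  by (rule acm_nonneg[OF reg_acm])

lemma reg_subset: "reg m s \<nu> \<Longrightarrow> E \<in> sets M \<Longrightarrow> F \<in> sets M \<Longrightarrow> E \<subseteq> F \<Longrightarrow> \<nu> E \<le> \<nu> F"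
  by (rule acm_mono[OF reg_acm])

lemma \<kappa>_power_eventually_le:
  assumes "0 < (e::real)" obtains J where "\<kappa> ^ J \<le> e"
proof -
  obtain J where "\<kappa> ^ J < e" using real_arch_pow_inv[OF assms \<kappa>_less_1] by blast
  then show thesis by (intro that[of J]) simp
qed

text \<open>Only half of the Doeblin bound is subtracted, as \<open>reg_diff\<close> requires. After
  \<open>N\<close> steps the constant is at most \<open>3 * s\<^sub>0\<close>, after subtraction
  \<open>9 * s\<^sub>0\<close>, and \<open>Suc J\<close> further steps bring it back to
  \<open>2 * s\<^sub>0\<close>, so the construction can be repeated. The removed part is the total
  mass times a set function \<open>h\<close> that does not depend on \<open>\<nu>\<close>.\<close>

lemma split_off_common_part:
  obtains N \<gamma> h where "0 < N" "0 < \<gamma>" "\<gamma> < 1"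
    "\<And>\<nu>. reg 1 (2 * s\<^sub>0) \<nu> \<Longrightarrow> \<exists>\<nu>'. reg 1 (2 * s\<^sub>0) \<nu>' \<and> \<nu>' UNIV = (1 - \<gamma>) * \<nu> UNIV \<and>
       (\<forall>E\<in>sets M. \<nu> ((T ^^ N) -` E) = \<nu>' E + \<nu> UNIV * h E)"
proof -
  obtain Z0 where Z0: "Z0 \<in> \<xi>" using partition_nonempty by blast
  obtain N \<eta> where \<eta>: "0 < \<eta>" and low: "\<And>\<nu> E. reg 1 (2 * s\<^sub>0) \<nu> \<Longrightarrow> E \<in> sets M \<Longrightarrow>
    \<eta> * prob (E \<inter> Z0) * \<nu> UNIV \<le> \<nu> ((T ^^ N) -` E)"
    by (rule doeblin[OF Z0]) blast
  obtain J where J: "\<kappa> ^ J \<le> 1 / 9" by (rule \<kappa>_power_eventually_le[of "1/9"]) simp_all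
  have Z0s: "Z0 \<in> sets M" using Z0 by auto
  have "reg (max 1 1) 0 (\<lambda>E. prob (E \<inter> Z0))"
    by (rule reg_restrict[OF reg_prob]) (use Z0 in simp)
  from reg_mono[OF this, of 1 "3 * s\<^sub>0"] have regh: "reg 1 (3 * s\<^sub>0) (\<lambda>E. prob (E \<inter> Z0))"
    using s0_pos by simp
  \<comment> \<open>Testing the Doeblin bound on \<open>prob\<close> itself shows that the removed
    proportion is less than \<open>1\<close>.\<close>
  have "\<eta> * prob (UNIV \<inter> Z0) * 1 \<le> 1"
    using low[of prob UNIV] reg_mono[OF reg_prob, of 1 "2 * s\<^sub>0"] s0_pos by simp
  then have \<eta>1: "\<eta> * prob Z0 \<le> 1" by simp
  show thesis
  proof (rule that[of "N + Suc J" "\<eta> / 2 * prob Z0" "\<lambda>E. \<eta> / 2 * prob ((T ^^ Suc J) -` E \<inter> Z0)"])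
    show "0 < N + Suc J" "0 < \<eta> / 2 * prob Z0" "\<eta> / 2 * prob Z0 < 1"
      using \<eta> branch_pos[OF Z0] \<eta>1 by simp_all
    fix \<nu> assume reg: "reg 1 (2 * s\<^sub>0) \<nu>"
    define f where "f = (\<lambda>E. \<nu> ((T ^^ N) -` E) - (\<eta> / 2 * \<nu> UNIV) * prob (E \<inter> Z0))"
    have "\<kappa> ^ N * (2 * s\<^sub>0) + s\<^sub>0 \<le> 1 * (2 * s\<^sub>0) + s\<^sub>0"
      using s0_pos \<kappa>_power_le_1 by (intro add_mono mult_right_mono) auto
    then have 1: "reg 1 (3 * s\<^sub>0) (\<lambda>E. \<nu> ((T ^^ N) -` E))"
      using reg_mono[OF reg_push[OF reg, of N], of 1 "3 * s\<^sub>0"] by simp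
    have 2: "reg 1 (3 * s\<^sub>0) (\<lambda>E. (\<eta> / 2 * \<nu> UNIV) * prob (E \<inter> Z0))"
      by (rule reg_scale[OF regh]) (use \<eta> reg_nonneg[OF reg UNIV_sets] in simp)
    have "reg 1 (3 * (3 * s\<^sub>0)) f"
      unfolding f_def
    proof (rule reg_diff[OF 1 2])
      fix E assume "E \<in> sets M"
      then show "2 * ((\<eta> / 2 * \<nu> UNIV) * prob (E \<inter> Z0)) \<le> \<nu> ((T ^^ N) -` E)"
        using low[OF reg, of E] by (simp add: mult_ac)
    qed (use s0_pos in simp)
    note 3 = reg_push[OF this, of "Suc J"]
    have "\<kappa> ^ Suc J * (3 * (3 * s\<^sub>0)) + s\<^sub>0 \<le> 1 / 9 * (3 * (3 * s\<^sub>0)) + s\<^sub>0"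
    proof (intro add_mono mult_right_mono)
      have "\<kappa> ^ Suc J \<le> \<kappa> ^ J" using \<kappa>_pos \<kappa>_less_1 by (intro power_decreasing) auto
      then show "\<kappa> ^ Suc J \<le> 1 / 9" using J by simp
    qed (use s0_pos in auto)
    then have "reg 1 (2 * s\<^sub>0) (\<lambda>E. f ((T ^^ Suc J) -` E))"
      using reg_mono[OF 3, of 1 "2 * s\<^sub>0"] by simp
    moreover have "f ((T ^^ Suc J) -` UNIV) = (1 - \<eta> / 2 * prob Z0) * \<nu> UNIV"
      by (simp add: f_def algebra_simps)
    moreover have "\<nu> ((T ^^ (N + Suc J)) -` E)
        = f ((T ^^ Suc J) -` E) + \<nu> UNIV * (\<eta> / 2 * prob ((T ^^ Suc J) -` E \<inter> Z0))" for E
      unfolding f_def funpow_add_vimage by (simp add: mult_ac)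
    ultimately show "\<exists>\<nu>'. reg 1 (2 * s\<^sub>0) \<nu>' \<and> \<nu>' UNIV = (1 - \<eta> / 2 * prob Z0) * \<nu> UNIV \<and>
       (\<forall>E\<in>sets M. \<nu> ((T ^^ (N + Suc J)) -` E)
          = \<nu>' E + \<nu> UNIV * (\<eta> / 2 * prob ((T ^^ Suc J) -` E \<inter> Z0)))"
      by (intro exI[of _ "\<lambda>E. f ((T ^^ Suc J) -` E)"]) blast
  qed
qed

text \<open>Two regular measures of equal mass lose the same common part in each block of
  \<open>N\<close> steps, so only remainders of relative mass \<open>(1 - \<gamma>) ^ j\<close> can
  differ. One additional step, through \<open>reg_bounded\<close>, turns mass into a density bound
  and makes the estimate proportional to \<open>prob E\<close>.\<close>

lemma coupling:
  obtains q K where "0 < q" "q < 1" "0 < K"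
    "\<And>\<nu> \<nu>' n E. reg 1 (2 * s\<^sub>0) \<nu> \<Longrightarrow> reg 1 (2 * s\<^sub>0) \<nu>' \<Longrightarrow> \<nu> UNIV = \<nu>' UNIV \<Longrightarrow> 1 \<le> n \<Longrightarrow>
      E \<in> sets M \<Longrightarrow> \<nu> ((T ^^ n) -` E) - \<nu>' ((T ^^ n) -` E) \<le> K * q ^ n * prob E * \<nu> UNIV"
proof -
  obtain N \<gamma> h where N: "0 < N" and \<gamma>: "0 < \<gamma>" "\<gamma> < 1" and
    step: "\<And>\<nu>. reg 1 (2 * s\<^sub>0) \<nu> \<Longrightarrow> \<exists>\<nu>'. reg 1 (2 * s\<^sub>0) \<nu>' \<and> \<nu>' UNIV = (1 - \<gamma>) * \<nu> UNIV \<and>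
       (\<forall>E\<in>sets M. \<nu> ((T ^^ N) -` E) = \<nu>' E + \<nu> UNIV * h E)"
    by (rule split_off_common_part) blast
  define K\<^sub>0 where "K\<^sub>0 = exp (2 * s\<^sub>0 * \<kappa> + R) / c\<^sub>0"
  have K0: "0 < K\<^sub>0" using c0_pos by (simp add: K\<^sub>0_def)
  define q where "q = root N (1 - \<gamma>)"
  have q: "0 < q" "q < 1" "q ^ N = 1 - \<gamma>" using N \<gamma> by (auto simp: q_def)
  have iter: "\<nu> ((T ^^ (j * N + 1)) -` E) - \<nu>' ((T ^^ (j * N + 1)) -` E)
      \<le> K\<^sub>0 * prob E * ((1 - \<gamma>) ^ j * \<nu> UNIV)"
    if "reg 1 (2 * s\<^sub>0) \<nu>" "reg 1 (2 * s\<^sub>0) \<nu>'" "\<nu> UNIV = \<nu>' UNIV" "E \<in> sets M" for j \<nu> \<nu>' E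
    using that
  proof (induction j arbitrary: \<nu> \<nu>')
    case 0
    have "\<nu> (T -` E) - \<nu>' (T -` E) \<le> \<nu> (T -` E)"
      using reg_nonneg[OF 0(2) vimage_sets[OF 0(4)]] by simp
    also have "\<dots> \<le> K\<^sub>0 * prob E * \<nu> UNIV"
      unfolding K\<^sub>0_def by (rule reg_bounded[OF 0(1) 0(4)])
    finally show ?case by simp
  next
    case (Suc j)
    obtain f where f: "reg 1 (2 * s\<^sub>0) f" "f UNIV = (1 - \<gamma>) * \<nu> UNIV"
      "\<And>E. E \<in> sets M \<Longrightarrow> \<nu> ((T ^^ N) -` E) = f E + \<nu> UNIV * h E"
      using step[OF Suc.prems(1)] by blast
    obtain f' where f': "reg 1 (2 * s\<^sub>0) f'" "f' UNIV = (1 - \<gamma>) * \<nu>' UNIV"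
      "\<And>E. E \<in> sets M \<Longrightarrow> \<nu>' ((T ^^ N) -` E) = f' E + \<nu>' UNIV * h E"
      using step[OF Suc.prems(2)] by blast
    let ?E = "(T ^^ (j * N + 1)) -` E"
    have sets: "?E \<in> sets M" by (rule funpow_vimage_sets[OF Suc.prems(4)])
    have eq: "(T ^^ (Suc j * N + 1)) -` E = (T ^^ N) -` ?E"
      using funpow_add_vimage[of N "j * N + 1" T E] by (simp add: add.assoc)
    have "\<nu> ((T ^^ (Suc j * N + 1)) -` E) - \<nu>' ((T ^^ (Suc j * N + 1)) -` E) = f ?E - f' ?E"
      unfolding eq f(3)[OF sets] f'(3)[OF sets] Suc.prems(3) by simp
    also have "\<dots> \<le> K\<^sub>0 * prob E * ((1 - \<gamma>) ^ j * f UNIV)"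
      by (rule Suc.IH[OF f(1) f'(1)]) (use f(2) f'(2) Suc.prems in simp_all)
    finally show ?case by (simp only: f(2) mult_ac power_Suc)
  qed
  show thesis
  proof (rule that[of q "K\<^sub>0 / (1 - \<gamma>)"])
    show "0 < q" "q < 1" "0 < K\<^sub>0 / (1 - \<gamma>)" using q K0 \<gamma> by simp_all
    fix \<nu> \<nu>' E and n :: nat
    assume *: "reg 1 (2 * s\<^sub>0) \<nu>" "reg 1 (2 * s\<^sub>0) \<nu>'" "\<nu> UNIV = \<nu>' UNIV" "1 \<le> n" "E \<in> sets M"
    \<comment> \<open>One step is reserved for the density bound. The incomplete block of
      \<open>i\<close> steps is moved into the set, whose preimages have the same measure.\<close>
    define j i where "j = (n - 1) div N" and "i = (n - 1) mod N"
    have n: "n = (j * N + 1) + i" using *(4) by (simp add: j_def i_def)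
    have "i < N" using N by (simp add: i_def)
    have sets: "(T ^^ i) -` E \<in> sets M" by (rule funpow_vimage_sets[OF *(5)])
    have "\<nu> ((T ^^ n) -` E) - \<nu>' ((T ^^ n) -` E) \<le> K\<^sub>0 * prob E * ((1 - \<gamma>) ^ j * \<nu> UNIV)"
      using iter[OF *(1-3) sets, of j] prob_funpow_vimage[OF *(5), of i]
      unfolding n funpow_add_vimage[of "j * N + 1" i T E] by simp
    also have "\<dots> \<le> K\<^sub>0 * prob E * (q ^ n / (1 - \<gamma>) * \<nu> UNIV)"
    proof (intro mult_left_mono mult_right_mono)
      have "(1 - \<gamma>) ^ j * (1 - \<gamma>) = q ^ (N * j + N)"
        unfolding q(3)[symmetric] by (simp add: power_mult power_add)
      also have "\<dots> \<le> q ^ n"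
        using q \<open>i < N\<close> n by (intro power_decreasing) (auto simp: mult.commute)
      finally show "(1 - \<gamma>) ^ j \<le> q ^ n / (1 - \<gamma>)" using \<gamma> by (simp add: field_simps)
    qed (use K0 reg_nonneg[OF *(1) UNIV_sets] in auto)
    finally show "\<nu> ((T ^^ n) -` E) - \<nu>' ((T ^^ n) -` E) \<le> K\<^sub>0 / (1 - \<gamma>) * q ^ n * prob E * \<nu> UNIV"
      by (simp add: mult_ac)
  qed
qed

text \<open>The second measure of the coupling is \<open>prob\<close> multiplied by
  \<open>\<nu> UNIV\<close>. First, \<open>m - 1\<close> steps lower the rank to \<open>1\<close>
  and \<open>J\<close> steps lower the constant to \<open>2 * s\<^sub>0\<close>. Times within these
  \<open>J\<close> steps are covered by \<open>reg_bounded\<close>, and the factor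
  \<open>1 / q ^ J\<close> in \<open>K'\<close> pays for the delay. The rate \<open>q\<close> is
  chosen before \<open>s\<close>, so only the constant depends on \<open>s\<close>.\<close>

lemma decorrelation_exists:
  "\<exists>q. 0 < q \<and> q < 1 \<and> (\<forall>s\<ge>0. \<exists>K>0. \<forall>m \<nu> n E. reg m s \<nu> \<longrightarrow> 1 \<le> m \<longrightarrow> m \<le> n \<longrightarrow> E \<in> sets M \<longrightarrow>
      \<bar>\<nu> ((T ^^ n) -` E) - prob E * \<nu> UNIV\<bar> \<le> K * q ^ Suc (n - m) * prob E * \<nu> UNIV)"
proof -
  obtain q K where q: "0 < q" "q < 1" "0 < K" and
    coup: "\<And>\<nu> \<nu>' n E. reg 1 (2 * s\<^sub>0) \<nu> \<Longrightarrow> reg 1 (2 * s\<^sub>0) \<nu>' \<Longrightarrow> \<nu> UNIV = \<nu>' UNIV \<Longrightarrow> 1 \<le> n \<Longrightarrow>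
      E \<in> sets M \<Longrightarrow> \<nu> ((T ^^ n) -` E) - \<nu>' ((T ^^ n) -` E) \<le> K * q ^ n * prob E * \<nu> UNIV"
    by (rule coupling) blast
  have 1: "\<bar>\<nu> ((T ^^ n) -` E) - prob E * \<nu> UNIV\<bar> \<le> K * q ^ n * prob E * \<nu> UNIV"
    if reg: "reg 1 (2 * s\<^sub>0) \<nu>" and n: "1 \<le> n" and E: "E \<in> sets M" for \<nu> n E
  proof -
    have "reg 1 0 (\<lambda>E. \<nu> UNIV * prob E)" 
      by (rule reg_scale[OF reg_prob reg_nonneg[OF reg UNIV_sets]])
    from reg_mono[OF this, of 1 "2 * s\<^sub>0"] have reg': "reg 1 (2 * s\<^sub>0) (\<lambda>E. \<nu> UNIV * prob E)"
      using s0_pos by simp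
    have "\<nu> ((T ^^ n) -` E) - prob E * \<nu> UNIV \<le> K * q ^ n * prob E * \<nu> UNIV"
      using coup[OF reg reg' _ n E] prob_funpow_vimage[OF E] by (simp add: mult.commute)
    moreover have "prob E * \<nu> UNIV - \<nu> ((T ^^ n) -` E) \<le> K * q ^ n * prob E * \<nu> UNIV"
      using coup[OF reg' reg _ n E] prob_funpow_vimage[OF E] by (simp add: mult.commute)
    ultimately show ?thesis by linarith
  qed
  have "\<exists>K'>0. \<forall>m \<nu> n E. reg m s \<nu> \<longrightarrow> 1 \<le> m \<longrightarrow> m \<le> n \<longrightarrow> E \<in> sets M \<longrightarrow>
      \<bar>\<nu> ((T ^^ n) -` E) - prob E * \<nu> UNIV\<bar> \<le> K' * q ^ Suc (n - m) * prob E * \<nu> UNIV" if s: "0 \<le> s" for s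
  proof -
    obtain J where J: "\<kappa> ^ J \<le> s\<^sub>0 / (s + s\<^sub>0)"
      by (rule \<kappa>_power_eventually_le[of "s\<^sub>0 / (s + s\<^sub>0)"]) (use s s0_pos in \<open>auto simp: add_nonneg_pos\<close>)
    have Js: "\<kappa> ^ J * (s + s\<^sub>0) + s\<^sub>0 \<le> 2 * s\<^sub>0"
      using J s s0_pos by (simp add: pos_le_divide_eq add_nonneg_pos)
    define C where "C = exp ((s + s\<^sub>0) * \<kappa> + R) / c\<^sub>0"
    have C: "0 < C" using c0_pos by (simp add: C_def)
    define K' where "K' = (K + C + 1) / q ^ J"
    have K': "0 < K'" using C q by (simp add: K'_def)
    have "\<bar>\<nu> ((T ^^ n) -` E) - prob E * \<nu> UNIV\<bar> \<le> K' * q ^ Suc (n - m) * prob E * \<nu> UNIV"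
      if reg: "reg m s \<nu>" and m: "1 \<le> m" "m \<le> n" and E: "E \<in> sets M" for m \<nu> n E
    proof -
      define f where "f = (\<lambda>E. \<nu> ((T ^^ (m - 1)) -` E))"
      define k where "k = n - m"
      have n: "n = (m - 1) + Suc k" using m by (simp add: k_def)
      have fU: "f UNIV = \<nu> UNIV" by (simp add: f_def)
      have nn: "0 \<le> prob E * \<nu> UNIV" using reg_nonneg[OF reg UNIV_sets] by simp
      have "\<kappa> ^ (m - 1) * s + s\<^sub>0 \<le> 1 * s + s\<^sub>0"
        using s \<kappa>_power_le_1 by (intro add_mono mult_right_mono) auto
      then have f: "reg 1 (s + s\<^sub>0) f"
        using reg_mono[OF reg_push[OF reg m(1), of "m - 1"], of 1 "s + s\<^sub>0"] m by (simp add: f_def)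
      have eq: "\<nu> ((T ^^ n) -` E) = f ((T ^^ Suc k) -` E)"
        unfolding f_def n funpow_add_vimage ..
      have "\<bar>f ((T ^^ Suc k) -` E) - prob E * f UNIV\<bar> \<le> K' * q ^ Suc k * (prob E * f UNIV)"
      proof (cases "Suc k \<le> J")
        case True
        have "f ((T ^^ Suc k) -` E) = f (T -` ((T ^^ k) -` E))"
          using funpow_add_vimage[of 1 k T E] by simp
        also have "\<dots> \<le> C * prob E * f UNIV"
          using reg_bounded[OF f funpow_vimage_sets[OF E], of k] prob_funpow_vimage[OF E, of k]
          unfolding C_def by simp
        finally have "\<bar>f ((T ^^ Suc k) -` E) - prob E * f UNIV\<bar> \<le> (K + C + 1) * (prob E * f UNIV)"
        proof -
          assume a: "f ((T ^^ Suc k) -` E) \<le> C * prob E * f UNIV"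
          have "0 \<le> f ((T ^^ Suc k) -` E)" by (rule reg_nonneg[OF f funpow_vimage_sets[OF E]])
          moreover have "0 \<le> K * (prob E * f UNIV)" "0 \<le> C * (prob E * f UNIV)" "0 \<le> prob E * f UNIV"
            using nn q C fU by auto
          ultimately show ?thesis using a by (simp add: algebra_simps abs_le_iff)
        qed
        also have "\<dots> \<le> K' * q ^ Suc k * (prob E * f UNIV)"
        proof (rule mult_right_mono)
          have "q ^ J \<le> q ^ Suc k" using True q by (intro power_decreasing) auto
          then have "(K + C + 1) * q ^ J \<le> (K + C + 1) * q ^ Suc k"
            using q C by (intro mult_left_mono) auto
          then show "K + C + 1 \<le> K' * q ^ Suc k" using q by (simp add: K'_def field_simps)
        qed (use nn fU in simp)
        finally show ?thesis .
      next
        case False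
        define i where "i = Suc k - J"
        have k: "Suc k = J + i" "1 \<le> i" using False by (auto simp: i_def)
        have g: "reg 1 (2 * s\<^sub>0) (\<lambda>E. f ((T ^^ J) -` E))"
          using reg_mono[OF reg_push[OF f, of J], of 1 "2 * s\<^sub>0"] Js by simp
        have "\<bar>f ((T ^^ Suc k) -` E) - prob E * f UNIV\<bar> \<le> K * q ^ i * (prob E * f UNIV)"
          using 1[OF g k(2) E] unfolding k(1) funpow_add_vimage by (simp add: mult.assoc)
        also have "\<dots> \<le> K' * q ^ Suc k * (prob E * f UNIV)"
        proof (rule mult_right_mono)
          have "K * q ^ i \<le> (K + C + 1) * q ^ i" using q C by (intro mult_right_mono) auto
          also have "\<dots> = K' * q ^ Suc k" using q unfolding k(1) K'_def by (simp add: power_add)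
          finally show "K * q ^ i \<le> K' * q ^ Suc k" .
        qed (use nn fU in simp)
        finally show ?thesis .
      qed
      then show ?thesis unfolding eq fU k_def[symmetric] by (simp add: mult.assoc)
    qed
    then show ?thesis using K' by blast
  qed
  then show ?thesis using q by blast
qed

definition decorrelation_rate :: real  ("q\<^sub>0") where
  "q\<^sub>0 = (SOME q. 0 < q \<and> q < 1 \<and> (\<forall>s\<ge>0. \<exists>K>0. \<forall>m \<nu> n E.
     reg m s \<nu> \<longrightarrow> 1 \<le> m \<longrightarrow> m \<le> n \<longrightarrow> E \<in> sets M \<longrightarrow>
     \<bar>\<nu> ((T ^^ n) -` E) - prob E * \<nu> UNIV\<bar> \<le> K * q ^ Suc (n - m) * prob E * \<nu> UNIV))"

definition decorrelation_const :: "real \<Rightarrow> real"  ("K\<^sub>0") where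
  "K\<^sub>0 s = (SOME K. 0 < K \<and> (\<forall>m \<nu> n E.
     reg m s \<nu> \<longrightarrow> 1 \<le> m \<longrightarrow> m \<le> n \<longrightarrow> E \<in> sets M \<longrightarrow>
     \<bar>\<nu> ((T ^^ n) -` E) - prob E * \<nu> UNIV\<bar> \<le> K * q\<^sub>0 ^ Suc (n - m) * prob E * \<nu> UNIV))"

lemma q0_pos: "0 < q\<^sub>0" and q0_less_1: "q\<^sub>0 < 1"
  unfolding decorrelation_rate_def using someI_ex[OF decorrelation_exists] by blast+

lemma K0_properties:
  assumes "0 \<le> s"
  shows "0 < K\<^sub>0 s \<and> (\<forall>m \<nu> n E.
     reg m s \<nu> \<longrightarrow> 1 \<le> m \<longrightarrow> m \<le> n \<longrightarrow> E \<in> sets M \<longrightarrow>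
     \<bar>\<nu> ((T ^^ n) -` E) - prob E * \<nu> UNIV\<bar> \<le> K\<^sub>0 s * q\<^sub>0 ^ Suc (n - m) * prob E * \<nu> UNIV)"
  unfolding decorrelation_const_def
proof (rule someI_ex)
  show "\<exists>K>0. \<forall>m \<nu> n E. reg m s \<nu> \<longrightarrow> 1 \<le> m \<longrightarrow> m \<le> n \<longrightarrow> E \<in> sets M \<longrightarrow>
     \<bar>\<nu> ((T ^^ n) -` E) - prob E * \<nu> UNIV\<bar> \<le> K * q\<^sub>0 ^ Suc (n - m) * prob E * \<nu> UNIV"
    using someI_ex[OF decorrelation_exists] assms unfolding decorrelation_rate_def[symmetric] by blast
qed

lemma K0_pos: "0 \<le> s \<Longrightarrow> 0 < K\<^sub>0 s"
  using K0_properties by blast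

lemma decorrelation:
  assumes "reg m s \<nu>" "0 \<le> s" "1 \<le> m" "m \<le> n" "E \<in> sets M"
  shows "\<bar>\<nu> ((T ^^ n) -` E) - prob E * \<nu> UNIV\<bar> \<le> K\<^sub>0 s * q\<^sub>0 ^ Suc (n - m) * prob E * \<nu> UNIV"
  using K0_properties[OF assms(2)] assms(1,3-) by blast

lemma decorrelation_le:
  assumes reg: "reg m s \<nu>" and s: "0 \<le> s" and *: "1 \<le> m" "m \<le> n" "E \<in> sets M"
  shows "\<nu> ((T ^^ n) -` E) \<le> (1 + K\<^sub>0 s) * prob E * \<nu> UNIV"
proof -
  have "\<nu> ((T ^^ n) -` E) \<le> prob E * \<nu> UNIV + K\<^sub>0 s * q\<^sub>0 ^ Suc (n - m) * prob E * \<nu> UNIV"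
    using decorrelation[OF reg s *] by linarith
  also have "K\<^sub>0 s * q\<^sub>0 ^ Suc (n - m) * prob E * \<nu> UNIV \<le> K\<^sub>0 s * 1 * prob E * \<nu> UNIV"
  proof (intro mult_right_mono mult_left_mono)
    show "q\<^sub>0 ^ Suc (n - m) \<le> 1" using q0_pos q0_less_1 by (intro power_le_one) auto
  qed (use K0_pos[OF s] reg_nonneg[OF reg UNIV_sets] in auto)
  finally show ?thesis by (simp add: algebra_simps)
qed

text \<open>A cylinder of rank \<open>m\<close> either is \<open>B\<^sub>1\<close> or misses it. In both cases it loses a definite proportion
  of every regular measure.\<close>

lemma cylinder_contraction:
  assumes B1: "B\<^sub>1 \<in> cylinders T \<xi> m" "0 < prob B\<^sub>1" "prob B\<^sub>1 < 1"
  obtains L e where "0 < L" "0 < e" "e < 1"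
    "\<And>k B C. B \<in> cylinders T \<xi> k \<Longrightarrow> C \<in> cylinders T \<xi> L \<Longrightarrow>
      prob (B \<inter> (T ^^ k) -` C) \<le> (1 - e) * prob B"
proof -
  define p where "p = prob B\<^sub>1"
  \<comment> \<open>This choice gives \<open>p + e \<le> 1 - e\<close> and
    \<open>1 - p + e \<le> 1 - e\<close>, one inequality for each of the two cases.\<close>
  define e where "e = min p (1 - p) / 2"
  have e: "0 < e" "2 * e \<le> p" "2 * e \<le> 1 - p" using B1 by (auto simp: e_def p_def)
  then have e1: "e < 1" by simp
  have s0: "0 \<le> s\<^sub>0" using s0_pos by simp
  obtain n where n: "K\<^sub>0 s\<^sub>0 * q\<^sub>0 ^ n \<le> e"
  proof -
    obtain n where "q\<^sub>0 ^ n < e / K\<^sub>0 s\<^sub>0"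
      using real_arch_pow_inv[of "e / K\<^sub>0 s\<^sub>0" q\<^sub>0] e K0_pos[OF s0] q0_less_1 by auto
    then show thesis using K0_pos[OF s0] by (intro that[of n]) (simp add: field_simps)
  qed
  have B1s: "B\<^sub>1 \<in> sets M" using B1 by blast
  have one: "\<nu> ((T ^^ Suc n) -` E) \<le> (1 - e) * \<nu> UNIV"
    if reg: "reg 1 s\<^sub>0 \<nu>" and E: "E \<in> cylinders T \<xi> m" for \<nu> E
  proof -
    have Es: "E \<in> sets M" using E by blast
    have nn: "0 \<le> \<nu> UNIV" by (rule reg_nonneg[OF reg UNIV_sets])
    have "K\<^sub>0 s\<^sub>0 * q\<^sub>0 ^ Suc (Suc n - 1) * p * \<nu> UNIV \<le> e * 1 * \<nu> UNIV"
    proof (intro mult_right_mono mult_mono nn)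
      have "K\<^sub>0 s\<^sub>0 * q\<^sub>0 ^ Suc (Suc n - 1) \<le> K\<^sub>0 s\<^sub>0 * q\<^sub>0 ^ n"
        using K0_pos[OF s0] q0_pos q0_less_1 by (intro mult_left_mono power_decreasing) auto
      then show "K\<^sub>0 s\<^sub>0 * q\<^sub>0 ^ Suc (Suc n - 1) \<le> e" using n by linarith
    qed (use e B1 in \<open>auto simp: p_def\<close>)
    then have close: "\<bar>\<nu> ((T ^^ Suc n) -` B\<^sub>1) - p * \<nu> UNIV\<bar> \<le> e * \<nu> UNIV"
      using decorrelation[OF reg s0 _ _ B1s, of "Suc n"] by (simp add: p_def del: funpow.simps)
    show ?thesis
    proof (cases "E = B\<^sub>1")
      case True
      have "\<nu> ((T ^^ Suc n) -` E) \<le> (p + e) * \<nu> UNIV"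
        using close True by (simp add: algebra_simps del: funpow.simps)
      also have "\<dots> \<le> (1 - e) * \<nu> UNIV" using e by (intro mult_right_mono nn) auto
      finally show ?thesis .
    next
      case False
      then have "E \<inter> B\<^sub>1 = {}" using cylinders_disjoint[OF disjoint_partition E B1(1)] by blast
      then have "(T ^^ Suc n) -` E \<subseteq> UNIV - (T ^^ Suc n) -` B\<^sub>1" by blast
      then have "\<nu> ((T ^^ Suc n) -` E) \<le> \<nu> (UNIV - (T ^^ Suc n) -` B\<^sub>1)"
        by (rule reg_subset[OF reg funpow_vimage_sets[OF Es]
            sets.Diff[OF UNIV_sets funpow_vimage_sets[OF B1s]]])
      also have "\<dots> = \<nu> UNIV - \<nu> ((T ^^ Suc n) -` B\<^sub>1)"
        using acm_split[OF reg_acm[OF reg] UNIV_sets funpow_vimage_sets[OF B1s], of "Suc n"]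
        by (simp del: funpow.simps)
      also have "\<dots> \<le> (1 - p + e) * \<nu> UNIV" using close by (simp add: algebra_simps del: funpow.simps)
      also have "\<dots> \<le> (1 - e) * \<nu> UNIV" using e by (intro mult_right_mono nn) auto
      finally show ?thesis .
    qed
  qed
  show thesis
  proof (rule that[of "Suc n + m" e])
    show "0 < Suc n + m" "0 < e" "e < 1" using e e1 by simp_all
    fix k B C assume B: "B \<in> cylinders T \<xi> k" and "C \<in> cylinders T \<xi> (Suc n + m)"
    then obtain C' E where C': "C' \<in> cylinders T \<xi> (Suc n)" and E: "E \<in> cylinders T \<xi> m"
      and C: "C = C' \<inter> (T ^^ Suc n) -` E" by (meson cylinders_split)
    have sets: "B \<in> sets M" "C' \<in> sets M" "E \<in> sets M" using B C' E by blast+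
    \<comment> \<open>The push-forward under \<open>T ^^ k\<close> of \<open>prob\<close> restricted
      to \<open>B\<close> has constant \<open>s\<^sub>0\<close> whatever \<open>B\<close> and
      \<open>k\<close> are; this makes the contraction uniform.\<close>
    have "1 \<le> max 1 k" by simp
    note reg_push[OF reg_restrict[OF reg_prob B] this, of k]
    moreover have "max 1 (max 1 k - k) = 1" by simp
    ultimately have "reg 1 s\<^sub>0 (\<lambda>E. prob ((T ^^ k) -` E \<inter> B))" by simp
    from one[OF this E]
    have "prob ((T ^^ k) -` ((T ^^ Suc n) -` E) \<inter> B) \<le> (1 - e) * prob B" by simp
    moreover have "prob (B \<inter> (T ^^ k) -` C) \<le> prob ((T ^^ k) -` ((T ^^ Suc n) -` E) \<inter> B)"
    proof (rule finite_measure_mono)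
      show "B \<inter> (T ^^ k) -` C \<subseteq> (T ^^ k) -` ((T ^^ Suc n) -` E) \<inter> B" using C by blast
      show "(T ^^ k) -` ((T ^^ Suc n) -` E) \<inter> B \<in> sets M"
        by (rule sets.Int[OF funpow_vimage_sets[OF funpow_vimage_sets[OF sets(3)]] sets(1)])
    qed
    ultimately show "prob (B \<inter> (T ^^ k) -` C) \<le> (1 - e) * prob B" by linarith
  qed
qed

text \<open>Every further block of \<open>L\<close> letters multiplies the measure by at most
  \<open>1 - e\<close>, so \<open>root L (1 - e)\<close> is a rate per letter.\<close>

lemma cylinder_decay:
  assumes B1: "B\<^sub>1 \<in> cylinders T \<xi> m" "0 < prob B\<^sub>1" "prob B\<^sub>1 < 1"
  obtains C q where "0 < C" "0 < q" "q < 1"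
    "\<And>n B. B \<in> cylinders T \<xi> n \<Longrightarrow> prob B \<le> C * q ^ n"
proof -
  obtain L e where L: "0 < L" "0 < e" "e < 1" and
    contr: "\<And>k B C. B \<in> cylinders T \<xi> k \<Longrightarrow> C \<in> cylinders T \<xi> L \<Longrightarrow>
      prob (B \<inter> (T ^^ k) -` C) \<le> (1 - e) * prob B"
    by (rule cylinder_contraction[OF B1]) blast
  have j: "prob B \<le> (1 - e) ^ j" if "B \<in> cylinders T \<xi> (j * L)" for j B
    using that
  proof (induction j arbitrary: B)
    case (Suc j)
    then have "B \<in> cylinders T \<xi> (j * L + L)" by (simp add: add.commute)
    then obtain B' C where BC: "B' \<in> cylinders T \<xi> (j * L)" "C \<in> cylinders T \<xi> L"
      "B = B' \<inter> (T ^^ (j * L)) -` C" by (meson cylinders_split)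
    have "prob B \<le> (1 - e) * prob B'" unfolding BC(3) by (rule contr[OF BC(1,2)])
    also have "\<dots> \<le> (1 - e) * (1 - e) ^ j" using Suc.IH[OF BC(1)] L by (intro mult_left_mono) auto
    finally show ?case by simp
  qed simp
  show thesis
  proof (rule that[of "1 / (1 - e)" "root L (1 - e)"])
    show "0 < 1 / (1 - e)" "0 < root L (1 - e)" "root L (1 - e) < 1" using L by auto
    fix n B assume "B \<in> cylinders T \<xi> n"
    then obtain B' where B': "B' \<in> cylinders T \<xi> (n div L * L)" "B \<subseteq> B'"
      using cylinders_mono[of B T \<xi> n "n div L * L"] by auto
    then have "B' \<in> sets M" by blast
    then have "prob B \<le> prob B'" using B' by (intro finite_measure_mono)
    also have "\<dots> \<le> (1 - e) ^ (n div L)" by (rule j[OF B'(1)])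
    also have "\<dots> \<le> root L (1 - e) ^ n / (1 - e)" using L by (intro power_div_le_root_power) auto
    finally show "prob B \<le> 1 / (1 - e) * root L (1 - e) ^ n" by simp
  qed
qed

section \<open>Survival and hitting events\<close>

text \<open>Time \<open>0\<close> is not inspected, so \<open>surv A k \<inter> A\<close> consists
  of the points of \<open>A\<close> that do not return up to time \<open>k\<close>.\<close>

definition surv :: "'a set \<Rightarrow> nat \<Rightarrow> 'a set" where
  "surv A k = {y. \<forall>j\<in>{1..k}. (T ^^ j) y \<notin> A}"

definition hit :: "'a set \<Rightarrow> nat \<Rightarrow> 'a set" where
  "hit A k = {y. (T ^^ k) y \<in> A \<and> (\<forall>j\<in>{1..<k}. (T ^^ j) y \<notin> A)}"

text \<open>Fixed powers of \<open>T\<close> replace the iterated entrance map, which suits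
  restriction followed by push-forward. Both descriptions agree for positive waiting times, see
  \<open>hitting_event_eq_hits\<close>.\<close>

primrec hits :: "'a set \<Rightarrow> nat \<Rightarrow> (nat \<Rightarrow> nat) \<Rightarrow> 'a set" where
  "hits A 0 k = UNIV"
| "hits A (Suc d) k = hit A (k 1) \<inter> (T ^^ k 1) -` hits A d (\<lambda>j. k (Suc j))"

lemma surv_add: "surv A (i + k) = surv A i \<inter> (T ^^ i) -` surv A k"
  unfolding surv_def vimage_def ball_atLeastAtMost_add by (auto simp: funpow_comp_apply)

lemma hit_eq_surv: "hit A (Suc k) = surv A k \<inter> (T ^^ Suc k) -` A"
  unfolding hit_def surv_def by (auto simp: atLeastLessThanSuc_atLeastAtMost simp del: funpow.simps)

lemma hit_add:
  assumes "1 \<le> k" shows "hit A (i + k) = surv A i \<inter> (T ^^ i) -` hit A k"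
proof -
  obtain k' where k: "k = Suc k'" using assms by (cases k) auto
  have "hit A (i + k) = surv A (i + k') \<inter> (T ^^ (i + k)) -` A"
    using hit_eq_surv[of A "i + k'"] k by (simp del: funpow.simps)
  then show ?thesis
    unfolding surv_add funpow_add_vimage k hit_eq_surv by auto
qed

lemma surv_eq_INT: "surv A k = (\<Inter>j\<in>{..<k}. (T ^^ Suc j) -` (- A))"
  unfolding surv_def
proof (intro equalityI subsetI)
  fix y assume "y \<in> (\<Inter>j\<in>{..<k}. (T ^^ Suc j) -` (- A))"
  then have "(T ^^ Suc (j - 1)) y \<notin> A" if "j \<in> {1..k}" for j using that by fastforce
  then have "(T ^^ j) y \<notin> A" if "j \<in> {1..k}" for j
    using that by (metis One_nat_def Suc_pred atLeastAtMost_iff less_eq_Suc_le)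
  then show "y \<in> {y. \<forall>j\<in>{1..k}. (T ^^ j) y \<notin> A}" by blast
qed fastforce

lemma surv_sets: "A \<in> sets M \<Longrightarrow> surv A k \<in> sets M"
  using funpow_vimage_sets[OF Compl_sets[of A]] unfolding surv_eq_INT
  by (cases k) (auto intro!: sets.finite_INT simp del: funpow.simps)

lemma hit_sets:
  assumes "A \<in> sets M" shows "hit A k \<in> sets M"
proof (cases k)
  case 0
  then show ?thesis using assms by (simp add: hit_def)
next
  case (Suc j)
  then show ?thesis using surv_sets[OF assms] funpow_vimage_sets[OF assms] unfolding hit_eq_surv Suc by blast
qed

end

section \<open>Local laws of hitting times\<close>

text \<open>\<open>D l\<close> is the part of \<open>W l\<close> that carries all early returns: empty for an aperiodic centre, and
  \<open>W (l + p)\<close> for a centre of period \<open>p\<close>.\<close>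

locale shrinking_cylinders = distortion_control M T \<xi> \<kappa> R
  for M :: "'a::metric_space measure" and T :: "'a \<Rightarrow> 'a" and \<xi> :: "'a set set" and \<kappa> R :: real +
  fixes W D :: "nat \<Rightarrow> 'a set" and p :: nat and \<theta> :: real
  assumes W_cylinder: "W l \<in> cylinders T \<xi> l"
    and W_antimono: "i \<le> l \<Longrightarrow> W l \<subseteq> W i"
    and W_pos: "0 < prob (W l)"
    and W_lim: "(\<lambda>l. prob (W l)) \<longlonglongrightarrow> 0"
    and \<theta>_pos: "0 < \<theta>" and \<theta>_le_1: "\<theta> \<le> 1"
    and p_pos: "1 \<le> p"
    and D_subset: "D l \<subseteq> W l \<inter> (T ^^ p) -` W l"
    and D_cylinder: "D l = {} \<or> D l \<in> cylinders T \<xi> (l + p)"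
    and D_ratio: "(\<lambda>l. prob (D l) / prob (W l)) \<longlonglongrightarrow> 1 - \<theta>"
    and short_returns: "1 \<le> i \<Longrightarrow> \<forall>\<^sub>F l in sequentially. W l \<inter> (T ^^ i) -` W l \<subseteq> D l"
begin

lemma W_sets [simp]: "W l \<in> sets M"
  using W_cylinder by blast

lemma D_sets [simp]: "D l \<in> sets M"
  using D_cylinder[of l] by (metis cylinders_sets sets.empty_sets)

lemma decay:
  obtains C q where "0 < C" "0 < q" "q < 1"
    "\<And>n B. B \<in> cylinders T \<xi> n \<Longrightarrow> prob B \<le> C * q ^ n"
proof -
  have "\<forall>\<^sub>F l in sequentially. prob (W l) < 1"
    using W_lim by (rule order_tendstoD) simp
  then obtain l where "prob (W l) < 1"
    using eventually_happens'[OF sequentially_bot] by blast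
  with that show thesis by (rule_tac cylinder_decay[OF W_cylinder W_pos]) blast+
qed

text \<open>Exponential decay of cylinder measures in their rank beats the linear factor.\<close>

lemma linear_W_lim: "(\<lambda>l. real l * prob (W l)) \<longlonglongrightarrow> 0"
proof -
  obtain C q where q: "0 < C" "0 < q" "q < 1"
    and le: "\<And>n B. B \<in> cylinders T \<xi> n \<Longrightarrow> prob B \<le> C * q ^ n"
    by (rule decay) blast
  have "(\<lambda>l. C * (real l * q ^ l)) \<longlonglongrightarrow> C * 0"
    using q by (intro tendsto_mult_left powser_times_n_limit_0) auto
  then have lim: "(\<lambda>l. C * (real l * q ^ l)) \<longlonglongrightarrow> 0" by simp
  show ?thesis
  proof (rule tendsto_sandwich[OF _ _ tendsto_const lim])
    have "real l * prob (W l) \<le> C * (real l * q ^ l)" for l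
      using mult_left_mono[OF le[OF W_cylinder], of "real l" l] by (simp add: mult_ac)
    then show "\<forall>\<^sub>F l in sequentially. real l * prob (W l) \<le> C * (real l * q ^ l)" by simp
  qed simp
qed

section \<open>Loss of memory across a gap\<close>

definition visit_const :: "real \<Rightarrow> real" where
  "visit_const s = (1 + K\<^sub>0 (s + s\<^sub>0)) * (1 + K\<^sub>0 s)"

lemma visit_const_nonneg: "0 \<le> s \<Longrightarrow> 0 \<le> visit_const s"
  using K0_pos[of s] K0_pos[of "s + s\<^sub>0"] s0_pos by (simp add: visit_const_def)

text \<open>After \<open>i\<close> steps the density is bounded, which pays for the visit.
  Restricted to the cylinder \<open>W l\<close>, the measure is regular from rank \<open>l\<close>
  on, so \<open>l\<close> more steps suffice to forget the visit and to pay for \<open>E\<close>.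
  Each payment is one factor of \<open>visit_const\<close>.\<close>

lemma visit_then_le:
  assumes reg: "reg m s \<nu>" and s: "0 \<le> s" and m: "1 \<le> m" "m \<le> i" "i + l \<le> n" and E: "E \<in> sets M"
    and l: "1 \<le> l"
  shows "\<nu> ((T ^^ i) -` W l \<inter> (T ^^ n) -` E) \<le> visit_const s * prob (W l) * prob E * \<nu> UNIV"
proof -
  define k where "k = n - i"
  have n: "n = i + k" "l \<le> k" using m by (auto simp: k_def)
  have ss: "0 \<le> s + s\<^sub>0" using s s0_pos by simp
  have "\<kappa> ^ i * s + s\<^sub>0 \<le> 1 * s + s\<^sub>0"
    using s \<kappa>_power_le_1 by (intro add_mono mult_right_mono) auto
  then have "reg 1 (s + s\<^sub>0) (\<lambda>E. \<nu> ((T ^^ i) -` E))"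
    using reg_mono[OF reg_push[OF reg m(1), of i], of 1 "s + s\<^sub>0"] m(2) by simp
  from reg_restrict[OF this W_cylinder, of l]
  have 1: "reg l (s + s\<^sub>0) (\<lambda>E. \<nu> ((T ^^ i) -` (E \<inter> W l)))" using l by (simp add: max_def)
  have "(T ^^ i) -` W l \<inter> (T ^^ n) -` E = (T ^^ i) -` ((T ^^ k) -` E \<inter> W l)"
    unfolding n(1) funpow_add_vimage by blast
  then have "\<nu> ((T ^^ i) -` W l \<inter> (T ^^ n) -` E) \<le> (1 + K\<^sub>0 (s + s\<^sub>0)) * prob E * \<nu> ((T ^^ i) -` W l)"
    using decorrelation_le[OF 1 ss l n(2) E] by simp
  also have "\<dots> \<le> (1 + K\<^sub>0 (s + s\<^sub>0)) * prob E * ((1 + K\<^sub>0 s) * prob (W l) * \<nu> UNIV)"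
    using K0_pos[OF ss] by (intro mult_left_mono decorrelation_le[OF reg s m(1,2)]) auto
  finally show ?thesis by (simp add: visit_const_def mult_ac)
qed

text \<open>The second set \<open>Q'\<close> is \<open>Q\<close> relaxed by a further gap of length \<open>l\<close>. It is needed because a visit to \<open>W l\<close>
  at a time close to \<open>l\<close> is not yet forgotten when \<open>Q\<close> begins.\<close>

lemma gap_regular:
  assumes reg: "reg 1 s \<nu>" and s: "0 \<le> s" and l: "1 \<le> l"
    and Q: "Q \<in> sets M" and Q': "Q' \<in> sets M" and sub: "Q \<subseteq> (T ^^ l) -` Q'"
  shows "\<bar>\<nu> (surv (W l) l \<inter> (T ^^ l) -` Q) - prob Q * \<nu> UNIV\<bar>
    \<le> (K\<^sub>0 s * q\<^sub>0 ^ l + real l * prob (W l) * visit_const s) * prob Q' * \<nu> UNIV"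
proof -
  note acm = reg_acm[OF reg]
  let ?N = "(T ^^ l) -` Q" and ?S = "surv (W l) l" and ?V = "\<lambda>i. (T ^^ i) -` W l \<inter> (T ^^ (2 * l)) -` Q'"
  have N: "?N \<in> sets M" by (rule funpow_vimage_sets[OF Q])
  have S: "?S \<in> sets M" by (rule surv_sets[OF W_sets])
  have SN: "?S \<inter> ?N \<in> sets M" by (rule sets.Int[OF S N])
  have V: "?V i \<in> sets M" for i
    by (rule sets.Int[OF funpow_vimage_sets[OF W_sets] funpow_vimage_sets[OF Q']])
  have UV: "(\<Union>i\<in>{1..l}. ?V i) \<in> sets M" by (rule sets.finite_UN) (simp, rule V)
  have nn: "0 \<le> \<nu> UNIV" by (rule reg_nonneg[OF reg UNIV_sets])
  have QQ': "prob Q \<le> prob Q'"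
    using finite_measure_mono[OF sub funpow_vimage_sets[OF Q']] Q' by (simp del: funpow.simps)
  have "?N \<subseteq> (T ^^ l) -` ((T ^^ l) -` Q')" using sub by (rule vimage_mono)
  also have "\<dots> = (T ^^ (2 * l)) -` Q'" unfolding mult_2 funpow_add_vimage ..
  finally have Nsub: "?N \<subseteq> (T ^^ (2 * l)) -` Q'" .
  have cover: "?N \<subseteq> (?S \<inter> ?N) \<union> (\<Union>i\<in>{1..l}. ?V i)"
  proof
    fix y assume y: "y \<in> ?N"
    show "y \<in> (?S \<inter> ?N) \<union> (\<Union>i\<in>{1..l}. ?V i)"
    proof (cases "y \<in> ?S")
      case False
      then obtain i where "i \<in> {1..l}" "(T ^^ i) y \<in> W l" unfolding surv_def by blast
      then show ?thesis using y Nsub by blast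
    qed (use y in blast)
  qed
  have "\<nu> ?N \<le> \<nu> ((?S \<inter> ?N) \<union> (\<Union>i\<in>{1..l}. ?V i))"
    by (rule reg_subset[OF reg N sets.Un[OF SN UV] cover])
  also have "\<dots> \<le> \<nu> (?S \<inter> ?N) + \<nu> (\<Union>i\<in>{1..l}. ?V i)" by (rule acm_subadd[OF acm SN UV])
  also have "\<nu> (\<Union>i\<in>{1..l}. ?V i) \<le> (\<Sum>i\<in>{1..l}. \<nu> (?V i))"
    by (rule acm_UN_le[OF acm]) (simp, rule V)
  also have "(\<Sum>i\<in>{1..l}. \<nu> (?V i)) \<le> (\<Sum>i\<in>{1..l}. visit_const s * prob (W l) * prob Q' * \<nu> UNIV)"
    by (rule sum_mono, rule visit_then_le[OF reg s _ _ _ Q' l]) auto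
  also have "\<dots> = real l * prob (W l) * visit_const s * prob Q' * \<nu> UNIV" by simp
  finally have 1: "\<nu> ?N - real l * prob (W l) * visit_const s * prob Q' * \<nu> UNIV \<le> \<nu> (?S \<inter> ?N)" by simp
  have 2: "\<nu> (?S \<inter> ?N) \<le> \<nu> ?N" by (rule reg_subset[OF reg SN N]) blast
  have "\<bar>\<nu> ?N - prob Q * \<nu> UNIV\<bar> \<le> K\<^sub>0 s * q\<^sub>0 ^ Suc (l - 1) * prob Q * \<nu> UNIV"
    by (rule decorrelation[OF reg s _ l Q]) simp
  also have "\<dots> \<le> K\<^sub>0 s * q\<^sub>0 ^ l * prob Q' * \<nu> UNIV"
    using l nn K0_pos[OF s] q0_pos QQ' by (intro mult_right_mono mult_left_mono) auto
  finally have 3: "\<bar>\<nu> ?N - prob Q * \<nu> UNIV\<bar> \<le> K\<^sub>0 s * q\<^sub>0 ^ l * prob Q' * \<nu> UNIV" .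
  have "0 \<le> real l * prob (W l) * visit_const s * prob Q' * \<nu> UNIV"
    using nn visit_const_nonneg[OF s] by simp
  then have "\<bar>\<nu> (?S \<inter> ?N) - prob Q * \<nu> UNIV\<bar> \<le> K\<^sub>0 s * q\<^sub>0 ^ l * prob Q' * \<nu> UNIV
    + real l * prob (W l) * visit_const s * prob Q' * \<nu> UNIV"
    using 1 2 3 by linarith
  then show ?thesis by (simp add: algebra_simps)
qed

lemma gap_regular_eventually:
  assumes s: "0 \<le> s" and e: "0 < (e::real)"
  shows "\<forall>\<^sub>F l in sequentially. \<forall>\<nu> Q Q'. reg 1 s \<nu> \<longrightarrow> Q \<in> sets M \<longrightarrow> Q' \<in> sets M \<longrightarrow> Q \<subseteq> (T ^^ l) -` Q' \<longrightarrow>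
    \<bar>\<nu> (surv (W l) l \<inter> (T ^^ l) -` Q) - prob Q * \<nu> UNIV\<bar> \<le> e * prob Q' * \<nu> UNIV"
proof -
  have "(\<lambda>l. K\<^sub>0 s * q\<^sub>0 ^ l + real l * prob (W l) * visit_const s) \<longlonglongrightarrow> K\<^sub>0 s * 0 + 0 * visit_const s"
    using q0_pos q0_less_1
    by (intro tendsto_intros LIMSEQ_power_zero linear_W_lim) auto
  then have "\<forall>\<^sub>F l in sequentially. K\<^sub>0 s * q\<^sub>0 ^ l + real l * prob (W l) * visit_const s < e"
    by (rule order_tendstoD) (use e in simp)
  with eventually_ge_at_top[of 1] show ?thesis
  proof eventually_elim
    case (elim l)
    show ?case
    proof (intro allI impI)
      fix \<nu> Q Q' assume *: "reg 1 s \<nu>" "Q \<in> sets M" "Q' \<in> sets M" "Q \<subseteq> (T ^^ l) -` Q'"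
      note gap_regular[OF *(1) s elim(1) *(2-4)]
      also have "(K\<^sub>0 s * q\<^sub>0 ^ l + real l * prob (W l) * visit_const s) * prob Q' * \<nu> UNIV
          \<le> e * prob Q' * \<nu> UNIV"
        using elim(2) reg_nonneg[OF *(1) UNIV_sets] by (intro mult_right_mono) auto
      finally show "\<bar>\<nu> (surv (W l) l \<inter> (T ^^ l) -` Q) - prob Q * \<nu> UNIV\<bar> \<le> e * prob Q' * \<nu> UNIV" .
    qed
  qed
qed

text \<open>Inside the cylinder \<open>W l\<close> of rank \<open>l\<close> the density of
  \<open>\<nu>\<close> varies by at most the factor \<open>exp (s * \<kappa> ^ l)\<close>, so the
  share of \<open>D l\<close> is close to its share under \<open>prob\<close>.\<close>

lemma D_mass_close:
  assumes reg: "reg l s \<nu>" and s: "0 \<le> s" and conc: "\<nu> (W l) = \<nu> UNIV"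
  shows "\<bar>\<nu> (D l) - (1 - \<theta>) * \<nu> UNIV\<bar>
    \<le> (exp (s * \<kappa> ^ l) - 1 + \<bar>prob (D l) / prob (W l) - (1 - \<theta>)\<bar>) * \<nu> UNIV"
proof -
  define X \<rho> where "X = exp (s * \<kappa> ^ l)" and "\<rho> = prob (D l) / prob (W l)"
  have X: "1 \<le> X" using s \<kappa>_pos by (simp add: X_def)
  have nn: "0 \<le> \<nu> UNIV" by (rule reg_nonneg[OF reg UNIV_sets])
  have sub: "D l \<subseteq> W l" using D_subset by blast
  have \<rho>: "0 \<le> \<rho>" "\<rho> \<le> 1"
    using W_pos[of l] finite_measure_mono[OF sub W_sets] by (auto simp: \<rho>_def)
  have "\<nu> (D l) * prob (W l) \<le> X * \<nu> UNIV * prob (D l)"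
    using regD[OF reg order_refl W_cylinder D_sets W_sets sub order_refl] by (simp add: X_def conc)
  then have 1: "\<nu> (D l) \<le> X * (\<rho> * \<nu> UNIV)"
    using W_pos[of l] by (simp add: \<rho>_def field_simps)
  have "\<nu> UNIV * prob (D l) \<le> X * \<nu> (D l) * prob (W l)"
    using regD[OF reg order_refl W_cylinder W_sets D_sets order_refl sub] by (simp add: X_def conc)
  then have 2: "\<rho> * \<nu> UNIV \<le> X * \<nu> (D l)"
    using W_pos[of l] by (simp add: \<rho>_def field_simps)
  have "(X - 1) * (\<rho> * \<nu> UNIV) \<le> (X - 1) * (1 * \<nu> UNIV)"
    using X \<rho> nn by (intro mult_left_mono mult_right_mono) auto
  then have 3: "\<nu> (D l) - \<rho> * \<nu> UNIV \<le> (X - 1) * \<nu> UNIV" using 1 by (simp add: algebra_simps)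
  have "\<nu> (D l) \<le> \<nu> UNIV" by (rule reg_subset[OF reg D_sets UNIV_sets]) simp
  then have "(X - 1) * \<nu> (D l) \<le> (X - 1) * \<nu> UNIV" using X by (intro mult_left_mono) auto
  then have 4: "\<rho> * \<nu> UNIV - \<nu> (D l) \<le> (X - 1) * \<nu> UNIV" using 2 by (simp add: algebra_simps)
  have "\<bar>\<rho> * \<nu> UNIV - (1 - \<theta>) * \<nu> UNIV\<bar> = \<bar>\<rho> - (1 - \<theta>)\<bar> * \<nu> UNIV"
    using nn by (simp add: abs_mult flip: left_diff_distrib)
  then have "\<bar>\<nu> (D l) - (1 - \<theta>) * \<nu> UNIV\<bar> \<le> (X - 1) * \<nu> UNIV + \<bar>\<rho> - (1 - \<theta>)\<bar> * \<nu> UNIV"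
    using 3 4 by linarith
  then show ?thesis unfolding X_def \<rho>_def by (simp add: distrib_right)
qed

lemma concentrated_Int:
  assumes reg: "reg m s \<nu>" and conc: "\<nu> (- W l) = 0" and E: "E \<in> sets M"
  shows "\<nu> (E \<inter> W l) = \<nu> E"
proof -
  have "\<nu> (E - W l) \<le> \<nu> (- W l)"
    by (rule reg_subset[OF reg sets.Diff[OF E W_sets] Compl_sets[OF W_sets]]) blast
  moreover have "0 \<le> \<nu> (E - W l)" by (rule reg_nonneg[OF reg sets.Diff[OF E W_sets]])
  ultimately show ?thesis using acm_split[OF reg_acm[OF reg] E W_sets, of l] conc by linarith
qed

text \<open>A return at time \<open>i \<le> l\<close> forces the last \<open>i\<close> letters of
  \<open>W l\<close> to occur from time \<open>l\<close> on, when \<open>\<nu>\<close> already has a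
  bounded density. This costs the measure of a cylinder \<open>E\<close> of rank \<open>i\<close>,
  hence the factor \<open>q ^ i\<close>. The event lies in the cylinder \<open>B\<close> of rank
  \<open>i + l \<le> 2 * l\<close>, which is forgotten by time \<open>3 * l\<close>.\<close>

lemma overlap_then_le:
  assumes reg: "reg l s \<nu>" and conc: "\<nu> (- W l) = 0" and s: "0 \<le> s" and i: "1 \<le> i" "i \<le> l"
    and Q: "Q \<in> sets M" and decay: "\<And>n B. B \<in> cylinders T \<xi> n \<Longrightarrow> prob B \<le> C * q ^ n"
  shows "\<nu> (W l \<inter> (T ^^ i) -` W l \<inter> (T ^^ (3 * l)) -` Q) \<le> (1 + K\<^sub>0 s)\<^sup>2 * C * q ^ i * prob Q * \<nu> UNIV"
proof -
  have l: "1 \<le> l" using i by simp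
  define B where "B = W i \<inter> (T ^^ i) -` W l"
  have B: "B \<in> cylinders T \<xi> (i + l)" unfolding B_def by (rule cylinders_Int[OF W_cylinder W_cylinder])
  have Bs: "B \<in> sets M" by (rule cylinders_sets[OF B])
  have K: "0 \<le> 1 + K\<^sub>0 s" using K0_pos[OF s] by simp
  have nn: "0 \<le> \<nu> UNIV" by (rule reg_nonneg[OF reg UNIV_sets])
  have Qs: "(T ^^ (3 * l)) -` Q \<in> sets M" by (rule funpow_vimage_sets[OF Q])
  have "max l (i + l) = i + l" by simp
  with reg_restrict[OF reg B] have regB: "reg (i + l) s (\<lambda>E. \<nu> (E \<inter> B))" by simp
  have "\<nu> (W l \<inter> (T ^^ i) -` W l \<inter> (T ^^ (3 * l)) -` Q) \<le> \<nu> ((T ^^ (3 * l)) -` Q \<inter> B)"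
  proof (rule reg_subset[OF reg _ sets.Int[OF Qs Bs]])
    show "W l \<inter> (T ^^ i) -` W l \<inter> (T ^^ (3 * l)) -` Q \<subseteq> (T ^^ (3 * l)) -` Q \<inter> B"
      using W_antimono[OF i(2)] unfolding B_def by blast
    show "W l \<inter> (T ^^ i) -` W l \<inter> (T ^^ (3 * l)) -` Q \<in> sets M"
      by (rule sets.Int[OF sets.Int[OF W_sets funpow_vimage_sets[OF W_sets]] Qs])
  qed
  also have "\<dots> \<le> (1 + K\<^sub>0 s) * prob Q * \<nu> (UNIV \<inter> B)"
    by (rule decorrelation_le[OF regB s _ _ Q]) (use i in auto)
  also have "\<nu> (UNIV \<inter> B) \<le> (1 + K\<^sub>0 s) * (C * q ^ i) * \<nu> UNIV"
  proof -
    have "W l \<in> cylinders T \<xi> ((l - i) + i)" using W_cylinder[of l] i(2) by simp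
    then obtain B' E where E: "E \<in> cylinders T \<xi> i" "W l = B' \<inter> (T ^^ (l - i)) -` E"
      by (meson cylinders_split)
    have Es: "E \<in> sets M" by (rule cylinders_sets[OF E(1)])
    have "(T ^^ i) -` W l \<subseteq> (T ^^ i) -` ((T ^^ (l - i)) -` E)" using E(2) by (intro vimage_mono) blast
    also have "\<dots> = (T ^^ l) -` E" using funpow_add_vimage[of i "l - i" T E] i(2) by simp
    finally have "B \<subseteq> (T ^^ l) -` E" unfolding B_def by blast
    then have "\<nu> (UNIV \<inter> B) \<le> \<nu> ((T ^^ l) -` E)"
      using reg_subset[OF reg Bs funpow_vimage_sets[OF Es]] by simp
    also have "\<dots> \<le> (1 + K\<^sub>0 s) * prob E * \<nu> UNIV" by (rule decorrelation_le[OF reg s l order_refl Es])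
    also have "\<dots> \<le> (1 + K\<^sub>0 s) * (C * q ^ i) * \<nu> UNIV"
      using decay[OF E(1)] K nn by (intro mult_right_mono mult_left_mono) auto
    finally show ?thesis .
  qed
  then have "(1 + K\<^sub>0 s) * prob Q * \<nu> (UNIV \<inter> B)
      \<le> (1 + K\<^sub>0 s) * prob Q * ((1 + K\<^sub>0 s) * (C * q ^ i) * \<nu> UNIV)"
    using K by (intro mult_left_mono) auto
  finally show ?thesis by (simp add: power2_eq_square mult_ac)
qed

text \<open>Returns are sorted by their time: before \<open>i\<^sub>0\<close> they lie in
  \<open>D l\<close>, from \<open>i\<^sub>0\<close> to \<open>l\<close> they are overlaps with a
  geometric tail, and from \<open>l + 1\<close> to \<open>2 * l\<close> they are ordinary visits. As
  \<open>Q'\<close> is tested at time \<open>3 * l\<close>, there are \<open>l\<close> steps left to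
  forget even the latest of them.\<close>

lemma gap_cylinder_cover:
  assumes reg: "reg l s \<nu>" and conc: "\<nu> (- W l) = 0" and s: "0 \<le> s" and l: "1 \<le> l"
    and Q: "Q \<in> sets M" and Q': "Q' \<in> sets M" and sub: "Q \<subseteq> (T ^^ l) -` Q'"
    and decay: "\<And>n B. B \<in> cylinders T \<xi> n \<Longrightarrow> prob B \<le> C * q ^ n" and q: "0 < C" "0 < q" "q < 1"
    and no_return: "\<And>i. 1 \<le> i \<Longrightarrow> i < i\<^sub>0 \<Longrightarrow> W l \<inter> (T ^^ i) -` W l \<subseteq> D l"
    and i0: "1 \<le> i\<^sub>0"
  shows "\<nu> ((T ^^ (2 * l)) -` Q - D l) \<le> \<nu> (surv (W l) (2 * l) \<inter> (T ^^ (2 * l)) -` Q)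
    + ((1 + K\<^sub>0 s)\<^sup>2 * C * (q ^ i\<^sub>0 / (1 - q)) + real l * prob (W l) * visit_const s) * prob Q' * \<nu> UNIV"
proof -
  note acm = reg_acm[OF reg]
  let ?N = "(T ^^ (2 * l)) -` Q" and ?S = "surv (W l) (2 * l)" and ?N' = "(T ^^ (3 * l)) -` Q'"
  let ?O = "\<lambda>i. W l \<inter> (T ^^ i) -` W l \<inter> ?N'" and ?V = "\<lambda>i. (T ^^ i) -` W l \<inter> ?N'"
  have N: "?N \<in> sets M" by (rule funpow_vimage_sets[OF Q])
  have N': "?N' \<in> sets M" by (rule funpow_vimage_sets[OF Q'])
  have S: "?S \<in> sets M" by (rule surv_sets[OF W_sets])
  have SN: "?S \<inter> ?N \<in> sets M" by (rule sets.Int[OF S N])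
  have V: "?V i \<in> sets M" for i by (rule sets.Int[OF funpow_vimage_sets[OF W_sets] N'])
  have Oset: "?O i \<in> sets M" for i
    by (rule sets.Int[OF sets.Int[OF W_sets funpow_vimage_sets[OF W_sets]] N'])
  have UV: "(\<Union>i\<in>{Suc l..2 * l}. ?V i) \<in> sets M" by (rule sets.finite_UN) (simp, rule V)
  have UO: "(\<Union>i\<in>{i\<^sub>0..l}. ?O i) \<in> sets M" by (rule sets.finite_UN) (simp, rule Oset)
  have nn: "0 \<le> \<nu> UNIV" by (rule reg_nonneg[OF reg UNIV_sets])
  have "?N \<subseteq> (T ^^ (2 * l)) -` ((T ^^ l) -` Q')" using sub by (rule vimage_mono)
  also have "\<dots> = ?N'" using funpow_add_vimage[of "2 * l" l T Q'] by simp
  finally have Nsub: "?N \<subseteq> ?N'" .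
  have cover: "(?N - D l) \<inter> W l \<subseteq> (?S \<inter> ?N) \<union> ((\<Union>i\<in>{i\<^sub>0..l}. ?O i) \<union> (\<Union>i\<in>{Suc l..2 * l}. ?V i))"
  proof
    fix y assume y: "y \<in> (?N - D l) \<inter> W l"
    show "y \<in> (?S \<inter> ?N) \<union> ((\<Union>i\<in>{i\<^sub>0..l}. ?O i) \<union> (\<Union>i\<in>{Suc l..2 * l}. ?V i))"
    proof (cases "y \<in> ?S")
      case False
      then obtain i where i: "i \<in> {1..2 * l}" "(T ^^ i) y \<in> W l" unfolding surv_def by blast
      have yN': "y \<in> ?N'" using y Nsub by blast
      consider "i < i\<^sub>0" | "i\<^sub>0 \<le> i" "i \<le> l" | "Suc l \<le> i" by linarith
      then show ?thesis
      proof cases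
        case 1
        then have "y \<in> D l" using no_return[of i] i y by auto
        then show ?thesis using y by blast
      next
        case 2
        then have "i \<in> {i\<^sub>0..l}" by simp
        then show ?thesis using i y yN' by blast
      next
        case 3
        then have "i \<in> {Suc l..2 * l}" using i by simp
        then show ?thesis using i y yN' by blast
      qed
    qed (use y in blast)
  qed
  have "\<nu> (?N - D l) = \<nu> ((?N - D l) \<inter> W l)"
    by (rule concentrated_Int[OF reg conc sets.Diff[OF N D_sets], symmetric])
  also have "\<dots> \<le> \<nu> ((?S \<inter> ?N) \<union> ((\<Union>i\<in>{i\<^sub>0..l}. ?O i) \<union> (\<Union>i\<in>{Suc l..2 * l}. ?V i)))"
    by (rule reg_subset[OF reg sets.Int[OF sets.Diff[OF N D_sets] W_sets] sets.Un[OF SN sets.Un[OF UO UV]] cover])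
  also have "\<dots> \<le> \<nu> (?S \<inter> ?N) + \<nu> ((\<Union>i\<in>{i\<^sub>0..l}. ?O i) \<union> (\<Union>i\<in>{Suc l..2 * l}. ?V i))"
    by (rule acm_subadd[OF acm SN sets.Un[OF UO UV]])
  also have "\<nu> ((\<Union>i\<in>{i\<^sub>0..l}. ?O i) \<union> (\<Union>i\<in>{Suc l..2 * l}. ?V i))
      \<le> \<nu> (\<Union>i\<in>{i\<^sub>0..l}. ?O i) + \<nu> (\<Union>i\<in>{Suc l..2 * l}. ?V i)"
    by (rule acm_subadd[OF acm UO UV])
  also have "\<nu> (\<Union>i\<in>{i\<^sub>0..l}. ?O i) \<le> (1 + K\<^sub>0 s)\<^sup>2 * C * (q ^ i\<^sub>0 / (1 - q)) * prob Q' * \<nu> UNIV"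
  proof -
    have "\<nu> (\<Union>i\<in>{i\<^sub>0..l}. ?O i) \<le> (\<Sum>i\<in>{i\<^sub>0..l}. \<nu> (?O i))"
      by (rule acm_UN_le[OF acm]) (simp, rule Oset)
    also have "\<dots> \<le> (\<Sum>i\<in>{i\<^sub>0..l}. (1 + K\<^sub>0 s)\<^sup>2 * C * q ^ i * prob Q' * \<nu> UNIV)"
      by (rule sum_mono, rule overlap_then_le[OF reg conc s _ _ Q' decay]) (use i0 in auto)
    also have "\<dots> = (1 + K\<^sub>0 s)\<^sup>2 * C * (\<Sum>i\<in>{i\<^sub>0..l}. q ^ i) * prob Q' * \<nu> UNIV"
      by (simp add: sum_distrib_left sum_distrib_right)
    also have "\<dots> \<le> (1 + K\<^sub>0 s)\<^sup>2 * C * (q ^ i\<^sub>0 / (1 - q)) * prob Q' * \<nu> UNIV"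
      using q nn by (intro mult_right_mono mult_left_mono power_sum_le) auto
    finally show ?thesis .
  qed
  also have "\<nu> (\<Union>i\<in>{Suc l..2 * l}. ?V i) \<le> real l * prob (W l) * visit_const s * prob Q' * \<nu> UNIV"
  proof -
    have "\<nu> (\<Union>i\<in>{Suc l..2 * l}. ?V i) \<le> (\<Sum>i\<in>{Suc l..2 * l}. \<nu> (?V i))"
      by (rule acm_UN_le[OF acm]) (simp, rule V)
    also have "\<dots> \<le> (\<Sum>i\<in>{Suc l..2 * l}. visit_const s * prob (W l) * prob Q' * \<nu> UNIV)"
      by (rule sum_mono, rule visit_then_le[OF reg s l _ _ Q' l]) auto
    also have "\<dots> = real l * prob (W l) * visit_const s * prob Q' * \<nu> UNIV" by simp
    finally show ?thesis .
  qed
  finally show ?thesis by (simp add: algebra_simps)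
qed

text \<open>Up to small errors the survivors are everything off \<open>D l\<close>: points of
  \<open>D l\<close> return at time \<open>p\<close>, and other returns are rare by
  \<open>gap_cylinder_cover\<close>. Both \<open>\<nu>\<close> and its restriction to
  \<open>D l\<close> are nearly independent of \<open>Q\<close> at time \<open>2 * l\<close>, which
  leaves the factor \<open>1 - (1 - \<theta>)\<close>. The exponent \<open>l - p\<close> reflects
  the rank \<open>l + p\<close> of \<open>D l\<close>.\<close>

lemma gap_cylinder:
  assumes reg: "reg l s \<nu>" and conc: "\<nu> (- W l) = 0" and s: "0 \<le> s" and l: "p \<le> l"
    and Q: "Q \<in> sets M" and Q': "Q' \<in> sets M" and sub: "Q \<subseteq> (T ^^ l) -` Q'"
    and decay: "\<And>n B. B \<in> cylinders T \<xi> n \<Longrightarrow> prob B \<le> C * q ^ n" and q: "0 < C" "0 < q" "q < 1"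
    and no_return: "\<And>i. 1 \<le> i \<Longrightarrow> i < i\<^sub>0 \<Longrightarrow> W l \<inter> (T ^^ i) -` W l \<subseteq> D l"
    and i0: "1 \<le> i\<^sub>0"
  shows "\<bar>\<nu> (surv (W l) (2 * l) \<inter> (T ^^ (2 * l)) -` Q) - \<theta> * prob Q * \<nu> UNIV\<bar>
    \<le> (2 * K\<^sub>0 s * q\<^sub>0 ^ (l - p) + (exp (s * \<kappa> ^ l) - 1 + \<bar>prob (D l) / prob (W l) - (1 - \<theta>)\<bar>)
       + ((1 + K\<^sub>0 s)\<^sup>2 * C * (q ^ i\<^sub>0 / (1 - q)) + real l * prob (W l) * visit_const s)) * prob Q' * \<nu> UNIV"
proof -
  note acm = reg_acm[OF reg]
  have l1: "1 \<le> l" using l p_pos by simp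
  let ?N = "(T ^^ (2 * l)) -` Q" and ?S = "surv (W l) (2 * l)"
  define e1 where "e1 = K\<^sub>0 s * q\<^sub>0 ^ (l - p)"
  define e2 where "e2 = exp (s * \<kappa> ^ l) - 1 + \<bar>prob (D l) / prob (W l) - (1 - \<theta>)\<bar>"
  define e3 where "e3 = (1 + K\<^sub>0 s)\<^sup>2 * C * (q ^ i\<^sub>0 / (1 - q)) + real l * prob (W l) * visit_const s"
  have N: "?N \<in> sets M" by (rule funpow_vimage_sets[OF Q])
  have S: "?S \<in> sets M" by (rule surv_sets[OF W_sets])
  have SN: "?S \<inter> ?N \<in> sets M" by (rule sets.Int[OF S N])
  have nn: "0 \<le> \<nu> UNIV" by (rule reg_nonneg[OF reg UNIV_sets])
  have e: "0 \<le> e1" "0 \<le> e2" "0 \<le> e3"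
    using K0_pos[OF s] q0_pos s \<kappa>_pos q visit_const_nonneg[OF s]
    by (simp_all add: e1_def e2_def e3_def)
  have QQ': "prob Q \<le> prob Q'"
    using finite_measure_mono[OF sub funpow_vimage_sets[OF Q']] Q' by (simp del: funpow.simps)
  have qle: "q\<^sub>0 ^ n \<le> q\<^sub>0 ^ (l - p)" if "l - p \<le> n" for n
    using that q0_pos q0_less_1 by (intro power_decreasing) auto
  have 1: "\<bar>\<nu> ?N - prob Q * \<nu> UNIV\<bar> \<le> e1 * prob Q' * \<nu> UNIV"
  proof -
    have "\<bar>\<nu> ?N - prob Q * \<nu> UNIV\<bar> \<le> K\<^sub>0 s * q\<^sub>0 ^ Suc (2 * l - l) * prob Q * \<nu> UNIV"
      by (rule decorrelation[OF reg s l1 _ Q]) simp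
    also have "\<dots> \<le> e1 * prob Q' * \<nu> UNIV"
      unfolding e1_def using nn K0_pos[OF s] q0_pos QQ'
      by (intro mult_right_mono mult_mono mult_left_mono qle) auto
    finally show ?thesis .
  qed
  have 2: "\<bar>\<nu> (?N \<inter> D l) - prob Q * \<nu> (D l)\<bar> \<le> e1 * prob Q' * \<nu> UNIV"
    using D_cylinder[of l]
  proof
    assume "D l = {}"
    then show ?thesis using acm_empty[OF acm] e nn by simp
  next
    assume Dc: "D l \<in> cylinders T \<xi> (l + p)"
    have "max l (l + p) = l + p" by simp
    with reg_restrict[OF reg Dc] have regD: "reg (l + p) s (\<lambda>E. \<nu> (E \<inter> D l))" by simp
    have "\<bar>\<nu> (?N \<inter> D l) - prob Q * \<nu> (UNIV \<inter> D l)\<bar>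
        \<le> K\<^sub>0 s * q\<^sub>0 ^ Suc (2 * l - (l + p)) * prob Q * \<nu> (UNIV \<inter> D l)"
      by (rule decorrelation[OF regD s _ _ Q]) (use l l1 in auto)
    also have "\<dots> \<le> e1 * prob Q' * \<nu> UNIV"
      unfolding e1_def
    proof (intro mult_mono qle QQ' reg_subset[OF reg])
      show "l - p \<le> Suc (2 * l - (l + p))" by simp
      show "0 \<le> \<nu> (UNIV \<inter> D l)" using reg_nonneg[OF reg D_sets] by simp
    qed (use K0_pos[OF s] q0_pos in auto)
    finally show ?thesis by simp
  qed
  have 3: "\<bar>\<nu> (D l) - (1 - \<theta>) * \<nu> UNIV\<bar> \<le> e2 * \<nu> UNIV"
    unfolding e2_def
    by (rule D_mass_close[OF reg s]) (use concentrated_Int[OF reg conc UNIV_sets] in simp)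
  have c3: "\<bar>prob Q * \<nu> (D l) - prob Q * ((1 - \<theta>) * \<nu> UNIV)\<bar> \<le> e2 * prob Q' * \<nu> UNIV"
  proof -
    have "\<bar>prob Q * \<nu> (D l) - prob Q * ((1 - \<theta>) * \<nu> UNIV)\<bar>
        = prob Q * \<bar>\<nu> (D l) - (1 - \<theta>) * \<nu> UNIV\<bar>"
      by (simp add: abs_mult flip: right_diff_distrib)
    also have "\<dots> \<le> prob Q' * (e2 * \<nu> UNIV)" by (rule mult_mono[OF QQ' 3]) auto
    finally show ?thesis by (simp add: mult_ac)
  qed
  have 4: "\<nu> (?N - D l) \<le> \<nu> (?S \<inter> ?N) + e3 * prob Q' * \<nu> UNIV"
    unfolding e3_def by (rule gap_cylinder_cover[OF reg conc s l1 Q Q' sub decay q no_return i0])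
  have 5: "\<nu> (?S \<inter> ?N) \<le> \<nu> (?N - D l)"
  proof (rule reg_subset[OF reg SN sets.Diff[OF N D_sets]])
    have "p \<in> {1..2 * l}" using l p_pos by simp
    then have "?S \<inter> D l = {}" using D_subset[of l] unfolding surv_def by blast
    then show "?S \<inter> ?N \<subseteq> ?N - D l" by blast
  qed
  have 6: "\<nu> ?N = \<nu> (?N \<inter> D l) + \<nu> (?N - D l)" by (rule acm_split[OF acm N D_sets])
  have "\<bar>\<nu> (?S \<inter> ?N) - \<theta> * prob Q * \<nu> UNIV\<bar>
      \<le> e1 * prob Q' * \<nu> UNIV + e1 * prob Q' * \<nu> UNIV + e2 * prob Q' * \<nu> UNIV + e3 * prob Q' * \<nu> UNIV"
  proof -
    have "prob Q * ((1 - \<theta>) * \<nu> UNIV) = prob Q * \<nu> UNIV - \<theta> * prob Q * \<nu> UNIV"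
      by (simp add: algebra_simps)
    moreover have "0 \<le> e3 * prob Q' * \<nu> UNIV" using e nn by simp
    ultimately show ?thesis using 1 2 c3 4 5 6 by linarith
  qed
  also have "\<dots> = (2 * e1 + e2 + e3) * prob Q' * \<nu> UNIV" by (simp add: algebra_simps)
  finally show ?thesis unfolding e1_def e2_def e3_def by (simp add: mult.assoc)
qed

lemma gap_cylinder_eventually:
  assumes s: "0 \<le> s" and e: "0 < (e::real)"
  shows "\<forall>\<^sub>F l in sequentially. \<forall>\<nu> Q Q'. reg l s \<nu> \<longrightarrow> \<nu> (- W l) = 0 \<longrightarrow>
    Q \<in> sets M \<longrightarrow> Q' \<in> sets M \<longrightarrow> Q \<subseteq> (T ^^ l) -` Q' \<longrightarrow>
    \<bar>\<nu> (surv (W l) (2 * l) \<inter> (T ^^ (2 * l)) -` Q) - \<theta> * prob Q * \<nu> UNIV\<bar> \<le> e * prob Q' * \<nu> UNIV"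
proof -
  obtain C q where q: "0 < C" "0 < q" "q < 1"
    and decay: "\<And>n B. B \<in> cylinders T \<xi> n \<Longrightarrow> prob B \<le> C * q ^ n"
    by (rule decay) blast
  define G where "G = (1 + K\<^sub>0 s)\<^sup>2 * C / (1 - q)"
  have G: "0 < G" using q K0_pos[OF s] by (simp add: G_def)
  \<comment> \<open>The cut-off \<open>i0\<close> is chosen first, from the geometric tail; only
    then is \<open>l\<close> taken so large that the finitely many earlier returns lie in
    \<open>D l\<close>.\<close>
  have "0 < e / 2 / G" using e G by simp
  then obtain i0 where i0: "q ^ i0 < e / 2 / G" using real_arch_pow_inv q by blast
  have "G * q ^ Suc i0 \<le> G * q ^ i0" using G q by (intro mult_left_mono power_decreasing) auto
  also have "\<dots> < e / 2" using i0 G by (simp add: field_simps)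
  finally have tail: "(1 + K\<^sub>0 s)\<^sup>2 * C * (q ^ Suc i0 / (1 - q)) < e / 2" by (simp add: G_def mult_ac)
  have 1: "(\<lambda>l. q\<^sub>0 ^ (l - p)) \<longlonglongrightarrow> 0"
  proof (rule LIMSEQ_offset[of _ p])
    show "(\<lambda>n. q\<^sub>0 ^ (n + p - p)) \<longlonglongrightarrow> 0" using q0_pos q0_less_1 by (simp add: LIMSEQ_power_zero)
  qed
  have 2: "(\<lambda>l. \<kappa> ^ l) \<longlonglongrightarrow> 0" using \<kappa>_pos \<kappa>_less_1 by (intro LIMSEQ_power_zero) auto
  have "(\<lambda>l. 2 * K\<^sub>0 s * q\<^sub>0 ^ (l - p) + (exp (s * \<kappa> ^ l) - 1 + \<bar>prob (D l) / prob (W l) - (1 - \<theta>)\<bar>)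
       + real l * prob (W l) * visit_const s)
     \<longlonglongrightarrow> 2 * K\<^sub>0 s * 0 + (exp (s * 0) - 1 + \<bar>(1 - \<theta>) - (1 - \<theta>)\<bar>) + 0 * visit_const s"
    by (intro tendsto_intros 1 2 linear_W_lim D_ratio)
  then have "\<forall>\<^sub>F l in sequentially. 2 * K\<^sub>0 s * q\<^sub>0 ^ (l - p)
      + (exp (s * \<kappa> ^ l) - 1 + \<bar>prob (D l) / prob (W l) - (1 - \<theta>)\<bar>)
      + real l * prob (W l) * visit_const s < e / 2"
    by (rule order_tendstoD) (use e in simp)
  moreover have "\<forall>\<^sub>F l in sequentially. \<forall>i\<in>{1..i0}. W l \<inter> (T ^^ i) -` W l \<subseteq> D l"
    by (rule eventually_ball_finite) (use short_returns in auto)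
  ultimately show ?thesis using eventually_ge_at_top[of p]
  proof eventually_elim
    case (elim l)
    show ?case
    proof (intro allI impI)
      fix \<nu> Q Q' assume *: "reg l s \<nu>" "\<nu> (- W l) = 0" "Q \<in> sets M" "Q' \<in> sets M" "Q \<subseteq> (T ^^ l) -` Q'"
      have "W l \<inter> (T ^^ i) -` W l \<subseteq> D l" if "1 \<le> i" "i < Suc i0" for i
      proof -
        have "i \<in> {1..i0}" using that by simp
        then show ?thesis using elim(2) by blast
      qed
      note gap_cylinder[OF *(1,2) s elim(3) *(3-5) decay q this]
      also have "(2 * K\<^sub>0 s * q\<^sub>0 ^ (l - p) + (exp (s * \<kappa> ^ l) - 1 + \<bar>prob (D l) / prob (W l) - (1 - \<theta>)\<bar>)
         + ((1 + K\<^sub>0 s)\<^sup>2 * C * (q ^ Suc i0 / (1 - q)) + real l * prob (W l) * visit_const s)) * prob Q' * \<nu> UNIV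
         \<le> e * prob Q' * \<nu> UNIV"
      proof (intro mult_right_mono)
        show "2 * K\<^sub>0 s * q\<^sub>0 ^ (l - p) + (exp (s * \<kappa> ^ l) - 1 + \<bar>prob (D l) / prob (W l) - (1 - \<theta>)\<bar>)
          + ((1 + K\<^sub>0 s)\<^sup>2 * C * (q ^ Suc i0 / (1 - q)) + real l * prob (W l) * visit_const s) \<le> e"
          using elim(1) tail by linarith
      qed (use reg_nonneg[OF *(1) UNIV_sets] in auto)
      finally show "\<bar>\<nu> (surv (W l) (2 * l) \<inter> (T ^^ (2 * l)) -` Q) - \<theta> * prob Q * \<nu> UNIV\<bar>
        \<le> e * prob Q' * \<nu> UNIV" by simp
    qed
  qed
qed

section \<open>Survival function and local law under the invariant measure\<close>

lemma surv_0 [simp]: "surv A 0 = UNIV"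
  by (simp add: surv_def)

lemma surv_1: "surv A 1 = T -` (- A)"
  by (auto simp: surv_def)

lemma surv_mono: "surv A (k + j) \<subseteq> surv A k"
  unfolding surv_add by blast

lemma prob_surv_Suc:
  assumes "A \<in> sets M"
  shows "prob (surv A (Suc k)) = prob (surv A k) - prob (surv A k \<inter> A)"
proof -
  have "surv A (Suc k) = T -` (surv A k - A)"
    using surv_add[of A 1 k] unfolding surv_1 by auto
  then have "prob (surv A (Suc k)) = prob (surv A k - A)"
    using prob_vimage[OF sets.Diff[OF surv_sets[OF assms] assms]] by simp
  then show ?thesis using acm_split[OF acm_prob surv_sets[OF assms] assms, of k] by simp
qed

lemma prob_hit_Suc:
  assumes A: "A \<in> sets M"
  shows "prob (hit A (Suc k)) = prob (surv A k \<inter> A)"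
proof -
  have "surv A (Suc k) = surv A k \<inter> (T ^^ k) -` (T -` (- A))"
    using surv_add[of A k 1] unfolding surv_1 by simp
  then have S: "surv A (Suc k) = surv A k \<inter> - ((T ^^ Suc k) -` A)" by auto
  have "hit A (Suc k) = surv A k \<inter> (T ^^ Suc k) -` A" by (rule hit_eq_surv)
  moreover have "surv A k - (T ^^ Suc k) -` A = surv A (Suc k)" unfolding S by blast
  ultimately have "prob (surv A k) = prob (hit A (Suc k)) + prob (surv A (Suc k))"
    using acm_split[OF acm_prob surv_sets[OF A] funpow_vimage_sets[OF A], of k "Suc k"] by simp
  then show ?thesis using prob_surv_Suc[OF A, of k] by simp
qed

lemma prob_hit_le:
  assumes "A \<in> sets M" shows "prob (hit A k) \<le> prob A"
proof -
  have "hit A k \<subseteq> (T ^^ k) -` A" by (auto simp: hit_def)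
  then have "prob (hit A k) \<le> prob ((T ^^ k) -` A)"
    by (rule finite_measure_mono[OF _ funpow_vimage_sets[OF assms]])
  then show ?thesis by (simp add: assms)
qed

lemma prob_surv_diff:
  assumes A: "A \<in> sets M"
  shows "prob (surv A (k + j)) \<le> prob (surv A k)"
    and "prob (surv A k) \<le> prob (surv A (k + j)) + real j * prob A"
proof -
  show "prob (surv A (k + j)) \<le> prob (surv A k)"
    by (rule finite_measure_mono[OF surv_mono surv_sets[OF A]])
  show "prob (surv A k) \<le> prob (surv A (k + j)) + real j * prob A"
  proof (induction j)
    case (Suc j)
    have "prob (surv A (k + j) \<inter> A) \<le> prob A" by (rule finite_measure_mono[OF _ A]) blast
    then show ?case using Suc prob_surv_Suc[OF A, of "k + j"] by (simp add: algebra_simps)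
  qed simp
qed

lemma reg_W: "1 \<le> l \<Longrightarrow> reg l 0 (\<lambda>E. prob (E \<inter> W l))"
  using reg_restrict[OF reg_prob W_cylinder, of l] by (simp add: max_def)

text \<open>The gap estimate is applied to \<open>prob\<close> restricted to \<open>W l\<close>,
  with survival for \<open>l + j\<close> steps as \<open>Q\<close> and for \<open>j\<close> steps as
  \<open>Q'\<close>, where \<open>k = 3 * l + j\<close>. Replacing the survival function at
  \<open>l + j\<close> by its value at \<open>k\<close> costs \<open>2 * l\<close> decrements, each
  at most \<open>prob (W l)\<close>.\<close>

lemma return_surv_law:
  assumes e: "0 < (e::real)"
  shows "\<forall>\<^sub>F l in sequentially. \<forall>k\<ge>3 * l.
    \<bar>prob (surv (W l) k \<inter> W l) - \<theta> * prob (W l) * prob (surv (W l) k)\<bar> \<le> e * prob (W l)"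
proof -
  have "(\<lambda>l. 2 * (real l * prob (W l))) \<longlonglongrightarrow> 2 * 0" by (intro tendsto_intros linear_W_lim)
  then have "\<forall>\<^sub>F l in sequentially. 2 * (real l * prob (W l)) < e / 2"
    by (rule order_tendstoD) (use e in simp)
  moreover have "0 < e / 2" using e by simp
  note gap_cylinder_eventually[OF order_refl this]
  ultimately show ?thesis using eventually_ge_at_top[of 1]
  proof eventually_elim
    case (elim l)
    let ?a = "prob (W l)" and ?F = "\<lambda>k. prob (surv (W l) k)"
    show ?case
    proof (intro allI impI)
      fix k assume k: "3 * l \<le> k"
      define j where "j = k - 3 * l"
      have S: "surv (W l) k = surv (W l) (2 * l) \<inter> (T ^^ (2 * l)) -` surv (W l) (l + j)"
        using surv_add[of "W l" "2 * l" "l + j"] k by (simp add: j_def)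
      have "surv (W l) (l + j) \<subseteq> (T ^^ l) -` surv (W l) j" unfolding surv_add by blast
      then have "\<bar>prob (surv (W l) (2 * l) \<inter> (T ^^ (2 * l)) -` surv (W l) (l + j) \<inter> W l)
          - \<theta> * ?F (l + j) * prob (UNIV \<inter> W l)\<bar> \<le> e / 2 * ?F j * prob (UNIV \<inter> W l)"
        using elim(2)[rule_format, OF reg_W[OF elim(3)] _ surv_sets[OF W_sets] surv_sets[OF W_sets]]
        by simp
      then have 1: "\<bar>prob (surv (W l) k \<inter> W l) - \<theta> * ?F (l + j) * ?a\<bar> \<le> e / 2 * ?F j * ?a"
        unfolding S by simp
      have a1: "e / 2 * ?F j * ?a \<le> e / 2 * 1 * ?a" using e by (intro mult_right_mono mult_left_mono) auto
      have a2: "\<bar>\<theta> * ?F (l + j) * ?a - \<theta> * ?a * ?F k\<bar> \<le> 1 * ?a * (e / 2)"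
      proof -
        have "k = (l + j) + 2 * l" using k by (simp add: j_def)
        then have "\<bar>?F (l + j) - ?F k\<bar> \<le> 2 * (real l * ?a)"
          using prob_surv_diff[OF W_sets, of l "l + j" "2 * l"] by simp
        then have "\<bar>?F (l + j) - ?F k\<bar> \<le> e / 2" using elim(1) by simp
        moreover have "\<bar>\<theta> * ?F (l + j) * ?a - \<theta> * ?a * ?F k\<bar> = (\<theta> * ?a) * \<bar>?F (l + j) - ?F k\<bar>"
        proof -
          have "\<theta> * ?F (l + j) * ?a - \<theta> * ?a * ?F k = (\<theta> * ?a) * (?F (l + j) - ?F k)"
            by (simp add: algebra_simps)
          then show ?thesis using \<theta>_pos by (simp add: abs_mult)
        qed
        ultimately show ?thesis using \<theta>_pos \<theta>_le_1
          by (simp only:) (intro mult_mono; simp)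
      qed
      show "\<bar>prob (surv (W l) k \<inter> W l) - \<theta> * ?a * ?F k\<bar> \<le> e * ?a"
      proof -
        have "e / 2 * 1 * ?a + 1 * ?a * (e / 2) = e * ?a" by (simp add: field_simps)
        then show ?thesis using 1 a1 a2 by linarith
      qed
    qed
  qed
qed

text \<open>In \<open>perturbed_geometric\<close> with \<open>n = 3 * l\<close>, the early steps
  cost \<open>3 * l * prob (W l)\<close>, which vanishes, and the late ones at most
  \<open>K * (e' + prob (W l))\<close>. Hence \<open>e' = e / (3 * K)\<close>, which leaves one
  third of \<open>e\<close> for each of the three terms.\<close>

lemma survival_law:
  assumes e: "0 < (e::real)" and K: "0 < (K::real)"
  shows "\<forall>\<^sub>F l in sequentially. \<forall>k. prob (W l) * real k \<le> K \<longrightarrow>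
    \<bar>prob (surv (W l) k) - exp (- \<theta> * prob (W l) * real k)\<bar> \<le> e"
proof -
  define e' where "e' = e / (3 * K)"
  have e': "0 < e'" "K * e' = e / 3" using e K by (simp_all add: e'_def)
  have "(\<lambda>l. 3 * (real l * prob (W l))) \<longlonglongrightarrow> 3 * 0" by (intro tendsto_intros linear_W_lim)
  then have "\<forall>\<^sub>F l in sequentially. 3 * (real l * prob (W l)) < e / 3"
    by (rule order_tendstoD) (use e in simp)
  moreover have "\<forall>\<^sub>F l in sequentially. prob (W l) < e'" using W_lim by (rule order_tendstoD) (rule e')
  ultimately show ?thesis using return_surv_law[OF e'(1)]
  proof eventually_elim
    case (elim l)
    let ?a = "prob (W l)" and ?F = "\<lambda>k. prob (surv (W l) k)"
    have c: "0 \<le> \<theta> * ?a" "\<theta> * ?a \<le> ?a"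
      using \<theta>_pos \<theta>_le_1 by (simp_all add: mult_left_le_one_le)
    have step: "?F (Suc k) - (1 - \<theta> * ?a) * ?F k = - (prob (surv (W l) k \<inter> W l) - \<theta> * ?a * ?F k)" for k
      using prob_surv_Suc[OF W_sets, of l k] by (simp add: algebra_simps)
    show ?case
    proof (intro allI impI)
      fix k assume k: "?a * real k \<le> K"
      have "\<bar>?F k - exp (- (\<theta> * ?a) * real k)\<bar> \<le> real (3 * l) * ?a + real k * (e' * ?a + ?a\<^sup>2)"
      proof (rule perturbed_geometric)
        show "?F 0 = 1" by simp
        show "?a \<le> 1" by simp
        show "\<bar>?F (Suc j) - (1 - \<theta> * ?a) * ?F j\<bar> \<le> e' * ?a" if "3 * l \<le> j" for j
          unfolding step abs_minus_cancel using elim(3) that by blast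
        show "\<bar>?F (Suc j) - (1 - \<theta> * ?a) * ?F j\<bar> \<le> ?a" for j
        proof -
          have "prob (surv (W l) j \<inter> W l) \<le> ?a" by (rule finite_measure_mono) auto
          moreover have "\<theta> * ?a * ?F j \<le> ?a * 1" using c by (intro mult_mono) auto
          moreover have "0 \<le> \<theta> * ?a * ?F j" using c by simp
          moreover have "0 \<le> prob (surv (W l) j \<inter> W l)" by simp
          ultimately show ?thesis unfolding step by linarith
        qed
      qed (use c e' in auto)
      also have "real k * (e' * ?a + ?a\<^sup>2) = (?a * real k) * (e' + ?a)"
        by (simp add: algebra_simps power2_eq_square)
      also have "\<dots> \<le> K * (e' + e')"
        using k elim(2) e' K by (intro mult_mono) auto
      also have "K * (e' + e') = e / 3 + e / 3" using e'(2) by (simp add: distrib_left)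
      finally show "\<bar>?F k - exp (- \<theta> * ?a * real k)\<bar> \<le> e"
        using elim(1) by (simp add: mult.assoc)
    qed
  qed
qed

lemma hit_law:
  assumes e: "0 < (e::real)" and K: "0 < (K::real)"
  shows "\<forall>\<^sub>F l in sequentially. \<forall>k>3 * l. prob (W l) * real k \<le> K \<longrightarrow>
    \<bar>prob (hit (W l) k) - prob (W l) * \<theta> * exp (- \<theta> * prob (W l) * real k)\<bar> \<le> e * prob (W l)"
proof -
  have e3: "0 < e / 3" using e by simp
  have "\<forall>\<^sub>F l in sequentially. prob (W l) < e / 3" using W_lim by (rule order_tendstoD) (rule e3)
  with return_surv_law[OF e3] survival_law[OF e3 K] show ?thesis
  proof eventually_elim
    case (elim l)
    let ?a = "prob (W l)" and ?F = "\<lambda>k. prob (surv (W l) k)"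
    show ?case
    proof (intro allI impI)
      fix k assume k: "3 * l < k" "?a * real k \<le> K"
      define j where "j = k - 1"
      have j: "k = Suc j" "3 * l \<le> j" using k by (auto simp: j_def)
      have "?a * real j \<le> ?a * real k" using j by (intro mult_left_mono) auto
      then have "?a * real j \<le> K" using k by linarith
      then have 1: "\<bar>?F j - exp (- \<theta> * ?a * real j)\<bar> \<le> e / 3" using elim(2) by blast
      have 2: "\<bar>prob (hit (W l) k) - \<theta> * ?a * ?F j\<bar> \<le> e / 3 * ?a"
        using elim(1) j prob_hit_Suc[OF W_sets, of l j] by simp
      have "\<bar>exp (- (\<theta> * ?a * real j)) - exp (- (\<theta> * ?a * real k))\<bar> \<le> \<theta> * ?a * real k - \<theta> * ?a * real j"
        using \<theta>_pos j by (intro exp_minus_lipschitz mult_left_mono mult_nonneg_nonneg) auto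
      also have "\<dots> = \<theta> * ?a" by (simp add: j algebra_simps)
      also have "\<dots> \<le> ?a" using \<theta>_pos \<theta>_le_1 by (simp add: mult_left_le_one_le)
      finally have "\<bar>?F j - exp (- \<theta> * ?a * real k)\<bar> \<le> e / 3 + e / 3"
        using 1 elim(3) unfolding mult_minus_left by (simp only: mult.assoc)
      then have "(\<theta> * ?a) * \<bar>?F j - exp (- \<theta> * ?a * real k)\<bar> \<le> (1 * ?a) * (e / 3 + e / 3)"
        using \<theta>_pos \<theta>_le_1 by (intro mult_mono) auto
      moreover have "(\<theta> * ?a) * \<bar>?F j - exp (- \<theta> * ?a * real k)\<bar>
          = \<bar>\<theta> * ?a * ?F j - ?a * \<theta> * exp (- \<theta> * ?a * real k)\<bar>"
      proof -
        have "\<theta> * ?a * ?F j - ?a * \<theta> * exp (- \<theta> * ?a * real k)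
          = (\<theta> * ?a) * (?F j - exp (- \<theta> * ?a * real k))" by (simp add: right_diff_distrib mult_ac)
        then show ?thesis using \<theta>_pos by (simp add: abs_mult)
      qed
      moreover have "(1 * ?a) * (e / 3 + e / 3) + e / 3 * ?a = e * ?a" by (simp add: algebra_simps)
      ultimately show "\<bar>prob (hit (W l) k) - ?a * \<theta> * exp (- \<theta> * ?a * real k)\<bar> \<le> e * ?a"
        using 2 by linarith
    qed
  qed
qed

text \<open>Shortening the waiting time by a gap changes the exponent by at most
  \<open>2 * l * prob (W l)\<close>. The bound \<open>5 * l\<close> leaves more than the
  \<open>3 * l\<close> steps that \<open>hit_law\<close> needs.\<close>

lemma hit_law_shifted:
  assumes e: "0 < (e::real)" and K: "0 < (K::real)"
  shows "\<forall>\<^sub>F l in sequentially. \<forall>k>5 * l. \<forall>j\<le>2 * l. prob (W l) * real k \<le> K \<longrightarrow>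
    \<bar>prob (hit (W l) (k - j)) - prob (W l) * \<theta> * exp (- \<theta> * prob (W l) * real k)\<bar> \<le> e * prob (W l)"
proof -
  have e2: "0 < e / 2" using e by simp
  have "(\<lambda>l. 2 * (real l * prob (W l))) \<longlonglongrightarrow> 2 * 0" by (intro tendsto_intros linear_W_lim)
  then have "\<forall>\<^sub>F l in sequentially. 2 * (real l * prob (W l)) < e / 2"
    by (rule order_tendstoD) (use e in simp)
  with hit_law[OF e2 K] show ?thesis
  proof eventually_elim
    case (elim l)
    let ?a = "prob (W l)"
    show ?case
    proof (intro allI impI)
      fix k j assume k: "5 * l < k" "j \<le> 2 * l" "?a * real k \<le> K"
      let ?x = "exp (- \<theta> * ?a * real k)" and ?y = "exp (- \<theta> * ?a * real (k - j))"
      have "?a * real (k - j) \<le> ?a * real k" by (intro mult_left_mono) auto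
      then have 1: "\<bar>prob (hit (W l) (k - j)) - ?a * \<theta> * ?y\<bar> \<le> e / 2 * ?a"
        using elim(1)[rule_format, of "k - j"] k by linarith
      have "\<bar>exp (- (\<theta> * ?a * real (k - j))) - exp (- (\<theta> * ?a * real k))\<bar>
          \<le> \<theta> * ?a * real k - \<theta> * ?a * real (k - j)"
        using \<theta>_pos by (intro exp_minus_lipschitz mult_left_mono mult_nonneg_nonneg) auto
      also have "\<dots> = \<theta> * ?a * real j" using k by (simp add: of_nat_diff algebra_simps)
      also have "\<dots> \<le> 1 * ?a * real (2 * l)"
        using k(2) \<theta>_pos \<theta>_le_1 by (intro mult_mono) (auto simp del: of_nat_mult)
      finally have "\<bar>?y - ?x\<bar> \<le> e / 2" using elim(2) by (simp add: mult_ac)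
      then have "(?a * \<theta>) * \<bar>?y - ?x\<bar> \<le> (?a * 1) * (e / 2)"
        using \<theta>_pos \<theta>_le_1 by (intro mult_mono) auto
      moreover have "(?a * \<theta>) * \<bar>?y - ?x\<bar> = \<bar>?a * \<theta> * ?y - ?a * \<theta> * ?x\<bar>"
      proof -
        have "?a * \<theta> * ?y - ?a * \<theta> * ?x = (?a * \<theta>) * (?y - ?x)" by (simp add: right_diff_distrib)
        then show ?thesis using \<theta>_pos by (simp add: abs_mult)
      qed
      moreover have "(?a * 1) * (e / 2) + e / 2 * ?a = e * ?a" by (simp add: algebra_simps)
      ultimately show "\<bar>prob (hit (W l) (k - j)) - ?a * \<theta> * ?x\<bar> \<le> e * ?a" using 1 by linarith
    qed
  qed
qed

section \<open>Local law from regular starting measures\<close>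

lemma hit_decompose:
  assumes "1 \<le> j" "j < k"
  shows "hit A k = surv A j \<inter> (T ^^ j) -` hit A (k - j)"
  using hit_add[of "k - j" A j] assms by simp

lemma hit_subset_vimage:
  assumes "1 \<le> j" "j < k" shows "hit A k \<subseteq> (T ^^ j) -` hit A (k - j)"
  using hit_decompose[OF assms] by blast

text \<open>The common argument for both kinds of start: \<open>m = 1\<close>, \<open>c = 1\<close>
  for regular measures and \<open>m = 2\<close>, \<open>c = \<theta>\<close> for those on
  \<open>W l\<close>. The sets \<open>Q\<close> and \<open>Q'\<close> are first hits at
  \<open>k - m * l\<close> and \<open>k - m * l - l\<close>; stationarity bounds the measure of
  \<open>Q'\<close> by \<open>prob (W l)\<close>, the order of the main term.\<close>

lemma hit_law_from_gap:
  assumes c: "0 \<le> c" "c \<le> 1" and m: "1 \<le> m" "m \<le> 2" and e: "0 < (e::real)" and K: "0 < (K::real)"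
    and reg: "\<And>l \<nu>. 1 \<le> l \<Longrightarrow> P l \<nu> \<Longrightarrow> reg l s \<nu>"
    and gap: "\<And>e::real. 0 < e \<Longrightarrow> \<forall>\<^sub>F l in sequentially. \<forall>\<nu> Q Q'. P l \<nu> \<longrightarrow>
      Q \<in> sets M \<longrightarrow> Q' \<in> sets M \<longrightarrow> Q \<subseteq> (T ^^ l) -` Q' \<longrightarrow>
      \<bar>\<nu> (surv (W l) (m * l) \<inter> (T ^^ (m * l)) -` Q) - c * prob Q * \<nu> UNIV\<bar> \<le> e * prob Q' * \<nu> UNIV"
  shows "\<forall>\<^sub>F l in sequentially. \<forall>\<nu>. P l \<nu> \<longrightarrow> (\<forall>k>5 * l. prob (W l) * real k \<le> K \<longrightarrow>
    \<bar>\<nu> (hit (W l) k) - prob (W l) * (c * \<theta>) * exp (- \<theta> * prob (W l) * real k) * \<nu> UNIV\<bar>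
      \<le> e * prob (W l) * \<nu> UNIV)"
proof -
  have e2: "0 < e / 2" using e by simp
  show ?thesis
    using gap[OF e2] hit_law_shifted[OF e2 K] eventually_ge_at_top[of 1]
  proof eventually_elim
    case (elim l)
    let ?a = "prob (W l)"
    show ?case
    proof (intro allI impI)
      fix \<nu> k assume P: "P l \<nu>" and k: "5 * l < k" "?a * real k \<le> K"
      let ?L = "?a * \<theta> * exp (- \<theta> * ?a * real k)"
      have nn: "0 \<le> \<nu> UNIV" by (rule reg_nonneg[OF reg[OF elim(3) P] UNIV_sets])
      have ml: "1 \<le> m * l" "m * l \<le> 2 * l" using m elim(3) by simp_all
      have "m * l < k" "l < k - m * l" using k(1) elim(3) ml by linarith+
      then have H: "hit (W l) k = surv (W l) (m * l) \<inter> (T ^^ (m * l)) -` hit (W l) (k - m * l)"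
        and sub: "hit (W l) (k - m * l) \<subseteq> (T ^^ l) -` hit (W l) (k - m * l - l)"
        using hit_decompose[OF ml(1)] hit_subset_vimage[OF elim(3)] by blast+
      have "\<bar>\<nu> (hit (W l) k) - c * prob (hit (W l) (k - m * l)) * \<nu> UNIV\<bar>
          \<le> e / 2 * prob (hit (W l) (k - m * l - l)) * \<nu> UNIV"
        unfolding H by (rule elim(1)[rule_format, OF P hit_sets[OF W_sets] hit_sets[OF W_sets] sub])
      also have "\<dots> \<le> e / 2 * ?a * \<nu> UNIV"
        using e nn prob_hit_le[OF W_sets] by (intro mult_right_mono mult_left_mono) auto
      finally have 1: "\<bar>\<nu> (hit (W l) k) - c * prob (hit (W l) (k - m * l)) * \<nu> UNIV\<bar>
          \<le> e / 2 * ?a * \<nu> UNIV" .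
      have "\<bar>prob (hit (W l) (k - m * l)) - ?L\<bar> \<le> e / 2 * ?a"
        using elim(2)[rule_format, OF k(1) ml(2) k(2)] .
      then have "(c * \<nu> UNIV) * \<bar>prob (hit (W l) (k - m * l)) - ?L\<bar> \<le> (1 * \<nu> UNIV) * (e / 2 * ?a)"
        using nn c by (intro mult_mono mult_right_mono) auto
      moreover have "(c * \<nu> UNIV) * \<bar>prob (hit (W l) (k - m * l)) - ?L\<bar>
          = \<bar>c * prob (hit (W l) (k - m * l)) * \<nu> UNIV - c * ?L * \<nu> UNIV\<bar>"
      proof -
        have "c * prob (hit (W l) (k - m * l)) * \<nu> UNIV - c * ?L * \<nu> UNIV
            = (c * \<nu> UNIV) * (prob (hit (W l) (k - m * l)) - ?L)"
          by (simp add: right_diff_distrib mult_ac)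
        then show ?thesis using nn c by (simp add: abs_mult)
      qed
      moreover have "(1 * \<nu> UNIV) * (e / 2 * ?a) + e / 2 * ?a * \<nu> UNIV = e * ?a * \<nu> UNIV" by simp
      moreover have "c * ?L * \<nu> UNIV = ?a * (c * \<theta>) * exp (- \<theta> * ?a * real k) * \<nu> UNIV" by simp
      ultimately show "\<bar>\<nu> (hit (W l) k) - ?a * (c * \<theta>) * exp (- \<theta> * ?a * real k) * \<nu> UNIV\<bar>
          \<le> e * ?a * \<nu> UNIV" using 1 by linarith
    qed
  qed
qed

lemma hit_law_regular:
  assumes s: "0 \<le> s" and e: "0 < (e::real)" and K: "0 < (K::real)"
  shows "\<forall>\<^sub>F l in sequentially. \<forall>\<nu>. reg 1 s \<nu> \<longrightarrow> (\<forall>k>5 * l. prob (W l) * real k \<le> K \<longrightarrow>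
    \<bar>\<nu> (hit (W l) k) - prob (W l) * \<theta> * exp (- \<theta> * prob (W l) * real k) * \<nu> UNIV\<bar>
      \<le> e * prob (W l) * \<nu> UNIV)"
proof -
  have "reg l s \<nu>" if "1 \<le> l" "reg 1 s \<nu>" for l \<nu> using reg_mono[OF that(2,1) order_refl] .
  from hit_law_from_gap[OF _ _ _ _ e K this, of 1 1] gap_regular_eventually[OF s]
  show ?thesis by simp
qed

lemma hit_law_cylinder:
  assumes s: "0 \<le> s" and e: "0 < (e::real)" and K: "0 < (K::real)"
  shows "\<forall>\<^sub>F l in sequentially. \<forall>\<nu>. reg l s \<nu> \<and> \<nu> (- W l) = 0 \<longrightarrow> (\<forall>k>5 * l. prob (W l) * real k \<le> K \<longrightarrow>
    \<bar>\<nu> (hit (W l) k) - prob (W l) * \<theta>\<^sup>2 * exp (- \<theta> * prob (W l) * real k) * \<nu> UNIV\<bar>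
      \<le> e * prob (W l) * \<nu> UNIV)"
  unfolding power2_eq_square[of \<theta>]
proof (rule hit_law_from_gap[OF _ \<theta>_le_1 _ _ e K])
  fix e :: real assume e: "0 < e"
  show "\<forall>\<^sub>F l in sequentially. \<forall>\<nu> Q Q'. reg l s \<nu> \<and> \<nu> (- W l) = 0 \<longrightarrow>
      Q \<in> sets M \<longrightarrow> Q' \<in> sets M \<longrightarrow> Q \<subseteq> (T ^^ l) -` Q' \<longrightarrow>
      \<bar>\<nu> (surv (W l) (2 * l) \<inter> (T ^^ (2 * l)) -` Q) - \<theta> * prob Q * \<nu> UNIV\<bar> \<le> e * prob Q' * \<nu> UNIV"
    using gap_cylinder_eventually[OF s e] by (rule eventually_mono) blast
qed (use \<theta>_pos in auto)

section \<open>Successive waiting times\<close>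

text \<open>Each step pushes forward and then removes the cylinder \<open>W l\<close>, which does no
  harm at ranks \<open>l\<close> and above. So the constant stays bounded no matter how long the
  orbit avoids \<open>W l\<close>.\<close>

lemma reg_surv:
  assumes reg: "reg l s \<nu>" and s: "0 \<le> s" and l: "1 \<le> l"
  shows "reg l (\<kappa> ^ j * s + s\<^sub>0) (\<lambda>E. \<nu> (surv (W l) j \<inter> (T ^^ j) -` E))"
proof (induction j)
  case 0
  show ?case using reg_mono[OF reg order_refl, of "s + s\<^sub>0"] s0_pos by simp
next
  case (Suc j)
  have "\<kappa> * (\<kappa> ^ j * s + s\<^sub>0) + R = \<kappa> ^ Suc j * s + s\<^sub>0"
    using s0_fixed by (simp add: algebra_simps)
  then have "reg l (\<kappa> ^ Suc j * s + s\<^sub>0) (\<lambda>E. \<nu> (surv (W l) j \<inter> (T ^^ j) -` (T -` E)))"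
    using reg_mono[OF reg_push1[OF Suc], of l "\<kappa> ^ Suc j * s + s\<^sub>0"] l by simp
  from reg_restrict_Compl[OF this W_cylinder, of l]
  have "reg l (\<kappa> ^ Suc j * s + s\<^sub>0) (\<lambda>E. \<nu> (surv (W l) j \<inter> (T ^^ j) -` (T -` (E \<inter> - W l))))"
    by simp
  moreover have "surv (W l) j \<inter> (T ^^ j) -` (T -` (E \<inter> - W l)) = surv (W l) (Suc j) \<inter> (T ^^ Suc j) -` E" for E
    using surv_add[of "W l" j 1] unfolding surv_1 by auto
  ultimately show ?case by (simp only:)
qed

lemma reg_hit:
  assumes reg: "reg l s \<nu>" and s: "0 \<le> s" and l: "1 \<le> l" and k: "1 \<le> k"
  shows "reg l (s + s\<^sub>0) (\<lambda>E. \<nu> (hit (W l) k \<inter> (T ^^ k) -` E))"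
proof -
  obtain j where j: "k = Suc j" using k by (cases k) auto
  have "\<kappa> * (\<kappa> ^ j * s + s\<^sub>0) + R = \<kappa> ^ Suc j * s + s\<^sub>0"
    using s0_fixed by (simp add: algebra_simps)
  also have "\<dots> \<le> s + s\<^sub>0"
    using mult_right_mono[OF \<kappa>_power_le_1 s, of "Suc j"] by linarith
  finally have "reg l (s + s\<^sub>0) (\<lambda>E. \<nu> (surv (W l) j \<inter> (T ^^ j) -` (T -` E)))"
    using reg_mono[OF reg_push1[OF reg_surv[OF reg s l, of j]], of l "s + s\<^sub>0"] l by simp
  from reg_restrict[OF this W_cylinder, of l]
  have "reg l (s + s\<^sub>0) (\<lambda>E. \<nu> (surv (W l) j \<inter> (T ^^ j) -` (T -` (E \<inter> W l))))" by simp
  moreover have "surv (W l) j \<inter> (T ^^ j) -` (T -` (E \<inter> W l)) = hit (W l) k \<inter> (T ^^ k) -` E" for E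
    unfolding j hit_eq_surv by auto
  ultimately show ?thesis by (simp only:)
qed

text \<open>Restricting to the first hit and pushing forward gives a measure \<open>f\<close> on
  \<open>W l\<close> of mass \<open>\<nu> (hit (W l) (k 1))\<close> and constant
  \<open>s + s\<^sub>0\<close>, whatever \<open>k 1\<close> is, so \<open>rest\<close> applies to
  it. The kind of start enters through \<open>P\<close> and \<open>c\<close>, which is
  \<open>\<theta>\<close> for regular starts and \<open>\<theta>\<^sup>2\<close> for starts on
  \<open>W l\<close>.\<close>

lemma hits_law_Suc:
  assumes s: "0 \<le> s" and c: "0 \<le> c" "c \<le> 1" and e: "0 < (e::real)"
    and reg: "\<And>l \<nu>. 1 \<le> l \<Longrightarrow> P l \<nu> \<Longrightarrow> reg l s \<nu>"
    and first: "\<And>e::real. 0 < e \<Longrightarrow> \<forall>\<^sub>F l in sequentially. \<forall>\<nu>. P l \<nu> \<longrightarrow>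
      (\<forall>k>5 * l. prob (W l) * real k \<le> K \<longrightarrow>
      \<bar>\<nu> (hit (W l) k) - prob (W l) * c * exp (- \<theta> * prob (W l) * real k) * \<nu> UNIV\<bar>
        \<le> e * prob (W l) * \<nu> UNIV)"
    and rest: "\<And>e::real. 0 < e \<Longrightarrow> \<forall>\<^sub>F l in sequentially. \<forall>\<nu> k. reg l (s + s\<^sub>0) \<nu> \<and> \<nu> (- W l) = 0 \<longrightarrow>
      (\<forall>j\<in>{1..d}. 5 * l < k j \<and> prob (W l) * real (k j) \<le> K) \<longrightarrow>
      \<bar>\<nu> (hits (W l) d k) - (prob (W l) * \<theta>\<^sup>2) ^ d
          * exp (- \<theta> * prob (W l) * (\<Sum>j=1..d. real (k j))) * \<nu> UNIV\<bar> \<le> e * prob (W l) ^ d * \<nu> UNIV"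
  shows "\<forall>\<^sub>F l in sequentially. \<forall>\<nu> k. P l \<nu> \<longrightarrow>
    (\<forall>j\<in>{1..Suc d}. 5 * l < k j \<and> prob (W l) * real (k j) \<le> K) \<longrightarrow>
    \<bar>\<nu> (hits (W l) (Suc d) k) - prob (W l) * c * (prob (W l) * \<theta>\<^sup>2) ^ d
        * exp (- \<theta> * prob (W l) * (\<Sum>j=1..Suc d. real (k j))) * \<nu> UNIV\<bar>
      \<le> e * prob (W l) ^ Suc d * \<nu> UNIV"
proof -
  define e' where "e' = min 1 (e / 3)"
  have e': "0 < e'" "e' \<le> 1" "3 * e' \<le> e" using e by (auto simp: e'_def)
  show ?thesis
    using rest[OF e'(1)] first[OF e'(1)] eventually_ge_at_top[of 1]
  proof eventually_elim
    case (elim l)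
    let ?a = "prob (W l)"
    show ?case
    proof (intro allI impI)
      fix \<nu> k assume P: "P l \<nu>"
        and k: "\<forall>j\<in>{1..Suc d}. 5 * l < k j \<and> ?a * real (k j) \<le> K"
      note reg = reg[OF elim(3) P]
      define f where "f = (\<lambda>E. \<nu> (hit (W l) (k 1) \<inter> (T ^^ k 1) -` E))"
      have k1: "5 * l < k 1" "?a * real (k 1) \<le> K" using k by auto
      have f: "reg l (s + s\<^sub>0) f" unfolding f_def
        by (rule reg_hit[OF reg s elim(3)]) (use k1 in simp)
      have "hit (W l) (k 1) \<inter> (T ^^ k 1) -` (- W l) = {}" by (auto simp: hit_def)
      then have fc: "f (- W l) = 0" using acm_empty[OF reg_acm[OF reg]] by (simp add: f_def)
      have fU: "f UNIV = \<nu> (hit (W l) (k 1))" by (simp add: f_def)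
      have ks: "\<forall>j\<in>{1..d}. 5 * l < k (Suc j) \<and> ?a * real (k (Suc j)) \<le> K" using k by auto
      have X: "exp (- \<theta> * ?a * (\<Sum>j=1..Suc d. real (k j)))
          = exp (- \<theta> * ?a * real (k 1)) * exp (- \<theta> * ?a * (\<Sum>j=1..d. real (k (Suc j))))"
        unfolding sum_from_1_Suc by (simp only: distrib_left exp_add)
      have "\<bar>f (hits (W l) d (\<lambda>j. k (Suc j))) - (?a * c * (?a * \<theta>\<^sup>2) ^ d)
          * (exp (- \<theta> * ?a * real (k 1)) * exp (- \<theta> * ?a * (\<Sum>j=1..d. real (k (Suc j))))) * \<nu> UNIV\<bar>
          \<le> 3 * e' * (?a * ?a ^ d) * \<nu> UNIV"
      proof (rule hits_step)
        show "\<bar>\<nu> (hit (W l) (k 1)) - ?a * c * exp (- \<theta> * ?a * real (k 1)) * \<nu> UNIV\<bar> \<le> e' * ?a * \<nu> UNIV"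
          using elim(2) P k1 by blast
        show "\<bar>f (hits (W l) d (\<lambda>j. k (Suc j))) - (?a * \<theta>\<^sup>2) ^ d
          * exp (- \<theta> * ?a * (\<Sum>j=1..d. real (k (Suc j)))) * \<nu> (hit (W l) (k 1))\<bar>
          \<le> e' * ?a ^ d * \<nu> (hit (W l) (k 1))"
          using elim(1)[THEN spec, THEN spec, of f "\<lambda>j. k (Suc j)"] f fc ks unfolding fU by blast
        show "(?a * \<theta>\<^sup>2) ^ d \<le> ?a ^ d"
          using \<theta>_pos \<theta>_le_1 by (intro power_mono mult_left_le) (auto simp: power_le_one)
        show "exp (- \<theta> * ?a * real (k 1)) \<le> 1" using \<theta>_pos by simp
        show "exp (- \<theta> * ?a * (\<Sum>j=1..d. real (k (Suc j)))) \<le> 1" using \<theta>_pos by (simp add: sum_nonneg)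
      qed (use c e' reg_nonneg[OF reg UNIV_sets] in auto)
      also have "3 * e' * (?a * ?a ^ d) * \<nu> UNIV \<le> e * (?a * ?a ^ d) * \<nu> UNIV"
        using e' reg_nonneg[OF reg UNIV_sets] by (intro mult_right_mono) auto
      finally show "\<bar>\<nu> (hits (W l) (Suc d) k) - ?a * c * (?a * \<theta>\<^sup>2) ^ d
          * exp (- \<theta> * ?a * (\<Sum>j=1..Suc d. real (k j))) * \<nu> UNIV\<bar> \<le> e * ?a ^ Suc d * \<nu> UNIV"
        unfolding X by (simp add: f_def mult.assoc)
    qed
  qed
qed

text \<open>The constant \<open>s\<close> has to vary in the induction, since every hit adds
  \<open>s\<^sub>0\<close> to it.\<close>

lemma hits_law_cylinder:
  assumes s: "0 \<le> s" and e: "0 < (e::real)" and K: "0 < (K::real)"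
  shows "\<forall>\<^sub>F l in sequentially. \<forall>\<nu> k. reg l s \<nu> \<and> \<nu> (- W l) = 0 \<longrightarrow>
    (\<forall>j\<in>{1..d}. 5 * l < k j \<and> prob (W l) * real (k j) \<le> K) \<longrightarrow>
    \<bar>\<nu> (hits (W l) d k) - (prob (W l) * \<theta>\<^sup>2) ^ d * exp (- \<theta> * prob (W l) * (\<Sum>j=1..d. real (k j))) * \<nu> UNIV\<bar>
      \<le> e * prob (W l) ^ d * \<nu> UNIV"
  using s e
proof (induction d arbitrary: s e)
  case 0
  have "0 \<le> e * \<nu> UNIV" if "reg l s \<nu>" for l \<nu>
    using reg_nonneg[OF that UNIV_sets] \<open>0 < e\<close> by simp
  then show ?case by (intro always_eventually) auto
next
  case (Suc d)
  have "0 \<le> s + s\<^sub>0" using Suc.prems s0_pos by simp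
  note rest = Suc.IH[OF this]
  have le: "\<theta>\<^sup>2 \<le> 1" using \<theta>_pos \<theta>_le_1 by (simp add: power_le_one)
  have "reg l s \<nu>" if "1 \<le> l" "reg l s \<nu> \<and> \<nu> (- W l) = 0" for l \<nu> using that by blast
  from hits_law_Suc[OF Suc.prems(1) zero_le_power2 le Suc.prems(2) this
      hit_law_cylinder[OF Suc.prems(1) _ K] rest]
  show ?case by (simp only: power_Suc)
qed

lemma hits_law_regular:
  assumes s: "0 \<le> s" and e: "0 < (e::real)" and K: "0 < (K::real)"
  shows "\<forall>\<^sub>F l in sequentially. \<forall>\<nu> k. reg 1 s \<nu> \<longrightarrow>
    (\<forall>j\<in>{1..Suc d}. 5 * l < k j \<and> prob (W l) * real (k j) \<le> K) \<longrightarrow>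
    \<bar>\<nu> (hits (W l) (Suc d) k) - prob (W l) * \<theta> * (prob (W l) * \<theta>\<^sup>2) ^ d
        * exp (- \<theta> * prob (W l) * (\<Sum>j=1..Suc d. real (k j))) * \<nu> UNIV\<bar>
      \<le> e * prob (W l) ^ Suc d * \<nu> UNIV"
proof -
  have "0 \<le> s + s\<^sub>0" using s s0_pos by simp
  note rest = hits_law_cylinder[OF this _ K]
  have "reg l s \<nu>" if "1 \<le> l" "reg 1 s \<nu>" for l \<nu> using reg_mono[OF that(2,1) order_refl] .
  from hits_law_Suc[OF s less_imp_le[OF \<theta>_pos] \<theta>_le_1 e this hit_law_regular[OF s _ K] rest]
  show ?thesis .
qed

end

section \<open>Regular densities and hitting events\<close>

context gibbs_markov
begin

lemma prob_densitiesD: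
  assumes "u \<in> prob_densities M"
  shows "u \<in> borel_measurable M" "0 \<le> u y" "(\<integral>\<^sup>+x. ennreal (u x) \<partial>M) = 1"
  using assms by (auto simp: prob_densities_def)

lemma emeasure_weighted:
  assumes "u \<in> prob_densities M" "E \<in> sets M"
  shows "emeasure (u \<odot> M) E = (\<integral>\<^sup>+x\<in>E. ennreal (u x) \<partial>M)"
  using assms prob_densitiesD(1)[OF assms(1)] by (simp add: weighted_def emeasure_density)

lemma prob_space_weighted:
  assumes "u \<in> prob_densities M" shows "prob_space (u \<odot> M)"
proof (rule prob_spaceI)
  have "space (u \<odot> M) = UNIV" by (simp add: weighted_def)
  then show "emeasure (u \<odot> M) (space (u \<odot> M)) = 1"
    using emeasure_weighted[OF assms UNIV_sets] prob_densitiesD(3)[OF assms] by simp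
qed

lemma sets_weighted: "sets (u \<odot> M) = sets M"
  by (simp add: weighted_def)

lemma measure_weighted_UNIV:
  assumes "u \<in> prob_densities M" shows "measure (u \<odot> M) UNIV = 1"
proof -
  have "space (u \<odot> M) = UNIV" by (simp add: weighted_def)
  then show ?thesis using prob_space.prob_space[OF prob_space_weighted[OF assms]] by simp
qed

lemma acm_weighted:
  assumes u: "u \<in> prob_densities M" shows "acm (measure (u \<odot> M))"
  unfolding acm_def
proof (intro conjI ballI allI impI)
  interpret U: prob_space "u \<odot> M" by (rule prob_space_weighted[OF u])
  fix F :: "nat \<Rightarrow> 'a set" assume "range F \<subseteq> sets M" "disjoint_family F"
  then show "(\<lambda>i. measure (u \<odot> M) (F i)) sums measure (u \<odot> M) (\<Union> (range F))"
    using U.finite_measure_UNION[of F] by (simp add: sets_weighted)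
next
  fix E assume E: "E \<in> sets M" "prob E = 0"
  then have "emeasure M E = 0" by (simp add: emeasure_eq_measure)
  then have "AE x in M. x \<notin> E" using E by (simp add: AE_iff_null_sets[symmetric] null_sets_def)
  then have "(\<integral>\<^sup>+x\<in>E. ennreal (u x) \<partial>M) = (\<integral>\<^sup>+x. 0 \<partial>M)"
    by (intro nn_integral_cong_AE) (auto elim!: eventually_mono)
  then show "measure (u \<odot> M) E = 0"
    using emeasure_weighted[OF u E(1)] by (simp add: measure_def)
qed simp

lemma weighted_ratio_le:
  assumes u: "u \<in> prob_densities M" and E: "E \<in> sets M" and F: "F \<in> sets M" and c: "0 \<le> c"
    and le: "\<And>x y. x \<in> E \<Longrightarrow> y \<in> F \<Longrightarrow> u x \<le> c * u y"
  shows "measure (u \<odot> M) E * prob F \<le> c * measure (u \<odot> M) F * prob E"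
proof -
  interpret U: prob_space "u \<odot> M" by (rule prob_space_weighted[OF u])
  have "emeasure (u \<odot> M) E * emeasure M F \<le> ennreal c * emeasure (u \<odot> M) F * emeasure M E"
    unfolding emeasure_weighted[OF u E] emeasure_weighted[OF u F]
    by (rule nn_integral_ratio_le[OF prob_densitiesD(1)[OF u] E F c le])
  then have "ennreal (measure (u \<odot> M) E * prob F) \<le> ennreal (c * measure (u \<odot> M) F * prob E)"
    unfolding U.emeasure_eq_measure emeasure_eq_measure using c by (simp add: ennreal_mult)
  then show ?thesis using c by (subst (asm) ennreal_le_iff) auto
qed

lemma weighted_cong_AE:
  assumes "u \<in> prob_densities M" "w \<in> prob_densities M" "AE x in M. u x = w x"
  shows "u \<odot> M = w \<odot> M"
  unfolding weighted_def using assms prob_densitiesD(1)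
  by (intro density_cong) (auto elim: eventually_mono)

text \<open>Off this null set, every element of \<open>\<xi>\<close> lies in a single class of the image partition.\<close>

definition exceptional_set :: "'a set" where
  "exceptional_set = (\<Union>(Z, Z')\<in>{(Z, Z'). Z \<in> \<xi> \<and> Z' \<in> \<xi> \<and> prob (T ` Z \<inter> Z') = 0}. T ` Z \<inter> Z')"

lemma exceptional_set_null: "exceptional_set \<in> sets M" "prob exceptional_set = 0"
proof -
  let ?I = "{(Z, Z'). Z \<in> \<xi> \<and> Z' \<in> \<xi> \<and> prob (T ` Z \<inter> Z') = 0}"
  have "countable (\<xi> \<times> \<xi>)" by (intro countable_SIGMA countable_partition)
  then have c: "countable ?I" by (rule countable_subset[rotated]) auto
  have "exceptional_set = (\<Union>i\<in>?I. T ` fst i \<inter> snd i)" unfolding exceptional_set_def by auto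
  moreover have "(\<Union>i\<in>?I. T ` fst i \<inter> snd i) \<in> null_sets M"
  proof (rule null_sets_UN'[OF c])
    fix i assume "i \<in> ?I"
    then have "fst i \<in> \<xi>" "snd i \<in> \<xi>" "prob (T ` fst i \<inter> snd i) = 0" by auto
    then show "T ` fst i \<inter> snd i \<in> null_sets M"
      unfolding null_sets_def by (auto simp: emeasure_eq_measure)
  qed
  ultimately have "exceptional_set \<in> null_sets M" by simp
  then show "exceptional_set \<in> sets M" "prob exceptional_set = 0"
    by (auto simp: null_sets_def measure_def)
qed

lemma image_mem_iff:
  assumes Z': "Z' \<in> \<xi>" and x: "x \<in> Z'" "x \<notin> exceptional_set" and y: "y \<in> Z'" "y \<notin> exceptional_set"
    and Z: "Z \<in> \<xi>"
  shows "y \<in> T ` Z \<longleftrightarrow> x \<in> T ` Z"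
  using image_disjoint_or_contains[OF Z Z']
proof
  assume "prob (T ` Z \<inter> Z') = 0"
  then have "T ` Z \<inter> Z' \<subseteq> exceptional_set" using Z Z' unfolding exceptional_set_def by blast
  then show ?thesis using x y by blast
next
  assume "Z' \<subseteq> T ` Z"
  then show ?thesis using x y by blast
qed

end

context distortion_control
begin

lemma one_plus_dist_le_exp:
  assumes "0 \<le> s" "B \<in> cylinders T \<xi> n" "x \<in> B" "y \<in> B"
  shows "1 + s * dist x y \<le> exp (s * R * \<kappa> ^ n)"
proof -
  have "s * dist x y \<le> s * (R * \<kappa> ^ n)" by (rule mult_left_mono[OF diameter[OF assms(2-)] assms(1)])
  then have "1 + s * dist x y \<le> 1 + s * R * \<kappa> ^ n" by (simp add: mult.assoc)
  also have "\<dots> \<le> exp (s * R * \<kappa> ^ n)" by (rule exp_ge_add_one_self)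
  finally show ?thesis .
qed

text \<open>A cylinder of positive rank lies in one class of the image partition only up to
  \<open>exceptional_set\<close>, so this null set is removed from \<open>E\<close> and
  \<open>F\<close> before the pointwise bound is integrated. In the constant, \<open>r + 1\<close>
  comes from \<open>reg_onD\<close> and \<open>R\<close> from the diameter of cylinders.\<close>

lemma reg_regular_density:
  assumes u: "u \<in> regular_densities M T \<xi> r" and r: "0 < r"
  shows "reg 1 ((r + 1) * R) (measure (u \<odot> M))"
proof -
  obtain w where w: "w \<in> prob_densities M" "AE x in M. u x = w x"
    "reg_partition (image_partition T \<xi>) w \<le> ereal r" and up: "u \<in> prob_densities M"
    using u unfolding regular_densities_def by blast
  have eq: "u \<odot> M = w \<odot> M" by (rule weighted_cong_AE[OF up w(1,2)])
  note acm = acm_weighted[OF w(1)]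
  let ?N = exceptional_set
  show ?thesis unfolding eq
  proof (rule regI[OF acm])
    fix n B E F
    assume *: "1 \<le> n" "B \<in> cylinders T \<xi> n" "E \<in> sets M" "F \<in> sets M" "E \<subseteq> B" "F \<subseteq> B"
    obtain Z' where Z': "Z' \<in> \<xi>" "B \<subseteq> Z'" using cylinders_mono[OF *(2,1)] by auto
    have drop: "measure (w \<odot> M) (G - ?N) = measure (w \<odot> M) G" "prob (G - ?N) = prob G" if G: "G \<in> sets M" for G
    proof -
      have s: "G \<inter> ?N \<in> sets M" by (rule sets.Int[OF G exceptional_set_null(1)])
      have "prob (G \<inter> ?N) \<le> prob ?N" by (rule finite_measure_mono[OF _ exceptional_set_null(1)]) blast
      then have 0: "prob (G \<inter> ?N) = 0" using exceptional_set_null(2) measure_nonneg[of M "G \<inter> ?N"] by linarith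
      show "prob (G - ?N) = prob G" using acm_split[OF acm_prob G exceptional_set_null(1)] 0 by simp
      show "measure (w \<odot> M) (G - ?N) = measure (w \<odot> M) G"
        using acm_split[OF acm G exceptional_set_null(1)] acm_null[OF acm s 0] by simp
    qed
    have "measure (w \<odot> M) (E - ?N) * prob (F - ?N)
        \<le> exp ((r + 1) * R * \<kappa> ^ n) * measure (w \<odot> M) (F - ?N) * prob (E - ?N)"
    proof (rule weighted_ratio_le[OF w(1)])
      show "E - ?N \<in> sets M" "F - ?N \<in> sets M" using *(3,4) exceptional_set_null(1) by (simp_all add: sets.Diff)
      fix x y assume x: "x \<in> E - ?N" and y: "y \<in> F - ?N"
      define P where "P = {y. \<forall>Z\<in>\<xi>. y \<in> T ` Z \<longleftrightarrow> x \<in> T ` Z}"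
      have "P \<in> image_partition T \<xi>" unfolding P_def image_partition_def by (rule rangeI)
      then have "reg_on P w \<le> reg_partition (image_partition T \<xi>) w"
        unfolding reg_partition_def by (rule SUP_upper)
      then have P: "reg_on P w \<le> ereal r" using w(3) by (rule order_trans)
      have xy: "x \<in> B" "y \<in> B" using x y *(5,6) by blast+
      have "\<forall>Z\<in>\<xi>. y \<in> T ` Z \<longleftrightarrow> x \<in> T ` Z"
        using image_mem_iff[OF Z'(1), of x y] x y xy Z'(2) by blast
      then have "x \<in> P" "y \<in> P" unfolding P_def by simp_all
      then have "w x \<le> (1 + (r + 1) * dist x y) * w y"
        by (intro reg_onD[OF P] prob_densitiesD(2)[OF w(1)])
      also have "\<dots> \<le> exp ((r + 1) * R * \<kappa> ^ n) * w y"
        using r by (intro mult_right_mono one_plus_dist_le_exp[OF _ *(2) xy] prob_densitiesD(2)[OF w(1)]) simp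
      finally show "w x \<le> exp ((r + 1) * R * \<kappa> ^ n) * w y" .
    qed simp
    then show "measure (w \<odot> M) E * prob F \<le> exp ((r + 1) * R * \<kappa> ^ n) * measure (w \<odot> M) F * prob E"
      using drop[OF *(3)] drop[OF *(4)] by simp
  qed
qed

lemma reg_regular_density_on:
  assumes u: "u \<in> regular_densities_on M C r" and r: "0 < r" and C: "C \<in> cylinders T \<xi> l"
  shows "reg l ((r + 1) * R) (measure (u \<odot> M))" "measure (u \<odot> M) (- C) = 0"
proof -
  obtain w where w: "w \<in> prob_densities M" "AE x in M. u x = w x" "w = (\<lambda>x. indicator C x * w x)"
    "reg_on C w \<le> ereal r" and up: "u \<in> prob_densities M"
    using u unfolding regular_densities_on_def by blast
  have eq: "u \<odot> M = w \<odot> M" by (rule weighted_cong_AE[OF up w(1,2)])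
  note acm = acm_weighted[OF w(1)]
  have w0: "w x = 0" if "x \<notin> C" for x using fun_cong[OF w(3), of x] that by simp
  have null: "measure (w \<odot> M) E = 0" if "E \<in> sets M" "E \<inter> C = {}" for E
  proof -
    have "ennreal (w x) * indicator E x = 0" for x
    proof (cases "x \<in> E")
      case True
      then have "x \<notin> C" using that(2) by blast
      then show ?thesis using w0 by simp
    qed simp
    then have "emeasure (w \<odot> M) E = 0"
      unfolding emeasure_weighted[OF w(1) that(1)] by (simp only: nn_integral_const) simp
    then show ?thesis by (simp add: measure_def)
  qed
  show "measure (u \<odot> M) (- C) = 0" unfolding eq by (rule null) (use C in auto)
  show "reg l ((r + 1) * R) (measure (u \<odot> M))" unfolding eq
  proof (rule regI[OF acm])
    fix n B E F
    assume *: "l \<le> n" "B \<in> cylinders T \<xi> n" "E \<in> sets M" "F \<in> sets M" "E \<subseteq> B" "F \<subseteq> B"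
    show "measure (w \<odot> M) E * prob F \<le> exp ((r + 1) * R * \<kappa> ^ n) * measure (w \<odot> M) F * prob E"
      using cylinders_dichotomy[OF disjoint_partition *(2) C *(1)]
    proof
      assume "B \<inter> C = {}"
      then have "E \<inter> C = {}" using *(5) by blast
      then show ?thesis using null[OF *(3)] by simp
    next
      assume BC: "B \<subseteq> C"
      show ?thesis
      proof (rule weighted_ratio_le[OF w(1) *(3,4)])
        fix x y assume "x \<in> E" "y \<in> F"
        then have xy: "x \<in> B" "y \<in> B" using *(5,6) by blast+
        then have "w x \<le> (1 + (r + 1) * dist x y) * w y"
          using BC by (intro reg_onD[OF w(4)] prob_densitiesD(2)[OF w(1)]) blast+
        also have "\<dots> \<le> exp ((r + 1) * R * \<kappa> ^ n) * w y"
          using r by (intro mult_right_mono one_plus_dist_le_exp[OF _ *(2) xy] prob_densitiesD(2)[OF w(1)]) simp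
        finally show "w x \<le> exp ((r + 1) * R * \<kappa> ^ n) * w y" .
      qed simp
    qed
  qed
qed

section \<open>Hitting events as orbit conditions\<close>

lemma hitting_time_eq_iff:
  assumes "1 \<le> k" shows "hitting_time T A y = enat k \<longleftrightarrow> y \<in> hit A k"
proof
  let ?S = "{n. 1 \<le> n \<and> (T ^^ n) y \<in> A}"
  assume eq: "hitting_time T A y = enat k"
  then have "?S \<noteq> {}" unfolding hitting_time_def by (auto simp: Inf_enat_def split: if_splits)
  then obtain n where "n \<in> ?S" by blast
  then have "Inf (enat ` ?S) \<in> enat ` ?S" by (rule wellorder_InfI[OF imageI])
  then have k: "k \<in> ?S" using eq unfolding hitting_time_def by auto
  have "k \<le> n" if "n \<in> ?S" for n
  proof -
    have "Inf (enat ` ?S) \<le> enat n" using that by (intro Inf_lower imageI)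
    then show ?thesis using eq unfolding hitting_time_def by simp
  qed
  then show "y \<in> hit A k" using k unfolding hit_def by force
next
  let ?S = "{n. 1 \<le> n \<and> (T ^^ n) y \<in> A}"
  assume h: "y \<in> hit A k"
  then have k: "k \<in> ?S" using assms by (simp add: hit_def)
  have "Inf (enat ` ?S) = enat k"
  proof (rule antisym)
    show "Inf (enat ` ?S) \<le> enat k" using k by (intro Inf_lower imageI)
    show "enat k \<le> Inf (enat ` ?S)"
    proof (rule Inf_greatest)
      fix e assume "e \<in> enat ` ?S"
      then obtain n where n: "e = enat n" "1 \<le> n" "(T ^^ n) y \<in> A" by auto
      have "\<not> n < k" using h n unfolding hit_def by auto
      then show "enat k \<le> e" using n by simp
    qed
  qed
  then show "hitting_time T A y = enat k" unfolding hitting_time_def .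
qed

lemma hitting_event_Suc:
  assumes "1 \<le> k 1"
  shows "hitting_event T A (Suc d) k = hit A (k 1) \<inter> (T ^^ k 1) -` hitting_event T A d (\<lambda>j. k (Suc j))"
proof -
  let ?e = "entrance_map T A"
  have "y \<in> hitting_event T A (Suc d) k
      \<longleftrightarrow> y \<in> hit A (k 1) \<and> (T ^^ k 1) y \<in> hitting_event T A d (\<lambda>j. k (Suc j))" for y
  proof -
    have "y \<in> hitting_event T A (Suc d) k
        \<longleftrightarrow> (\<forall>j\<in>{1..Suc d}. hitting_time T A ((?e ^^ (j - 1)) y) = enat (k j))"
      unfolding hitting_event_def by auto
    also have "\<dots> \<longleftrightarrow> hitting_time T A y = enat (k 1) \<and>
        (\<forall>j\<in>{1..d}. hitting_time T A ((?e ^^ j) y) = enat (k (Suc j)))"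
      using ball_atLeastAtMost_add[of 1 d "\<lambda>j. hitting_time T A ((?e ^^ (j - 1)) y) = enat (k j)"] by simp
    also have "\<dots> \<longleftrightarrow> hitting_time T A y = enat (k 1) \<and>
        (\<forall>j\<in>{1..d}. hitting_time T A ((?e ^^ (j - 1)) ((T ^^ k 1) y)) = enat (k (Suc j)))"
    \<comment> \<open>The first condition is kept while the others are rewritten, as it identifies
      the entrance map at \<open>y\<close> with \<open>T ^^ k 1\<close>.\<close>
    proof (rule conj_cong[OF refl], rule ball_cong[OF refl])
      fix j assume t: "hitting_time T A y = enat (k 1)" and j: "j \<in> {1..d}"
      have "?e y = (T ^^ k 1) y" using t by (simp add: entrance_map_def)
      moreover have "(?e ^^ j) y = (?e ^^ (j - 1)) (?e y)"
        using j funpow_swap1[of ?e "j - 1" y] by (cases j) auto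
      ultimately show "(hitting_time T A ((?e ^^ j) y) = enat (k (Suc j)))
          = (hitting_time T A ((?e ^^ (j - 1)) ((T ^^ k 1) y)) = enat (k (Suc j)))" by simp
    qed
    also have "\<dots> \<longleftrightarrow> y \<in> hit A (k 1) \<and> (T ^^ k 1) y \<in> hitting_event T A d (\<lambda>j. k (Suc j))"
      unfolding hitting_event_def using hitting_time_eq_iff[OF assms] by auto
    finally show ?thesis .
  qed
  then show ?thesis by blast
qed

end

context shrinking_cylinders
begin

lemma hitting_event_eq_hits:
  assumes "\<And>j. j \<in> {1..d} \<Longrightarrow> 1 \<le> k j"
  shows "hitting_event T A d k = hits A d k"
  using assms
proof (induction d arbitrary: k)
  case 0
  then show ?case by (simp add: hitting_event_def)
next
  case (Suc d)
  have "hitting_event T A d (\<lambda>j. k (Suc j)) = hits A d (\<lambda>j. k (Suc j))"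
    by (rule Suc.IH) (use Suc.prems in simp)
  moreover have "1 \<le> k 1" using Suc.prems[of 1] by simp
  ultimately show ?case by (simp add: hitting_event_Suc del: One_nat_def)
qed

section \<open>From additive to relative errors\<close>

text \<open>\<open>S\<close> stands for the target measure times the total waiting time, which the
  upper bound in \<open>time_scales\<close> keeps below a constant \<open>d\<close>. As
  \<open>\<theta> \<le> 1\<close>, the exponential is at least \<open>exp (- d)\<close>, and an
  additive error carrying this factor is a relative one.\<close>

lemma ratio_close:
  fixes X a c S d \<delta> \<epsilon> :: real
  assumes close: "\<bar>X - c * a * exp (- \<theta> * S)\<bar> \<le> \<epsilon> * (b * exp (- d)) * a"
    and bounds: "0 < b" "b \<le> c" "0 < a" "0 \<le> S" "S \<le> d" "0 < \<epsilon>"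
  shows "\<bar>X / (c * a * exp (- \<theta> * S)) - 1\<bar> \<le> \<epsilon>"
proof -
  let ?Y = "c * a * exp (- \<theta> * S)"
  have "\<theta> * S \<le> 1 * d" using \<theta>_pos \<theta>_le_1 bounds by (intro mult_mono) auto
  then have "b * exp (- d) * a \<le> c * exp (- \<theta> * S) * a"
    using bounds by (intro mult_right_mono mult_mono) auto
  then have "\<epsilon> * (b * exp (- d)) * a \<le> \<epsilon> * ?Y"
    using mult_left_mono[of "b * exp (- d) * a" ?Y \<epsilon>] bounds by (simp add: mult_ac)
  then have "\<bar>X - ?Y\<bar> \<le> \<epsilon> * ?Y" using close by linarith
  moreover have Y: "0 < ?Y" using bounds by simp
  moreover have "\<bar>X / ?Y - 1\<bar> = \<bar>X - ?Y\<bar> / ?Y"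
  proof -
    have "X / ?Y - 1 = (X - ?Y) / ?Y" using bounds by (simp add: diff_divide_distrib)
    then show ?thesis using Y by (simp add: abs_divide)
  qed
  ultimately show ?thesis by (simp only: pos_divide_le_eq)
qed

text \<open>The lower bound in \<open>time_scales\<close> puts every waiting time beyond the gaps,
  because \<open>5 * l * prob (W l)\<close> falls below \<open>\<delta>\<close>.\<close>

lemma time_scales_eventually:
  assumes A: "\<forall>l\<ge>1. A l = W l" and \<delta>: "0 < \<delta>"
  shows "\<forall>\<^sub>F l in sequentially. \<forall>k\<in>time_scales M A \<delta>.
    5 * l < k l \<and> 1 \<le> k l \<and> prob (W l) * real (k l) \<le> 1 / \<delta>"
proof -
  have "(\<lambda>l. 5 * (real l * prob (W l))) \<longlonglongrightarrow> 5 * 0" by (intro tendsto_intros linear_W_lim)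
  then have "\<forall>\<^sub>F l in sequentially. 5 * (real l * prob (W l)) < \<delta>"
    by (rule order_tendstoD) (use \<delta> in simp)
  then show ?thesis using eventually_ge_at_top[of 1]
  proof eventually_elim
    case (elim l)
    show ?case
    proof
      fix k assume "k \<in> time_scales M A \<delta>"
      then have k: "\<delta> \<le> prob (W l) * real (k l)" "prob (W l) * real (k l) \<le> 1 / \<delta>"
        using elim(2) A unfolding time_scales_def by auto
      then have "real (5 * l) * prob (W l) < real (k l) * prob (W l)"
        using elim(1) by (simp add: mult_ac)
      then have "real (5 * l) < real (k l)" using mult_less_cancel_right_pos[OF W_pos[of l]] by simp
      then have "5 * l < k l" by (simp only: of_nat_less_iff)
      then show "5 * l < k l \<and> 1 \<le> k l \<and> prob (W l) * real (k l) \<le> 1 / \<delta>" using k(2) by simp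
    qed
  qed
qed

lemma scaled_time_sum:
  assumes "\<forall>j\<in>{1..d}. prob (W l) * real (k j) \<le> 1 / \<delta>"
  shows "0 \<le> prob (W l) * (\<Sum>j=1..d. real (k j))" "prob (W l) * (\<Sum>j=1..d. real (k j)) \<le> real d / \<delta>"
proof -
  show "0 \<le> prob (W l) * (\<Sum>j=1..d. real (k j))" by (simp add: sum_nonneg)
  have "prob (W l) * (\<Sum>j=1..d. real (k j)) \<le> (\<Sum>j=1..d. 1 / \<delta>)"
    unfolding sum_distrib_left using assms by (intro sum_mono) auto
  then show "prob (W l) * (\<Sum>j=1..d. real (k j)) \<le> real d / \<delta>" by simp
qed

text \<open>The family \<open>N\<close> covers both kinds of start: a fixed measure, or the
  \<open>l\<close>-th member of a sequence of measures.\<close>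

lemma uniform_asymptotics_of_law:
  fixes N :: "'q \<Rightarrow> nat \<Rightarrow> 'a measure"
  assumes A: "\<forall>l\<ge>1. A l = W l" and \<delta>: "0 < \<delta>" and c: "0 < c"
    and law: "\<And>e::real. 0 < e \<Longrightarrow> \<forall>\<^sub>F l in sequentially. \<forall>\<nu>\<in>V. \<forall>k.
      (\<forall>j\<in>{1..d}. 5 * l < k j \<and> prob (W l) * real (k j) \<le> 1 / \<delta>) \<longrightarrow>
      \<bar>measure (N \<nu> l) (hits (W l) d k) - c * prob (W l) ^ d
        * exp (- \<theta> * prob (W l) * (\<Sum>j=1..d. real (k j)))\<bar> \<le> e * prob (W l) ^ d"
  shows "uniformly_asymp_equiv
        {(\<nu>, k). \<nu> \<in> V \<and> (\<forall>j\<in>{1..d}. k j \<in> time_scales M A \<delta>)}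
        (\<lambda>(\<nu>, k) l. measure (N \<nu> l) (hitting_event T (A l) d (\<lambda>j. k j l)))
        (\<lambda>(\<nu>, k) l. c * prob (A l) ^ d * exp (- \<theta> * prob (A l) * (\<Sum>j=1..d. real (k j l))))"
  unfolding uniformly_asymp_equiv_def
proof (intro allI impI)
  fix \<epsilon> :: real assume \<epsilon>: "0 < \<epsilon>"
  let ?P = "\<lambda>l. \<forall>q\<in>{(\<nu>, k). \<nu> \<in> V \<and> (\<forall>j\<in>{1..d}. k j \<in> time_scales M A \<delta>)}.
    \<bar>(case q of (\<nu>, k) \<Rightarrow> \<lambda>l. measure (N \<nu> l) (hitting_event T (A l) d (\<lambda>j. k j l))) l /
      (case q of (\<nu>, k) \<Rightarrow> \<lambda>l. c * prob (A l) ^ d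
        * exp (- \<theta> * prob (A l) * (\<Sum>j=1..d. real (k j l)))) l - 1\<bar> \<le> \<epsilon>"
  \<comment> \<open>The factor \<open>c * exp (- (real d / \<delta>))\<close> is a lower bound for
    the main term divided by \<open>prob (W l) ^ d\<close>.\<close>
  define e where "e = \<epsilon> * (c * exp (- (real d / \<delta>)))"
  have e: "0 < e" using \<epsilon> c by (simp add: e_def)
  have "\<forall>\<^sub>F l in sequentially. ?P l"
    using law[OF e] time_scales_eventually[OF A \<delta>] eventually_ge_at_top[of 1]
  proof eventually_elim
    case (elim l)
    have Al: "A l = W l" using A elim(3) by blast
    show ?case
    proof (clarify, unfold prod.case Al)
      fix \<nu> k assume \<nu>: "\<nu> \<in> V" and k: "\<forall>j\<in>{1..d}. k j \<in> time_scales M A \<delta>"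
      let ?k = "\<lambda>j. k j l"
      have kj: "\<forall>j\<in>{1..d}. 5 * l < ?k j \<and> 1 \<le> ?k j \<and> prob (W l) * real (?k j) \<le> 1 / \<delta>"
        using elim(2) k by blast
      have H: "hitting_event T (W l) d ?k = hits (W l) d ?k"
        by (rule hitting_event_eq_hits) (use kj in blast)
      have "\<bar>measure (N \<nu> l) (hits (W l) d ?k) - c * prob (W l) ^ d
          * exp (- \<theta> * prob (W l) * (\<Sum>j=1..d. real (?k j)))\<bar> \<le> e * prob (W l) ^ d"
        by (rule elim(1)[rule_format, OF \<nu>]) (use kj in blast)
      then have close: "\<bar>measure (N \<nu> l) (hits (W l) d ?k) - c * prob (W l) ^ d
          * exp (- \<theta> * (prob (W l) * (\<Sum>j=1..d. real (?k j))))\<bar>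
          \<le> \<epsilon> * (c * exp (- (real d / \<delta>))) * prob (W l) ^ d"
        unfolding e_def by (simp only: mult.assoc)
      have "\<bar>measure (N \<nu> l) (hits (W l) d ?k) / (c * prob (W l) ^ d
          * exp (- \<theta> * (prob (W l) * (\<Sum>j=1..d. real (?k j))))) - 1\<bar> \<le> \<epsilon>"
        by (rule ratio_close[OF close]) (use c W_pos[of l] \<epsilon> scaled_time_sum[of d l ?k \<delta>] kj in auto)
      then show "\<bar>measure (N \<nu> l) (hitting_event T (W l) d ?k) / (c * prob (W l) ^ d
          * exp (- \<theta> * prob (W l) * (\<Sum>j=1..d. real (?k j)))) - 1\<bar> \<le> \<epsilon>"
        unfolding H by (simp only: mult.assoc)
    qed
  qed
  then show "\<exists>l\<^sub>0. \<forall>l\<ge>l\<^sub>0. ?P l" unfolding eventually_sequentially .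
qed

lemma hitting_asymptotics_regular:
  assumes A: "\<forall>l\<ge>1. A l = W l" and r: "0 < r" and d: "1 \<le> d" and \<delta>: "0 < \<delta>"
    and V: "\<And>\<nu>. \<nu> \<in> V \<Longrightarrow> \<exists>u\<in>regular_densities M T \<xi> r. \<nu> = u \<odot> M"
  shows "uniformly_asymp_equiv
        {(\<nu>, k). \<nu> \<in> V \<and> (\<forall>j\<in>{1..d}. k j \<in> time_scales M A \<delta>)}
        (\<lambda>(\<nu>, k) l. measure \<nu> (hitting_event T (A l) d (\<lambda>j. k j l)))
        (\<lambda>(\<nu>, k) l. \<theta> ^ (2 * d - 1) * prob (A l) ^ d
           * exp (- \<theta> * prob (A l) * (\<Sum>j=1..d. real (k j l))))"
proof (rule uniform_asymptotics_of_law[OF A \<delta>])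
  show "0 < \<theta> ^ (2 * d - 1)" using \<theta>_pos by simp
  fix e :: real assume e: "0 < e"
  obtain d' where d': "d = Suc d'" using d by (cases d) auto
  have K: "0 < 1 / \<delta>" using \<delta> by simp
  have s: "0 \<le> (r + 1) * R" using r R_pos by simp
  show "\<forall>\<^sub>F l in sequentially. \<forall>\<nu>\<in>V. \<forall>k. (\<forall>j\<in>{1..d}. 5 * l < k j \<and> prob (W l) * real (k j) \<le> 1 / \<delta>) \<longrightarrow>
      \<bar>measure \<nu> (hits (W l) d k) - \<theta> ^ (2 * d - 1) * prob (W l) ^ d
        * exp (- \<theta> * prob (W l) * (\<Sum>j=1..d. real (k j)))\<bar> \<le> e * prob (W l) ^ d"
    using hits_law_regular[OF s e K, of d']
  proof eventually_elim
    case (elim l)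
    show ?case
    proof (intro ballI allI impI)
      fix \<nu> k assume "\<nu> \<in> V" and k: "\<forall>j\<in>{1..d}. 5 * l < k j \<and> prob (W l) * real (k j) \<le> 1 / \<delta>"
      then obtain u where u: "u \<in> regular_densities M T \<xi> r" "\<nu> = u \<odot> M" using V by blast
      then have one: "measure (u \<odot> M) UNIV = 1" by (simp add: measure_weighted_UNIV regular_densities_def)
      have const: "prob (W l) * \<theta> * (prob (W l) * \<theta>\<^sup>2) ^ d' = \<theta> ^ (2 * d - 1) * prob (W l) ^ d"
        by (simp add: d' power_mult_distrib mult_ac flip: power_mult)
      show "\<bar>measure \<nu> (hits (W l) d k) - \<theta> ^ (2 * d - 1) * prob (W l) ^ d
        * exp (- \<theta> * prob (W l) * (\<Sum>j=1..d. real (k j)))\<bar> \<le> e * prob (W l) ^ d"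
        using elim[THEN spec, THEN spec, of "measure \<nu>" k] reg_regular_density[OF u(1) r] k
        unfolding d'[symmetric] const one mult_1_right u(2) by blast
    qed
  qed
qed

lemma hitting_asymptotics_cylinder:
  assumes A: "\<forall>l\<ge>1. A l = W l" and r: "0 < r" and \<delta>: "0 < \<delta>"
    and V: "\<And>l \<nu>. \<nu> \<in> V l \<Longrightarrow> \<exists>u\<in>regular_densities_on M (A l) r. \<nu> = u \<odot> M"
  shows "uniformly_asymp_equiv
        {(\<nu>, k). (\<forall>l\<ge>1. \<nu> l \<in> V l) \<and> (\<forall>j\<in>{1..d}. k j \<in> time_scales M A \<delta>)}
        (\<lambda>(\<nu>, k) l. measure (\<nu> l) (hitting_event T (A l) d (\<lambda>j. k j l)))
        (\<lambda>(\<nu>, k) l. \<theta> ^ (2 * d) * prob (A l) ^ d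
           * exp (- \<theta> * prob (A l) * (\<Sum>j=1..d. real (k j l))))"
proof (rule uniform_asymptotics_of_law[OF A \<delta>, of _ "{\<nu>. \<forall>l\<ge>1. \<nu> l \<in> V l}" d "\<lambda>\<nu>. \<nu>", unfolded mem_Collect_eq])
  show "0 < \<theta> ^ (2 * d)" using \<theta>_pos by simp
  fix e :: real assume e: "0 < e"
  have K: "0 < 1 / \<delta>" using \<delta> by simp
  have s: "0 \<le> (r + 1) * R" using r R_pos by simp
  show "\<forall>\<^sub>F l in sequentially. \<forall>\<nu>\<in>{\<nu>. \<forall>l\<ge>1. \<nu> l \<in> V l}. \<forall>k.
      (\<forall>j\<in>{1..d}. 5 * l < k j \<and> prob (W l) * real (k j) \<le> 1 / \<delta>) \<longrightarrow>
      \<bar>measure (\<nu> l) (hits (W l) d k) - \<theta> ^ (2 * d) * prob (W l) ^ d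
        * exp (- \<theta> * prob (W l) * (\<Sum>j=1..d. real (k j)))\<bar> \<le> e * prob (W l) ^ d"
    using hits_law_cylinder[OF s e K, of d] eventually_ge_at_top[of 1]
  proof eventually_elim
    case (elim l)
    show ?case
    proof (intro ballI allI impI)
      fix \<nu> k assume "\<nu> \<in> {\<nu>. \<forall>l\<ge>1. \<nu> l \<in> V l}"
        and k: "\<forall>j\<in>{1..d}. 5 * l < k j \<and> prob (W l) * real (k j) \<le> 1 / \<delta>"
      then have "\<nu> l \<in> V l" using elim(2) by blast
      moreover have "A l = W l" using A elim(2) by blast
      ultimately obtain u where u: "u \<in> regular_densities_on M (W l) r" "\<nu> l = u \<odot> M"
        using V by metis
      then have one: "measure (u \<odot> M) UNIV = 1" by (simp add: measure_weighted_UNIV regular_densities_on_def)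
      have const: "(prob (W l) * \<theta>\<^sup>2) ^ d = \<theta> ^ (2 * d) * prob (W l) ^ d"
        by (simp add: power_mult_distrib mult_ac flip: power_mult)
      show "\<bar>measure (\<nu> l) (hits (W l) d k) - \<theta> ^ (2 * d) * prob (W l) ^ d
        * exp (- \<theta> * prob (W l) * (\<Sum>j=1..d. real (k j)))\<bar> \<le> e * prob (W l) ^ d"
        using elim(1)[THEN spec, THEN spec, of "measure (\<nu> l)" k]
          reg_regular_density_on[OF u(1) r W_cylinder] k
        unfolding const one mult_1_right u(2) by blast
    qed
  qed
qed

end

section \<open>Cylinders around a point\<close>

locale coded_point = distortion_control M T \<xi> \<kappa> R
  for M :: "'a::metric_space measure" and T :: "'a \<Rightarrow> 'a" and \<xi> :: "'a set set" and \<kappa> R :: real +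
  fixes x :: 'a and w W :: "nat \<Rightarrow> 'a set"
  assumes w_partition: "w i \<in> \<xi>" and orbit: "(T ^^ i) x \<in> w i"
    and W_eq: "W l = (\<Inter>i<l. (T ^^ i) -` w i)"
    and W_pos: "0 < prob (W l)"
    and W_lim: "(\<lambda>l. prob (W l)) \<longlonglongrightarrow> 0"
begin

lemma W_cylinder: "W l \<in> cylinders T \<xi> l"
  unfolding W_eq cylinders_def using w_partition by blast

lemma W_sets [simp]: "W l \<in> sets M"
  using W_cylinder by blast

lemma W_antimono: "i \<le> l \<Longrightarrow> W l \<subseteq> W i"
  unfolding W_eq by auto

lemma point_in_W: "x \<in> W l"
  unfolding W_eq using orbit by blast

lemma mem_W_iff: "y \<in> W l \<longleftrightarrow> (\<forall>i<l. (T ^^ i) y \<in> w i)"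
  unfolding W_eq by auto

lemma symbol_unique: "Z \<in> \<xi> \<Longrightarrow> y \<in> Z \<Longrightarrow> y \<in> w i \<Longrightarrow> Z = w i"
  using disjoint_partition w_partition[of i] unfolding disjoint_def by blast

text \<open>Both \<open>y\<close> and \<open>(T ^^ i) y\<close> follow the itinerary of
  \<open>x\<close> for \<open>l\<close> letters, which gives \<open>w (i + j) = w j\<close> for
  \<open>j < l - i\<close>; the orbit of \<open>x\<close> inherits this.\<close>

lemma overlap_orbit:
  assumes y: "y \<in> W l" "(T ^^ i) y \<in> W l" and i: "i \<le> l"
  shows "(T ^^ i) x \<in> W (l - i)"
  unfolding mem_W_iff
proof (intro allI impI)
  fix j assume j: "j < l - i"
  have "(T ^^ (i + j)) y \<in> w (i + j)" using y(1) j unfolding mem_W_iff by simp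
  moreover have "(T ^^ (i + j)) y \<in> w j" using y(2) j unfolding mem_W_iff funpow_comp_apply by simp
  ultimately have "w (i + j) = w j" using symbol_unique[OF w_partition] by blast
  then show "(T ^^ j) ((T ^^ i) x) \<in> w j" using orbit[of "i + j"] unfolding funpow_comp_apply by simp
qed

text \<open>By \<open>overlap_orbit\<close>, returns for arbitrarily large \<open>l\<close> would
  put \<open>(T ^^ i) x\<close> into cylinders around \<open>x\<close> whose diameters tend to
  \<open>0\<close>.\<close>

lemma no_short_return:
  assumes "(T ^^ i) x \<noteq> x"
  shows "\<forall>\<^sub>F l in sequentially. W l \<inter> (T ^^ i) -` W l = {}"
proof -
  have "(\<lambda>n. R * \<kappa> ^ n) \<longlonglongrightarrow> R * 0"
    using \<kappa>_pos \<kappa>_less_1 by (intro tendsto_intros LIMSEQ_power_zero) auto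
  then have "\<forall>\<^sub>F n in sequentially. R * \<kappa> ^ n < dist ((T ^^ i) x) x"
    by (rule order_tendstoD) (use assms in simp)
  then obtain n0 where n0: "\<And>n. n0 \<le> n \<Longrightarrow> R * \<kappa> ^ n < dist ((T ^^ i) x) x"
    unfolding eventually_sequentially by blast
  show ?thesis
    using eventually_ge_at_top[of "n0 + i"]
  proof eventually_elim
    case (elim l)
    show ?case
    proof (rule ccontr)
      assume "W l \<inter> (T ^^ i) -` W l \<noteq> {}"
      then obtain y where y: "y \<in> W l" "(T ^^ i) y \<in> W l" by blast
      have "(T ^^ i) x \<in> W (l - i)" by (rule overlap_orbit[OF y]) (use elim in simp)
      from diameter[OF W_cylinder this point_in_W] have "dist ((T ^^ i) x) x \<le> R * \<kappa> ^ (l - i)" .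
      moreover have "n0 \<le> l - i" using elim by linarith
      ultimately show False using n0[of "l - i"] by linarith
    qed
  qed
qed

lemma shrinking_aperiodic:
  assumes "\<not> periodic T x"
  shows "shrinking_cylinders M T \<xi> \<kappa> R W (\<lambda>_. {}) 1 1"
proof unfold_locales
  fix i :: nat assume "1 \<le> i"
  then have "(T ^^ i) x \<noteq> x" using assms unfolding periodic_def by blast
  from no_short_return[OF this]
  show "\<forall>\<^sub>F l in sequentially. W l \<inter> (T ^^ i) -` W l \<subseteq> {}" by simp
qed (rule W_cylinder W_pos W_lim | erule W_antimono | simp)+

text \<open>Both letters occur in succession on \<open>W (Suc (Suc i))\<close>, which has positive
  measure, so by stationarity the transition has positive measure. The Markov property then gives
  the inclusion.\<close>

lemma symbol_in_image: "w (Suc i) \<subseteq> T ` w i"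
proof -
  have sets: "w i \<inter> T -` w (Suc i) \<in> sets M"
    by (rule sets.Int[OF partition_sets[OF w_partition] vimage_sets[OF partition_sets[OF w_partition]]])
  have "prob (W (Suc (Suc i))) \<le> prob ((T ^^ i) -` (w i \<inter> T -` w (Suc i)))"
  proof (rule finite_measure_mono)
    show "W (Suc (Suc i)) \<subseteq> (T ^^ i) -` (w i \<inter> T -` w (Suc i))"
    proof
      fix y assume y: "y \<in> W (Suc (Suc i))"
      have "i < Suc (Suc i)" "Suc i < Suc (Suc i)" by simp_all
      then have "(T ^^ i) y \<in> w i" "(T ^^ Suc i) y \<in> w (Suc i)" using y unfolding mem_W_iff by blast+
      then show "y \<in> (T ^^ i) -` (w i \<inter> T -` w (Suc i))" by simp
    qed
  qed (rule funpow_vimage_sets[OF sets])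
  also have "\<dots> = prob (w i \<inter> T -` w (Suc i))"
    by (rule prob_funpow_vimage[OF sets])
  finally have pos: "0 < prob (w i \<inter> T -` w (Suc i))" using W_pos[of "Suc (Suc i)"] by linarith
  show ?thesis
    using image_disjoint_or_contains[OF w_partition w_partition, of i "Suc i"]
  proof
    assume "prob (T ` w i \<inter> w (Suc i)) = 0"
    then have "prob (w i \<inter> T -` w (Suc i)) = 0"
      by (intro prob_branch_eq_0 w_partition partition_sets) (simp add: Int_commute)
    then show ?thesis using pos by simp
  qed
qed

text \<open>\<open>symbol_in_image\<close> is lifted along the itinerary. For a periodic centre this
  puts all \<open>W l\<close> with \<open>l \<ge> 1\<close> into the domain of the inverse branch of
  \<open>W p\<close>.\<close>

lemma symbol_subset_image_W: "1 \<le> j \<Longrightarrow> w j \<subseteq> (T ^^ j) ` W j"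
proof (induction j rule: dec_induct)
  case base
  have "W 1 = w 0" unfolding W_eq by auto
  then show ?case using symbol_in_image[of 0] by simp
next
  case (step j)
  show ?case
  proof
    fix y assume "y \<in> w (Suc j)"
    then obtain z where z: "z \<in> w j" "y = T z" using symbol_in_image[of j] by blast
    then obtain u where u: "u \<in> W j" "z = (T ^^ j) u" using step.IH by blast
    have "u \<in> W (Suc j)" using u z(1) unfolding mem_W_iff by (auto simp: less_Suc_eq)
    moreover have "y = (T ^^ Suc j) u" using u z by simp
    ultimately show "y \<in> (T ^^ Suc j) ` W (Suc j)" by blast
  qed
qed

text \<open>Of all cylinders of rank \<open>l\<close> only \<open>W l\<close> contains
  \<open>x\<close>, so it is the initial part of \<open>W (l + L)\<close> and
  \<open>cylinder_contraction\<close> applies. The uniformity in \<open>l\<close> later excludes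
  \<open>g x \<ge> 1\<close>.\<close>

lemma W_contraction:
  obtains L e where "0 < L" "0 < e" "e < 1" "\<And>l n. L \<le> n \<Longrightarrow> prob (W (l + n)) \<le> (1 - e) * prob (W l)"
proof -
  have "\<forall>\<^sub>F l in sequentially. prob (W l) < 1" using W_lim by (rule order_tendstoD) simp
  then obtain m where m: "prob (W m) < 1" using eventually_happens'[OF sequentially_bot] by blast
  obtain L e where L: "0 < L" "0 < e" "e < 1" and
    contr: "\<And>k B C. B \<in> cylinders T \<xi> k \<Longrightarrow> C \<in> cylinders T \<xi> L \<Longrightarrow>
      prob (B \<inter> (T ^^ k) -` C) \<le> (1 - e) * prob B"
    by (rule cylinder_contraction[OF W_cylinder W_pos m]) blast
  have "prob (W (l + n)) \<le> (1 - e) * prob (W l)" if n: "L \<le> n" for l n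
  proof -
    have "W (l + L) \<in> cylinders T \<xi> (l + L)" by (rule W_cylinder)
    then obtain B C where BC: "B \<in> cylinders T \<xi> l" "C \<in> cylinders T \<xi> L" "W (l + L) = B \<inter> (T ^^ l) -` C"
      by (meson cylinders_split)
    have "x \<in> B" using point_in_W[of "l + L"] BC(3) by blast
    then have "B = W l"
      using cylinders_disjoint[OF disjoint_partition BC(1) W_cylinder] point_in_W[of l] by blast
    then have "prob (W (l + L)) \<le> (1 - e) * prob (W l)" using contr[OF BC(1,2)] BC(3) by simp
    moreover have "prob (W (l + n)) \<le> prob (W (l + L))"
      by (rule finite_measure_mono[OF W_antimono W_sets]) (use n in simp)
    ultimately show ?thesis by linarith
  qed
  with that L show thesis by blast
qed

end

section \<open>Periodic centres\<close>

locale coded_periodic_point = coded_point +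
  fixes p :: nat and g :: "'a \<Rightarrow> real" and r\<^sub>0 :: real
  assumes p_pos: "1 \<le> p" and period: "(T ^^ p) x = x"
    and minimal: "\<And>i. 1 \<le> i \<Longrightarrow> i < p \<Longrightarrow> (T ^^ i) x \<noteq> x"
    and density_g: "inverse_branch_density M T p (W p) g"
    and lipschitz_g: "ratio_lipschitz_on r\<^sub>0 ((T ^^ p) ` W p) g"
    and r0_pos: "0 < r\<^sub>0"
begin

lemma symbol_shift:
  assumes "(T ^^ i) x = x" shows "w (i + m) = w m"
proof -
  have "(T ^^ (i + m)) x = (T ^^ m) x" using funpow_comp_apply[of m T i x] assms by simp
  then show ?thesis using symbol_unique[OF w_partition orbit, of "i + m" m] orbit[of m] by simp
qed

text \<open>The itinerary is \<open>p\<close>-periodic, so \<open>W (l + p)\<close> is what the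
  inverse branch of \<open>W p\<close> makes of \<open>W l\<close>.\<close>

lemma W_add_period: "W (l + p) = W p \<inter> (T ^^ p) -` W l"
proof (intro equalityI subsetI)
  fix y assume y: "y \<in> W (l + p)"
  have "(T ^^ m) ((T ^^ p) y) \<in> w m" if "m < l" for m
  proof -
    have "(T ^^ (p + m)) y \<in> w (p + m)" using y that unfolding mem_W_iff by simp
    then show ?thesis unfolding funpow_comp_apply symbol_shift[OF period] .
  qed
  then have "(T ^^ p) y \<in> W l" unfolding mem_W_iff by blast
  then show "y \<in> W p \<inter> (T ^^ p) -` W l" using y W_antimono[of p "l + p"] by auto
next
  fix y assume "y \<in> W p \<inter> (T ^^ p) -` W l"
  then have y: "y \<in> W p" "(T ^^ p) y \<in> W l" by auto
  show "y \<in> W (l + p)" unfolding mem_W_iff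
  proof (intro allI impI)
    fix m assume m: "m < l + p"
    show "(T ^^ m) y \<in> w m"
    proof (cases "m < p")
      case True
      then show ?thesis using y unfolding mem_W_iff by blast
    next
      case False
      define j where "j = m - p"
      have j: "m = p + j" "j < l" using m False by (auto simp: j_def)
      have "(T ^^ j) ((T ^^ p) y) \<in> w j" using y j unfolding mem_W_iff by blast
      then show ?thesis unfolding funpow_comp_apply j(1) symbol_shift[OF period] .
    qed
  qed
qed

lemma point_in_image: "x \<in> (T ^^ p) ` W p"
  using point_in_W[of p] period by (metis image_eqI)

lemma g_nonneg: "y \<in> (T ^^ p) ` W p \<Longrightarrow> 0 \<le> g y"
  using density_g unfolding inverse_branch_density_def by blast

lemma g_pos: "0 < g x"
  by (rule ratio_lipschitz_onD(1)[OF lipschitz_g g_nonneg point_in_image point_in_image])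

lemma W_subset_image: "1 \<le> l \<Longrightarrow> W l \<subseteq> (T ^^ p) ` W p"
proof -
  assume "1 \<le> l"
  have "W l \<subseteq> w 0"
  proof
    fix y assume "y \<in> W l"
    then have "(T ^^ 0) y \<in> w 0" using \<open>1 \<le> l\<close> unfolding mem_W_iff by (auto simp del: funpow.simps)
    then show "y \<in> w 0" by simp
  qed
  also have "w 0 = w p" using symbol_shift[OF period, of 0] by simp
  also have "\<dots> \<subseteq> (T ^^ p) ` W p" by (rule symbol_subset_image_W[OF p_pos])
  finally show ?thesis .
qed

text \<open>The numerator is the integral of \<open>g\<close> over \<open>W l\<close>, where
  \<open>g\<close> differs from \<open>g x\<close> by a relative error of at most
  \<open>r\<^sub>0 * R * \<kappa> ^ l\<close>.\<close>

lemma W_ratio_close: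
  assumes l: "1 \<le> l"
  shows "\<bar>prob (W (l + p)) / prob (W l) - g x\<bar> \<le> r\<^sub>0 * R * \<kappa> ^ l * g x"
proof -
  define e where "e = r\<^sub>0 * R * \<kappa> ^ l"
  have e: "0 \<le> e" using r0_pos R_pos \<kappa>_pos by (simp add: e_def)
  have close: "\<bar>g y - g x\<bar> \<le> e * g x" if y: "y \<in> W l" for y
  proof -
    have "\<bar>g y - g x\<bar> \<le> r\<^sub>0 * dist y x * g x"
      by (rule ratio_lipschitz_onD(2)[OF lipschitz_g g_nonneg _ point_in_image])
        (use W_subset_image[OF l] y in blast)+
    also have "\<dots> \<le> r\<^sub>0 * (R * \<kappa> ^ l) * g x"
      using r0_pos g_pos diameter[OF W_cylinder y point_in_W]
      by (intro mult_right_mono mult_left_mono) auto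
    finally show ?thesis by (simp add: e_def mult.assoc)
  qed
  have [measurable]: "g \<in> borel_measurable M" using density_g unfolding inverse_branch_density_def by blast
  have "inv_into (W p) (T ^^ p) ` W l = W (l + p)"
    unfolding W_add_period by (rule inv_into_image[OF inj_on_cylinder[OF W_cylinder] W_subset_image[OF l]])
  then have int: "emeasure M (W (l + p)) = (\<integral>\<^sup>+y\<in>W l. ennreal (g y) \<partial>M)"
    using density_g W_subset_image[OF l] W_sets[of l] unfolding inverse_branch_density_def by metis
  have "emeasure M (W (l + p)) \<le> (\<integral>\<^sup>+y. ennreal (g x + e * g x) * indicator (W l) y \<partial>M)"
    unfolding int
  proof (rule nn_integral_mono)
    fix y
    show "ennreal (g y) * indicator (W l) y \<le> ennreal (g x + e * g x) * indicator (W l) y"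
    proof (cases "y \<in> W l")
      case True
      then have "g y \<le> g x + e * g x" using close[of y] by linarith
      then show ?thesis using True by (simp add: ennreal_leI del: ennreal_plus)
    qed simp
  qed
  also have "\<dots> = ennreal (g x + e * g x) * emeasure M (W l)" by (simp add: nn_integral_cmult_indicator)
  finally have "ennreal (prob (W (l + p))) \<le> ennreal ((g x + e * g x) * prob (W l))"
    by (simp only: emeasure_eq_measure ennreal_mult''[OF measure_nonneg])
  then have up: "prob (W (l + p)) \<le> (g x + e * g x) * prob (W l)"
    using e g_pos by (subst (asm) ennreal_le_iff) auto
  \<comment> \<open>If \<open>e > 1\<close> the constant is negative and \<open>ennreal\<close>
    truncates it to \<open>0\<close>, which keeps the lower bound true.\<close>
  have "ennreal (g x - e * g x) * emeasure M (W l) = (\<integral>\<^sup>+y. ennreal (g x - e * g x) * indicator (W l) y \<partial>M)"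
    by (simp add: nn_integral_cmult_indicator)
  also have "\<dots> \<le> emeasure M (W (l + p))"
    unfolding int
  proof (rule nn_integral_mono)
    fix y
    show "ennreal (g x - e * g x) * indicator (W l) y \<le> ennreal (g y) * indicator (W l) y"
    proof (cases "y \<in> W l")
      case True
      then have "g x - e * g x \<le> g y" using close[of y] by linarith
      then show ?thesis using True by (simp add: ennreal_leI)
    qed simp
  qed
  finally have "ennreal ((g x - e * g x) * prob (W l)) \<le> ennreal (prob (W (l + p)))"
    by (simp only: emeasure_eq_measure ennreal_mult''[OF measure_nonneg])
  then have low: "(g x - e * g x) * prob (W l) \<le> prob (W (l + p))"
    by (subst (asm) ennreal_le_iff) auto
  have "g x - e * g x \<le> prob (W (l + p)) / prob (W l)" "prob (W (l + p)) / prob (W l) \<le> g x + e * g x"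
    using up low W_pos[of l] by (simp_all add: pos_le_divide_eq pos_divide_le_eq)
  then show ?thesis unfolding e_def by (simp add: abs_le_iff)
qed

lemma W_ratio: "(\<lambda>l. prob (W (l + p)) / prob (W l)) \<longlonglongrightarrow> g x"
proof (rule LIM_zero_cancel, rule Lim_null_comparison)
  show "\<forall>\<^sub>F l in sequentially. norm (prob (W (l + p)) / prob (W l) - g x) \<le> r\<^sub>0 * R * \<kappa> ^ l * g x"
    using eventually_ge_at_top[of 1] by eventually_elim (simp add: W_ratio_close)
  have "(\<lambda>l. r\<^sub>0 * R * \<kappa> ^ l * g x) \<longlonglongrightarrow> r\<^sub>0 * R * 0 * g x"
    using \<kappa>_pos \<kappa>_less_1 by (intro tendsto_intros LIMSEQ_power_zero) auto
  then show "(\<lambda>l. r\<^sub>0 * R * \<kappa> ^ l * g x) \<longlonglongrightarrow> 0" by simp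
qed

lemma W_ratio_power: "(\<lambda>l. prob (W (l + j * p)) / prob (W l)) \<longlonglongrightarrow> g x ^ j"
proof (induction j)
  case 0
  have "prob (W l) \<noteq> 0" for l using W_pos[of l] by simp
  then show ?case by simp
next
  case (Suc j)
  have "(\<lambda>l. prob (W ((l + j * p) + p)) / prob (W (l + j * p))) \<longlonglongrightarrow> g x"
    by (rule LIMSEQ_ignore_initial_segment[OF W_ratio])
  then have "(\<lambda>l. (prob (W ((l + j * p) + p)) / prob (W (l + j * p))) * (prob (W (l + j * p)) / prob (W l)))
      \<longlonglongrightarrow> g x * g x ^ j"
    by (intro tendsto_mult Suc)
  moreover have "(prob (W ((l + j * p) + p)) / prob (W (l + j * p))) * (prob (W (l + j * p)) / prob (W l))
      = prob (W (l + Suc j * p)) / prob (W l)" for l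
    using W_pos[of "l + j * p"] by (simp add: ac_simps)
  ultimately show ?case by (simp only: power_Suc)
qed

text \<open>If \<open>g x \<ge> 1\<close>, the measure ratios over \<open>L\<close> periods would
  tend to at least \<open>1\<close>, whereas \<open>W_contraction\<close> keeps them at most
  \<open>1 - e\<close>. A single period may be shorter than the \<open>L\<close> letters that the
  contraction needs.\<close>

lemma g_less_1: "g x < 1"
proof (rule ccontr)
  assume "\<not> g x < 1"
  obtain L e where L: "0 < L" "0 < e" "e < 1"
    and contr: "\<And>l n. L \<le> n \<Longrightarrow> prob (W (l + n)) \<le> (1 - e) * prob (W l)"
    by (rule W_contraction) blast
  have "prob (W (l + L * p)) / prob (W l) \<le> 1 - e" for l
    using contr[of "L * p" l] p_pos W_pos[of l] by (simp add: pos_divide_le_eq)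
  then have "g x ^ L \<le> 1 - e" by (intro LIMSEQ_le_const2[OF W_ratio_power]) blast
  moreover have "1 \<le> g x ^ L" using \<open>\<not> g x < 1\<close> by (intro one_le_power) simp
  ultimately show False using L by linarith
qed

text \<open>Returns at a time \<open>i\<close> with \<open>(T ^^ i) x \<noteq> x\<close> disappear
  for large \<open>l\<close>. If \<open>(T ^^ i) x = x\<close>, the itinerary is
  \<open>i\<close>-periodic, and a point of \<open>W l\<close> returning at time
  \<open>i \<le> l\<close> follows it for \<open>i + l\<close> letters. Minimality gives
  \<open>p \<le> i\<close>, so the point lies in \<open>W (l + p)\<close>.\<close>

lemma shrinking_periodic:
  "shrinking_cylinders M T \<xi> \<kappa> R W (\<lambda>l. W (l + p)) p (1 - g x)"
proof unfold_locales
  fix l i :: nat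
  show "W l \<in> cylinders T \<xi> l" by (rule W_cylinder)
  show "0 < prob (W l)" by (rule W_pos)
  show "(\<lambda>l. prob (W l)) \<longlonglongrightarrow> 0" by (rule W_lim)
  show "0 < 1 - g x" "1 - g x \<le> 1" using g_less_1 g_pos by simp_all
  show "1 \<le> p" by (rule p_pos)
  show "W (l + p) \<subseteq> W l \<inter> (T ^^ p) -` W l"
    using W_antimono[of l "l + p"] W_add_period[of l] by auto
  show "W (l + p) = {} \<or> W (l + p) \<in> cylinders T \<xi> (l + p)" using W_cylinder by blast
  show "(\<lambda>l. prob (W (l + p)) / prob (W l)) \<longlonglongrightarrow> 1 - (1 - g x)" using W_ratio by simp
  show "W l \<subseteq> W i" if "i \<le> l" using that by (rule W_antimono)
  show "\<forall>\<^sub>F l in sequentially. W l \<inter> (T ^^ i) -` W l \<subseteq> W (l + p)" if i: "1 \<le> i"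
  proof (cases "(T ^^ i) x = x")
    case False
    from no_short_return[OF this] show ?thesis by (rule eventually_mono) simp
  next
    case True
    then have pi: "p \<le> i" using minimal i by (meson not_le)
    show ?thesis using eventually_ge_at_top[of i]
    proof eventually_elim
      case (elim l)
      show ?case
      proof
        fix y assume "y \<in> W l \<inter> (T ^^ i) -` W l"
        then have y: "y \<in> W l" "(T ^^ i) y \<in> W l" by auto
        show "y \<in> W (l + p)" unfolding mem_W_iff
        proof (intro allI impI)
          fix m assume m: "m < l + p"
          show "(T ^^ m) y \<in> w m"
          proof (cases "m < l")
            case True
            then show ?thesis using y unfolding mem_W_iff by blast
          next
            case False
            define j where "j = m - i"
            have j: "m = i + j" "j < l" using m False elim pi by (auto simp: j_def)
            have "(T ^^ j) ((T ^^ i) y) \<in> w j" using y j unfolding mem_W_iff by blast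
            then show ?thesis unfolding funpow_comp_apply j(1) symbol_shift[OF True] .
          qed
        qed
      qed
    qed
  qed
qed

end

theorem theorem3p1:
  fixes M :: "'a::metric_space measure"
    and T :: "'a \<Rightarrow> 'a"
    and \<xi> :: "'a set set"
    and v' :: "nat \<Rightarrow> 'a set \<Rightarrow> 'a \<Rightarrow> real"
    and x :: 'a
    and A :: "nat \<Rightarrow> 'a set"
    and r \<theta> :: real
    and V :: "'a measure set"
    and V\<^sub>l :: "nat \<Rightarrow> 'a measure set"
  assumes "gibbs_markov M T \<xi>"
    and "mixing M T"
    and "regular_versions M T \<xi> v'"
    and "\<And>l. l \<ge> 1 \<Longrightarrow> A l \<in> cylinders T \<xi> l \<and> x \<in> A l"
    and "\<And>l. l \<ge> 1 \<Longrightarrow> 0 < measure M (A l)"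
    and "(\<lambda>l. measure M (A l)) \<longlonglongrightarrow> 0"
    and "r > 0"
    and "V = {u \<odot> M |u. u \<in> regular_densities M T \<xi> r}"
    and "\<And>l. V\<^sub>l l = {u \<odot> M |u. u \<in> regular_densities_on M (A l) r}"
    and "\<not> periodic T x \<Longrightarrow> \<theta> = 1"
    and "periodic T x \<Longrightarrow> \<theta> = 1 - v' (min_period T x) (A (min_period T x)) x"
  shows "(periodic T x \<longrightarrow> 0 < \<theta> \<and> \<theta> < 1) \<and>
    (\<forall>d\<ge>1. \<forall>\<delta>. 0 < \<delta> \<and> \<delta> \<le> 1 \<longrightarrow>
      uniformly_asymp_equiv
        {(\<nu>, k). \<nu> \<in> V \<and> (\<forall>j\<in>{1..d}. k j \<in> time_scales M A \<delta>)}
        (\<lambda>(\<nu>, k) l. measure \<nu> (hitting_event T (A l) d (\<lambda>j. k j l)))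
        (\<lambda>(\<nu>, k) l. \<theta> ^ (2 * d - 1) * measure M (A l) ^ d
           * exp (- \<theta> * measure M (A l) * (\<Sum>j=1..d. real (k j l)))) \<and>
      uniformly_asymp_equiv
        {(\<nu>, k). (\<forall>l\<ge>1. \<nu> l \<in> V\<^sub>l l) \<and> (\<forall>j\<in>{1..d}. k j \<in> time_scales M A \<delta>)}
        (\<lambda>(\<nu>, k) l. measure (\<nu> l) (hitting_event T (A l) d (\<lambda>j. k j l)))
        (\<lambda>(\<nu>, k) l. \<theta> ^ (2 * d) * measure M (A l) ^ d
           * exp (- \<theta> * measure M (A l) * (\<Sum>j=1..d. real (k j l)))))"
proof -
  interpret gibbs_markov M T \<xi> by (rule assms(1))
  obtain \<kappa> R where \<kappa>: "0 < \<kappa>" "\<kappa> < 1" "0 < R" and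
    diam: "\<And>n B x y. B \<in> cylinders T \<xi> n \<Longrightarrow> x \<in> B \<Longrightarrow> y \<in> B \<Longrightarrow> dist x y \<le> R * \<kappa> ^ n" and
    dist: "\<And>n B Z E F. Z \<in> \<xi> \<Longrightarrow> B \<in> cylinders T \<xi> n \<Longrightarrow> E \<in> sets M \<Longrightarrow> F \<in> sets M \<Longrightarrow>
       E \<subseteq> B \<inter> T ` Z \<Longrightarrow> F \<subseteq> B \<inter> T ` Z \<Longrightarrow>
       prob (Z \<inter> T -` E) * prob F \<le> exp (R * \<kappa> ^ n) * prob (Z \<inter> T -` F) * prob E"
    by (rule branch_distortion) blast
  interpret distortion_control M T \<xi> \<kappa> R
    by unfold_locales (rule \<kappa>, rule \<kappa>, rule \<kappa>, erule (2) diam, erule (5) dist, rule assms(2))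
  \<comment> \<open>The elements of \<open>\<xi>\<close> are disjoint, so the letter is unique and
    the choice is harmless.\<close>
  define w where "w i = (SOME Z. Z \<in> \<xi> \<and> (T ^^ i) x \<in> Z)" for i
  have w: "w i \<in> \<xi> \<and> (T ^^ i) x \<in> w i" for i
  proof -
    obtain Z where "A (Suc i) = (\<Inter>j<Suc i. (T ^^ j) -` Z j)" "\<forall>j<Suc i. Z j \<in> \<xi>"
      using assms(4)[of "Suc i"] unfolding cylinders_def by auto
    moreover have "x \<in> A (Suc i)" using assms(4)[of "Suc i"] by simp
    ultimately have "Z i \<in> \<xi> \<and> (T ^^ i) x \<in> Z i" by blast
    then show ?thesis unfolding w_def by (rule someI)
  qed
  \<comment> \<open>The hypotheses say nothing about \<open>A 0\<close>, so the cylinders are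
    rebuilt from the itinerary, with \<open>W 0 = UNIV\<close>.\<close>
  define W where "W l = (\<Inter>i<l. (T ^^ i) -` w i)" for l
  have AW: "A l = W l" if "1 \<le> l" for l
  proof -
    have "W l \<in> cylinders T \<xi> l" unfolding W_def cylinders_def using w by blast
    moreover have "x \<in> W l" unfolding W_def using w by blast
    ultimately show ?thesis
      using cylinders_disjoint[OF disjoint_partition, of "A l" T l "W l"] assms(4)[OF that] by blast
  qed
  then have AW': "\<forall>l\<ge>1. A l = W l" by blast
  have pos: "0 < prob (W l)" for l
    using assms(5)[of l] AW[of l] by (cases "l = 0") (simp_all add: W_def)
  have lim: "(\<lambda>l. prob (W l)) \<longlonglongrightarrow> 0"
  proof (rule Lim_transform_eventually[OF assms(6)])
    show "\<forall>\<^sub>F l in sequentially. prob (A l) = prob (W l)"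
      using eventually_ge_at_top[of 1] by eventually_elim (simp add: AW)
  qed
  interpret coded_point M T \<xi> \<kappa> R x w W
    by unfold_locales (use w pos lim in \<open>auto simp: W_def\<close>)
  \<comment> \<open>The periodic and the aperiodic case differ only in the data \<open>D\<close>,
    \<open>p\<close> and \<open>\<theta>\<close> for early returns; the asymptotics are then
    obtained for both at once.\<close>
  have "\<exists>D p. shrinking_cylinders M T \<xi> \<kappa> R W D p \<theta> \<and> (periodic T x \<longrightarrow> 0 < \<theta> \<and> \<theta> < 1)"
  proof (cases "periodic T x")
    case False
    then show ?thesis using shrinking_aperiodic assms(10) by blast
  next
    case True
    define p where "p = min_period T x"
    obtain n where "1 \<le> n \<and> (T ^^ n) x = x" using True unfolding periodic_def by blast
    then have p: "1 \<le> p \<and> (T ^^ p) x = x" unfolding p_def min_period_def by (rule LeastI)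
    have min: "(T ^^ i) x \<noteq> x" if "1 \<le> i" "i < p" for i
      using not_less_Least[of i "\<lambda>p. 1 \<le> p \<and> (T ^^ p) x = x"] that unfolding p_def min_period_def by blast
    obtain r0 where r0: "r0 > 0" "\<forall>n\<ge>1. \<forall>Z\<in>cylinders T \<xi> n.
        inverse_branch_density M T n Z (v' n Z) \<and> ratio_lipschitz_on r0 ((T ^^ n) ` Z) (v' n Z)"
      using assms(3) unfolding regular_versions_def by blast
    have v: "inverse_branch_density M T p (W p) (v' p (W p))"
      "ratio_lipschitz_on r0 ((T ^^ p) ` W p) (v' p (W p))"
      using r0(2) p W_cylinder by blast+
    interpret coded_periodic_point M T \<xi> \<kappa> R x w W p "v' p (W p)" r0
      by unfold_locales (use p min v r0(1) in auto)
    have "\<theta> = 1 - v' p (W p) x" using assms(11)[OF True] AW p unfolding p_def by simp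
    then show ?thesis using shrinking_periodic g_pos g_less_1 by auto
  qed
  then obtain D p where sc: "shrinking_cylinders M T \<xi> \<kappa> R W D p \<theta>"
    and \<theta>: "periodic T x \<longrightarrow> 0 < \<theta> \<and> \<theta> < 1" by blast
  interpret shrinking_cylinders M T \<xi> \<kappa> R W D p \<theta> by (rule sc)
  show ?thesis
  proof (intro conjI allI impI)
    fix d :: nat and \<delta> :: real assume d: "1 \<le> d" and \<delta>: "0 < \<delta> \<and> \<delta> \<le> 1"
    show "uniformly_asymp_equiv
        {(\<nu>, k). \<nu> \<in> V \<and> (\<forall>j\<in>{1..d}. k j \<in> time_scales M A \<delta>)}
        (\<lambda>(\<nu>, k) l. measure \<nu> (hitting_event T (A l) d (\<lambda>j. k j l)))
        (\<lambda>(\<nu>, k) l. \<theta> ^ (2 * d - 1) * measure M (A l) ^ d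
           * exp (- \<theta> * measure M (A l) * (\<Sum>j=1..d. real (k j l))))"
      by (rule hitting_asymptotics_regular[OF AW' assms(7) d]) (use \<delta> assms(8) in auto)
    show "uniformly_asymp_equiv
        {(\<nu>, k). (\<forall>l\<ge>1. \<nu> l \<in> V\<^sub>l l) \<and> (\<forall>j\<in>{1..d}. k j \<in> time_scales M A \<delta>)}
        (\<lambda>(\<nu>, k) l. measure (\<nu> l) (hitting_event T (A l) d (\<lambda>j. k j l)))
        (\<lambda>(\<nu>, k) l. \<theta> ^ (2 * d) * measure M (A l) ^ d
           * exp (- \<theta> * measure M (A l) * (\<Sum>j=1..d. real (k j l))))"
      by (rule hitting_asymptotics_cylinder[OF AW' assms(7)]) (use \<delta> assms(9) in auto)
  qed (use \<theta> in auto)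
qed

end
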